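(* Let $\lambda_1,\ldots,\lambda_k\ge 0$ and let $B_i:\mathbb{R}^n\to\mathbb{R}^{n_i}$, $i=1,\ldots,k$, be linear maps such that $$\sum_{i=1}^k\lambda_iB_i^*B_i=I_n,\qquad B_iB_i^*=I_{n_i}\ \text{ for all } i.$$ Let $c\in(0,1)$, and let $f_1,\ldots,f_k,h$ be Borel measurable functions $f_i:\mathbb{R}^{n_i}\to\mathbb{R}$, $h:\mathbb{R}^n\to\mathbb{R}$ with values in $[0,1]$. Suppose that $$\lambda_1\Phi_c^{-1}(f_1(x_1))+\cdots+\lambda_k\Phi_c^{-1}(f_k(x_k)) \le \Phi_c^{-1}(h(\lambda_1B_1^*x_1+\cdots+\lambda_kB_k^*x_k))$$ for all $x_i\in\mathbb{R}^{n_i}$, $i=1,\ldots,k$. Then $$\lambda_1\Phi_c^{-1}\bigg(\int f_1\,d\gamma_{n_1}\bigg)+\cdots+\lambda_k\Phi_c^{-1}\bigg(\int f_k\,d\gamma_{n_k}\bigg)\le\Phi_c^{-1}\bigg(\int h\,d\gamma_n\bigg).$$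
   Context: $\gamma_m$ is the standard Gaussian measure on $\mathbb{R}^m$, $\Phi(x):=\gamma_1((-\infty,x])$, and $\Phi^{-1}$ is its inverse, extended by $\Phi^{-1}(0)=-\infty$ and $\Phi^{-1}(1)=+\infty$. For $c\in(0,1)$ define $\Phi_c^{-1}(x):=\Phi^{-1}(cx)-\Phi^{-1}(c)$ for $x\in[0,1]$, so that $\Phi_c^{-1}$ takes values in $[-\infty,0]$, with $\Phi_c^{-1}(0)=-\infty$. Products and sums are taken in $[-\infty,0]$, with the convention $\lambda\cdot(-\infty)=-\infty$ for all $\lambda\ge 0$ (including $\lambda=0$). $B^*$ denotes the adjoint (transpose) of $B$, and $I_m$ the identity on $\mathbb{R}^m$. *)

theory Defs
  imports "HOL-Probability.Probability" "Jordan_Normal_Form.Matrix"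
begin

text \<open>
  The dimensions vary with an index, so \<open>\<real>\<^sup>d\<close> is \<open>carrier_vec d\<close>, and linear maps and their
  adjoints are real matrices (\<open>carrier_mat\<close>) and their transposes.  The names \<open>vec\<close> and \<open>$\<close> exist
  both in HOL-Analysis and in \<open>Matrix\<close>; the latter is meant throughout.
\<close>

definition borel_vec :: "nat \<Rightarrow> real Matrix.vec measure" where
  "borel_vec d = embed_measure (\<Pi>\<^sub>M i\<in>{..<d}. borel) (Matrix.vec d)"

definition std_gaussian :: "nat \<Rightarrow> real Matrix.vec measure" where
  "std_gaussian d = embed_measure (\<Pi>\<^sub>M i\<in>{..<d}. std_normal_distribution) (Matrix.vec d)"

text \<open>The argument is meant to lie in \<open>[0,1]\<close>; \<open>cdf std_normal_distribution\<close> is a bijection onto \<open>]0,1[\<close>.\<close>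

definition Phi_inv :: "real \<Rightarrow> ereal" where
  "Phi_inv p = (if p = 0 then -\<infinity> else if p = 1 then \<infinity>
                else ereal (inv_into UNIV (cdf std_normal_distribution) p))"

definition Phi_inv_c :: "real \<Rightarrow> real \<Rightarrow> ereal" where
  "Phi_inv_c c x = Phi_inv (c * x) - Phi_inv c"

text \<open>
  Multiplication of an element of \<open>[-\<infinity>,0]\<close> by a nonnegative scalar with \<open>0 \<cdot> (-\<infinity>) = -\<infinity>\<close>;
  in \<open>ereal\<close> that product would be \<open>0\<close>.
\<close>

definition scale_ninf :: "real \<Rightarrow> ereal \<Rightarrow> ereal" where
  "scale_ninf l y = (if y = -\<infinity> then -\<infinity> else ereal l * y)"

lemma inj_on_vec_PiE: "inj_on (Matrix.vec d) (PiE {..<d} (\<lambda>_. A))"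
proof (rule inj_onI)
  fix x y :: "nat \<Rightarrow> 'a"
  assume x: "x \<in> PiE {..<d} (\<lambda>_. A)" and y: "y \<in> PiE {..<d} (\<lambda>_. A)"
    and eq: "Matrix.vec d x = Matrix.vec d y"
  have "x i = y i" if "i < d" for i
    using arg_cong[OF eq, of "\<lambda>v. vec_index v i"] that by simp
  then show "x = y" by (intro PiE_ext[OF x y]) simp
qed

lemma vec_image_PiE_UNIV: "Matrix.vec d ` PiE {..<d} (\<lambda>_. UNIV) = carrier_vec d"
proof (rule equalityI)
  show "Matrix.vec d ` PiE {..<d} (\<lambda>_. UNIV) \<subseteq> (carrier_vec d :: 'a Matrix.vec set)"
    by (rule image_subsetI) (rule vec_carrier)
  show "carrier_vec d \<subseteq> Matrix.vec d ` PiE {..<d} (\<lambda>_. UNIV :: 'a set)"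
  proof (rule subsetI)
    fix v :: "'a Matrix.vec" assume v: "v \<in> carrier_vec d"
    show "v \<in> Matrix.vec d ` PiE {..<d} (\<lambda>_. UNIV)"
    proof (rule image_eqI)
      show "v = Matrix.vec d (restrict (vec_index v) {..<d})"
        using v by (intro eq_vecI) auto
    qed (rule restrict_PiE_iff[THEN iffD2], simp)
  qed
qed

lemma space_borel_vec: "space (borel_vec d) = carrier_vec d"
  by (simp add: borel_vec_def space_embed_measure space_PiM vec_image_PiE_UNIV)

lemma space_std_gaussian: "space (std_gaussian d) = carrier_vec d"
  by (simp add: std_gaussian_def space_embed_measure space_PiM vec_image_PiE_UNIV)

lemma sets_std_gaussian: "sets (std_gaussian d) = sets (borel_vec d)"
proof -
  have "sets (\<Pi>\<^sub>M i\<in>{..<d}. std_normal_distribution) = sets (\<Pi>\<^sub>M i\<in>{..<d}. (borel :: real measure))"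
    by (intro sets_PiM_cong) auto
  moreover have "inj_on (Matrix.vec d) (space (\<Pi>\<^sub>M i\<in>{..<d}. std_normal_distribution))"
    and "inj_on (Matrix.vec d) (space (\<Pi>\<^sub>M i\<in>{..<d}. (borel :: real measure)))"
    by (simp_all add: space_PiM inj_on_vec_PiE)
  ultimately show ?thesis
    unfolding std_gaussian_def borel_vec_def by (simp only: sets_embed_measure')
qed

lemma prob_space_std_gaussian: "prob_space (std_gaussian d)"
proof -
  let ?M = "\<Pi>\<^sub>M i\<in>{..<d}. std_normal_distribution"
  have M: "prob_space ?M"
    by (intro prob_space_PiM prob_space_normal_density) simp
  have inj: "inj_on (Matrix.vec d) (space ?M)"
    by (simp add: space_PiM inj_on_vec_PiE)
  have "prob_space (distr ?M (embed_measure ?M (Matrix.vec d)) (Matrix.vec d))"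
    by (intro prob_space.prob_space_distr M measurable_embed_measure2' inj)
  then show ?thesis
    unfolding std_gaussian_def by (subst embed_measure_eq_distr'[OF inj])
qed

end

theory Submission
  imports Defs
begin

text \<open>
  With \<open>u\<^sub>i(t,\<cdot>)\<close> the heat flow of \<open>c f\<^sub>i\<close>, the functions \<open>v\<^sub>i = \<Phi>\<inverse>(u\<^sub>i)\<close> solve
  \<open>\<partial>\<^sub>t v = (\<Delta>v - v |\<nabla>v|\<^sup>2) / 2\<close>.  At a maximum of \<open>\<Sum>\<^sub>i \<lambda>\<^sub>i v\<^sub>i(x\<^sub>i)\<close> over a fibre of \<open>x \<mapsto> \<Sum>\<^sub>i \<lambda>\<^sub>i B\<^sub>i\<^sup>* x\<^sub>i\<close> the gradients are
  \<open>B\<^sub>i p\<close> for a common \<open>p\<close>, and then \<open>\<Sum>\<^sub>i \<lambda>\<^sub>i |B\<^sub>i p|\<^sup>2 = |p|\<^sup>2\<close>, \<open>|B\<^sub>i p| \<le> |p|\<close> and \<open>v\<^sub>i \<le> \<Phi>\<inverse>(c)\<close> show that the hypothesis is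
  propagated by the flow.  Instead of differentiating in time, we take time steps of length \<open>\<sigma>\<^sup>2\<close>: moving all \<open>x\<^sub>i\<close> by
  \<open>\<sigma> B\<^sub>i G\<close> with the same Gaussian vector \<open>G\<close>, a Taylor expansion of \<open>\<Phi>\<close> to third order loses only \<open>O(\<sigma>\<^sup>3)\<close> per
  step, and there are \<open>\<sigma>\<^sup>-\<^sup>2\<close> steps.  This needs only that the \<open>u\<^sub>i\<close> have Lipschitz gradients, and no regularity of \<open>h\<close>.
  Borel functions are reduced to Lipschitz ones by inner regularity, applied to the hypographs of the \<open>f\<^sub>i\<close>.
\<close>

subsection \<open>Measures determined by their cosine integrals\<close>

text \<open>The induction hypothesis has the form \<open>Phi (a + m + ...) \<le> H\<close> with
  \<open>Phi a = c\<close>; the slack \<open>m\<close> carries the accumulated losses, and the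
  right-hand side is only ever averaged over the noise. Maxima over fibres need not be attained, as
  fibres may be unbounded, so the gradients match only approximately: a maximiser up to \<sigma>^4,
  tested with displacements of size \<sigma>^2, has a squared mismatch O(\<sigma>^2), which costs
  O(\<sigma>) in the quadratic form. Constants that are uniform over all steps require values in a
  compact part of ]0,1[ and a positive starting time; hence the cut-off \<eta> and the delay \<tau>,
  both sent to 0 afterwards. The compact hypograph yields a minorant of f_i with almost the same
  integral; Lipschitz functions decrease to it from above, and h is replaced by their fibrewise
  supremum, again Lipschitz, whose limit is controlled by compactness. The convention 0 times
  -\<infinity> = -\<infinity> makes the hypothesis void where some f_i vanishes, even with weight
  zero. Indices of weight zero are therefore removed by fixing for each of them a point where f_i is
  positive, which exists unless the conclusion is trivial.\<close>

lemma weighted_indicator_eq_nonneg: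
  fixes X w :: "'a \<Rightarrow> real"
  assumes fin: "finite_measure M" "finite_measure N" and sets: "sets N = sets M"
    and X[measurable]: "X \<in> borel_measurable M" and w[measurable]: "w \<in> borel_measurable M"
    and bnd: "\<And>x. 0 \<le> w x" "\<And>x. w x \<le> 2"
    and eq: "\<And>t s. (\<integral>x. w x * cos (t * X x + s) \<partial>M) = (\<integral>x. w x * cos (t * X x + s) \<partial>N)"
    and A[measurable]: "A \<in> sets borel"
  shows "(\<integral>x. w x * indicator A (X x) \<partial>M) = (\<integral>x. w x * indicator A (X x) \<partial>N)"
proof -
  define m where "m = (\<integral>x. w x \<partial>M)"
  have mN: "m = (\<integral>x. w x \<partial>N)" using eq[of 0 0] by (simp add: m_def)
  have m0: "m \<ge> 0" unfolding m_def using bnd by (simp add: integral_nonneg_AE)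
  have mN'[measurable]: "X \<in> borel_measurable N" "w \<in> borel_measurable N"
    using X w by (simp_all add: measurable_cong_sets[OF sets refl])
  have intw: "integrable P w" if "finite_measure P" "w \<in> borel_measurable P" for P
    using that bnd by (intro finite_measure.integrable_const_bound[where B=2]) auto
  show ?thesis
  \<comment> \<open>A zero total mass cannot be normalised; then \<open>w\<close> vanishes almost
    everywhere and both sides are 0.\<close>
  proof (cases "m = 0")
    case True
    have *: "(\<integral>x. w x * indicator A (X x) \<partial>P) = 0"
      if "finite_measure P" "w \<in> borel_measurable P" "X \<in> borel_measurable P" "(\<integral>x. w x \<partial>P) = 0" for P
    proof -
      have "AE x in P. w x = 0"
        using integral_nonneg_eq_0_iff_AE[OF intw[OF that(1,2)]] that(4) bnd by simp
      then have "(\<integral>x. w x * indicator A (X x) \<partial>P) = (\<integral>x. 0 \<partial>P)"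
        using that(2,3) by (intro integral_cong_AE) auto
      then show ?thesis by simp
    qed
    show ?thesis using *[of M] *[of N] fin True mN by (simp add: m_def)
  next
    case False
    then have mpos: "m > 0" using m0 by simp
    \<comment> \<open>The law of \<open>X\<close> under the probability measure with density
      \<open>w x / m\<close>. This reduces the claim to distributions on the line, where Levy's
      uniqueness theorem applies.\<close>
    define D where "D P = distr (density P (\<lambda>x. ennreal (w x / m))) borel X" for P
    have R: "real_distribution (D P) \<and> (\<forall>g::real \<Rightarrow> real. g \<in> borel_measurable borel \<longrightarrow>
        (\<integral>y. g y \<partial>D P) = (\<integral>x. w x * g (X x) \<partial>P) / m)"
      if fP: "finite_measure P" and [measurable]: "w \<in> borel_measurable P" "X \<in> borel_measurable P"
        and mP: "(\<integral>x. w x \<partial>P) = m" for P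
    proof
      have i: "integrable P w" by (rule intw) (use fP in simp_all)
      have "(\<integral>\<^sup>+ x. ennreal (w x / m) \<partial>P) = ennreal (\<integral>x. w x / m \<partial>P)"
        using i bnd mpos by (intro nn_integral_eq_integral) auto
      also have "\<dots> = 1" using mP mpos by simp
      finally have "prob_space (density P (\<lambda>x. ennreal (w x / m)))"
        by (intro prob_spaceI) (simp add: emeasure_density cong: nn_integral_cong)
      then have "prob_space (D P)"
        unfolding D_def by (intro prob_space.prob_space_distr) simp_all
      then show "real_distribution (D P)"
        unfolding real_distribution_def real_distribution_axioms_def by (simp add: D_def)
      show "\<forall>g::real \<Rightarrow> real. g \<in> borel_measurable borel \<longrightarrow>
        (\<integral>y. g y \<partial>D P) = (\<integral>x. w x * g (X x) \<partial>P) / m"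
      proof (intro allI impI)
        fix g :: "real \<Rightarrow> real" assume [measurable]: "g \<in> borel_measurable borel"
        have "(\<integral>y. g y \<partial>D P) = (\<integral>x. (w x / m) *\<^sub>R g (X x) \<partial>P)"
          unfolding D_def by (subst integral_distr, simp, simp, subst integral_density) (use bnd mpos in auto)
        then show "(\<integral>y. g y \<partial>D P) = (\<integral>x. w x * g (X x) \<partial>P) / m" by simp
      qed
    qed
    have RM: "real_distribution (D M)" "\<And>g::real \<Rightarrow> real. g \<in> borel_measurable borel \<Longrightarrow>
        (\<integral>y. g y \<partial>D M) = (\<integral>x. w x * g (X x) \<partial>M) / m"
      using R[of M] fin by (auto simp: m_def)
    have RN: "real_distribution (D N)" "\<And>g::real \<Rightarrow> real. g \<in> borel_measurable borel \<Longrightarrow>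
        (\<integral>y. g y \<partial>D N) = (\<integral>x. w x * g (X x) \<partial>N) / m"
      using R[of N] fin mN by auto
    \<comment> \<open>Since sin y = cos (y - pi/2), real cosine integrals with a free phase
      determine the complex characteristic function.\<close>
    have cheq: "char P t = complex_of_real (\<integral>y. cos (t * y + 0) \<partial>P) + \<i> * complex_of_real (\<integral>y. cos (t * y + - (pi/2)) \<partial>P)"
      if "real_distribution P" for P t
    proof -
      interpret real_distribution P by fact
      have c: "integrable P (\<lambda>y. cos (t * y + s))" for s
        by (intro integrable_const_bound[where B=1]) auto
      have "char P t = (CLINT y|P. complex_of_real (cos (t * y + 0)) + \<i> * complex_of_real (cos (t * y + - (pi/2))))"
        unfolding char_def by (intro Bochner_Integration.integral_cong refl)
          (simp add: complex_eq_iff Re_exp Im_exp cos_diff)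
      also have "\<dots> = complex_of_real (\<integral>y. cos (t * y + 0) \<partial>P) + \<i> * complex_of_real (\<integral>y. cos (t * y + - (pi/2)) \<partial>P)"
        using c[of 0] c[of "- (pi/2)"]
        by (subst Bochner_Integration.integral_add) (auto simp: integral_mult_right_zero intro!: integrable_mult_right)
      finally show ?thesis .
    qed
    have "char (D M) = char (D N)"
    proof
      fix t
      have "(\<integral>y. cos (t * y + r) \<partial>D M) = (\<integral>y. cos (t * y + r) \<partial>D N)" for r
        by (subst RM(2), simp, subst RN(2), simp) (simp only: eq)
      then show "char (D M) t = char (D N) t"
        unfolding cheq[OF RM(1)] cheq[OF RN(1)] by (simp only:)
    qed
    then have "D M = D N" using Levy_uniqueness RM(1) RN(1) by blast
    then have "(\<integral>x. w x * indicator A (X x) \<partial>M) / m = (\<integral>x. w x * indicator A (X x) \<partial>N) / m"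
      using RM(2)[of "indicator A"] RN(2)[of "indicator A"] by simp
    then show ?thesis using False by simp
  qed
qed

text \<open>
  Only the case \<open>w \<ge> 0\<close> is covered by Levy's theorem for probability measures; apply it to \<open>w + 1\<close> and to \<open>1\<close>.
\<close>

lemma weighted_indicator_eq:
  fixes X w :: "'a \<Rightarrow> real"
  assumes fin: "finite_measure M" "finite_measure N" and sets: "sets N = sets M"
    and X[measurable]: "X \<in> borel_measurable M" and w[measurable]: "w \<in> borel_measurable M"
    and bnd: "\<And>x. \<bar>w x\<bar> \<le> 1"
    and eq1: "\<And>t s. (\<integral>x. cos (t * X x + s) \<partial>M) = (\<integral>x. cos (t * X x + s) \<partial>N)"
    and eq: "\<And>t s. (\<integral>x. w x * cos (t * X x + s) \<partial>M) = (\<integral>x. w x * cos (t * X x + s) \<partial>N)"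
    and A[measurable]: "A \<in> sets borel"
  shows "(\<integral>x. w x * indicator A (X x) \<partial>M) = (\<integral>x. w x * indicator A (X x) \<partial>N)"
proof -
  have mN'[measurable]: "X \<in> borel_measurable N" "w \<in> borel_measurable N"
    using X w by (simp_all add: measurable_cong_sets[OF sets refl])
  have i: "integrable P (\<lambda>x. g (X x))" "integrable P (\<lambda>x. w x * g (X x))"
    if "finite_measure P" "w \<in> borel_measurable P" "X \<in> borel_measurable P" "g \<in> borel_measurable borel" "\<And>y. \<bar>g y\<bar> \<le> 1" for P and g :: "real \<Rightarrow> real"
  proof -
    note [measurable] = that(2-4)
    interpret finite_measure P by fact
    show "integrable P (\<lambda>x. g (X x))" by (intro integrable_const_bound[where B=1]) (use that in auto)
    show "integrable P (\<lambda>x. w x * g (X x))"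
      by (intro integrable_const_bound[where B=1]) (use that bnd in \<open>auto simp: abs_mult intro!: mult_le_one\<close>)
  qed
  have split: "(\<integral>x. (w x + 1) * g (X x) \<partial>P) = (\<integral>x. w x * g (X x) \<partial>P) + (\<integral>x. g (X x) \<partial>P)"
    if "finite_measure P" "w \<in> borel_measurable P" "X \<in> borel_measurable P" "g \<in> borel_measurable borel" "\<And>y. \<bar>g y\<bar> \<le> 1" for P and g :: "real \<Rightarrow> real"
    using i[OF that] by (simp add: distrib_right)
  have b: "0 \<le> w x + 1" "w x + 1 \<le> 2" for x using bnd[of x] by (auto simp: abs_le_iff)
  have "(\<integral>x. (w x + 1) * indicator A (X x) \<partial>M) = (\<integral>x. (w x + 1) * indicator A (X x) \<partial>N)"
  proof (rule weighted_indicator_eq_nonneg[OF fin sets X])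
    fix t s show "(\<integral>x. (w x + 1) * cos (t * X x + s) \<partial>M) = (\<integral>x. (w x + 1) * cos (t * X x + s) \<partial>N)"
      using split[of M "\<lambda>y. cos (t * y + s)"] split[of N "\<lambda>y. cos (t * y + s)"] eq eq1 fin by simp
  qed (use b A in auto)
  moreover have "(\<integral>x. 1 * indicator A (X x) \<partial>M) = (\<integral>x. (1::real) * indicator A (X x) \<partial>N)"
  proof (rule weighted_indicator_eq_nonneg[OF fin sets X])
    fix t s show "(\<integral>x. 1 * cos (t * X x + s) \<partial>M) = (\<integral>x. 1 * cos (t * X x + s) \<partial>N)"
      using eq1 by simp
  qed (use A in auto)
  ultimately show ?thesis
    using split[of M "indicator A"] split[of N "indicator A"] fin by (simp add: indicator_def)
qed

text \<open>Indicators of coordinate sets are introduced one coordinate at a time, each time by the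
  one-dimensional uniqueness theorem, with the factors already obtained as weight.\<close>

lemma measure_eq_of_cos_integrals:
  fixes M N :: "('i \<Rightarrow> real) measure"
  assumes fin: "finite_measure M" "finite_measure N"
    and sets: "sets M = sets (PiM I (\<lambda>_. borel))" "sets N = sets (PiM I (\<lambda>_. borel))"
    and eq: "\<And>J \<theta> s. finite J \<Longrightarrow> J \<subseteq> I \<Longrightarrow>
      (\<integral>x. cos ((\<Sum>j\<in>J. \<theta> j * x j) + s) \<partial>M) = (\<integral>x. cos ((\<Sum>j\<in>J. \<theta> j * x j) + s) \<partial>N)"
  shows "M = N"
proof (rule measure_eqI_PiM_infinite[OF sets])
  interpret M: finite_measure M by fact
  interpret N: finite_measure N by fact
  fix A :: "'i \<Rightarrow> real set" and J assume J: "finite J" "J \<subseteq> I" and A: "\<And>i. i \<in> J \<Longrightarrow> A i \<in> sets borel"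
  have mc: "(\<lambda>x. x j) \<in> borel_measurable P" if "j \<in> J" "sets P = sets (PiM I (\<lambda>_. borel))" for j and P :: "('i \<Rightarrow> real) measure"
    using that J measurable_component_singleton[of j I "\<lambda>_. borel"] by (simp add: measurable_cong_sets[OF that(2) refl] subset_eq)
  \<comment> \<open>The cosine of the whole linear form stays in the statement, with \<theta> and
    \<open>s\<close> arbitrary, because the induction step changes both.\<close>
  have claim: "(\<integral>x. (\<Prod>j\<in>K. indicator (A j) (x j)) * cos ((\<Sum>j\<in>J. \<theta> j * x j) + s) \<partial>M)
      = (\<integral>x. (\<Prod>j\<in>K. indicator (A j) (x j)) * cos ((\<Sum>j\<in>J. \<theta> j * x j) + s) \<partial>N)"
    if "finite K" "K \<subseteq> J" for K \<theta> s
    using that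
  proof (induction K arbitrary: \<theta> s rule: finite_induct)
    case empty then show ?case using eq[OF J] by simp
  next
    case (insert k K)
    define ww :: "('i \<Rightarrow> real) \<Rightarrow> real" where "ww x = (\<Prod>j\<in>K. indicator (A j) (x j)) * cos ((\<Sum>j\<in>J. \<theta> j * x j) + s)" for x
    have pm[measurable]: "(\<lambda>x. \<Prod>j\<in>K. indicator (A j) (x j) :: real) \<in> borel_measurable P"
      "(\<lambda>x. cos ((\<Sum>j\<in>J. \<theta> j * x j) + s)) \<in> borel_measurable P"
      if "sets P = sets (PiM I (\<lambda>_. borel))" for \<theta> s and P :: "('i \<Rightarrow> real) measure"
    proof -
      have "(\<lambda>x. indicator (A j) (x j) :: real) \<in> borel_measurable P" if "j \<in> K" for j
        using mc[of j P] A[of j] that insert.prems \<open>sets P = _\<close> by (intro measurable_compose[of "\<lambda>x. x j" P borel "indicator (A j)"] borel_measurable_indicator) auto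
      then show "(\<lambda>x. \<Prod>j\<in>K. indicator (A j) (x j) :: real) \<in> borel_measurable P" by (intro borel_measurable_prod) auto
      have "(\<lambda>x. (\<Sum>j\<in>J. \<theta> j * x j) + s) \<in> borel_measurable P"
        using mc that by (intro borel_measurable_add borel_measurable_sum borel_measurable_times borel_measurable_const) auto
      then show "(\<lambda>x. cos ((\<Sum>j\<in>J. \<theta> j * x j) + s)) \<in> borel_measurable P" by simp
    qed
    have pb: "\<bar>\<Prod>j\<in>K. indicator (A j) (x j) :: real\<bar> \<le> 1" for x :: "'i \<Rightarrow> real"
      by (auto simp: abs_prod intro!: prod_le_1)
    have ip: "integrable P (\<lambda>x. (\<Prod>j\<in>K. indicator (A j) (x j)) * cos ((\<Sum>j\<in>J. \<theta> j * x j) + s))"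
      if "sets P = sets (PiM I (\<lambda>_. borel))" "finite_measure P" for \<theta> s and P :: "('i \<Rightarrow> real) measure"
      using that pm[OF that(1)] pb by (intro finite_measure.integrable_const_bound[where B=1]) (auto simp: abs_mult intro!: mult_le_one)
    have shift: "(\<Sum>j\<in>J. (\<theta> j + (if j = k then t else 0)) * x j) = (\<Sum>j\<in>J. \<theta> j * x j) + t * x k" for t and x :: "'i \<Rightarrow> real"
    proof -
      have "(\<Sum>j\<in>J. (\<theta> j + (if j = k then t else 0)) * x j) = (\<Sum>j\<in>J. \<theta> j * x j + (if j = k then t * x k else 0))"
        by (intro sum.cong) (auto simp: distrib_right)
      then show ?thesis using J insert.prems by (simp add: sum.distrib)
    qed
    \<comment> \<open>The product-to-sum formula absorbs the test function
      \<open>cos (t * x k + r)\<close> into frequency and phase of the existing cosine, so the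
      induction hypothesis applies to both summands.\<close>
    have ww: "ww x * cos (t * x k + r) =
       ((\<Prod>j\<in>K. indicator (A j) (x j)) * cos ((\<Sum>j\<in>J. (\<theta> j + (if j = k then t else 0)) * x j) + (s + r))
       + (\<Prod>j\<in>K. indicator (A j) (x j)) * cos ((\<Sum>j\<in>J. (\<theta> j + (if j = k then - t else 0)) * x j) + (s - r))) / 2" for x t r
    proof -
      define S where "S = (\<Sum>j\<in>J. \<theta> j * x j)"
      have "cos (S + s) * cos (t * x k + r) = (cos (S + t * x k + (s + r)) + cos (S + - t * x k + (s - r))) / 2"
      proof -
        have e: "S + t * x k + (s + r) = (S + s) + (t * x k + r)" "S + - t * x k + (s - r) = (S + s) - (t * x k + r)" by simp_all
        show ?thesis unfolding e by (simp add: cos_add cos_diff)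
      qed
      then show ?thesis unfolding shift ww_def S_def[symmetric] by (simp add: distrib_left mult.assoc)
    qed
    have "(\<integral>x. ww x * indicator (A k) (x k) \<partial>M) = (\<integral>x. ww x * indicator (A k) (x k) \<partial>N)"
    proof (rule weighted_indicator_eq[OF fin])
      show "sets N = sets M" using sets by simp
      show "(\<lambda>x. x k) \<in> borel_measurable M" using mc[of k M] insert.prems sets by auto
      show "ww \<in> borel_measurable M" unfolding ww_def using pm[OF sets(1)] by simp
      show "\<bar>ww x\<bar> \<le> 1" for x unfolding ww_def using pb[of x] by (auto simp: abs_mult intro!: mult_le_one)
      show "(\<integral>x. cos (t * x k + r) \<partial>M) = (\<integral>x. cos (t * x k + r) \<partial>N)" for t r
        using eq[of "{k}" "\<lambda>_. t" r] J insert.prems by auto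
      show "(\<integral>x. ww x * cos (t * x k + r) \<partial>M) = (\<integral>x. ww x * cos (t * x k + r) \<partial>N)" for t r
        unfolding ww using insert.IH insert.prems ip[OF sets(1) fin(1)] ip[OF sets(2) fin(2)] by simp
      show "A k \<in> sets borel" using A insert.prems by auto
    qed
    then show ?case using insert.hyps by (simp add: ww_def mult_ac)
  qed
  have meq: "measure P (prod_emb I (\<lambda>_. borel) J (Pi\<^sub>E J A)) = (\<integral>x. (\<Prod>j\<in>J. indicator (A j) (x j)) * cos ((\<Sum>j\<in>J. 0 * x j) + 0) \<partial>P)"
    if s: "sets P = sets (PiM I (\<lambda>_. borel))" and "finite_measure P" for P :: "('i \<Rightarrow> real) measure"
  proof -
    interpret finite_measure P by fact
    have sp: "space P = PiE I (\<lambda>_. UNIV)" using sets_eq_imp_space_eq[OF s] by (simp add: space_PiM)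
    have "prod_emb I (\<lambda>_. borel) J (Pi\<^sub>E J A) \<in> sets P"
      unfolding s using A J by (intro sets_PiM_I) auto
    then have "measure P (prod_emb I (\<lambda>_. borel) J (Pi\<^sub>E J A)) = (\<integral>x. indicator (prod_emb I (\<lambda>_. borel) J (Pi\<^sub>E J A)) x \<partial>P)"
      by simp
    also have "\<dots> = (\<integral>x. (\<Prod>j\<in>J. indicator (A j) (x j)) * cos ((\<Sum>j\<in>J. 0 * x j) + 0) \<partial>P)"
    proof (intro Bochner_Integration.integral_cong refl)
      fix x assume "x \<in> space P"
      then have "x \<in> extensional I" by (auto simp: sp PiE_def)
      then show "indicator (prod_emb I (\<lambda>_. borel) J (Pi\<^sub>E J A)) x = (\<Prod>j\<in>J. indicator (A j) (x j)) * cos ((\<Sum>j\<in>J. 0 * x j) + 0)"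
        using J by (auto simp: prod_emb_def indicator_def PiE_def Pi_def restrict_def extensional_def)
    qed
    finally show ?thesis .
  qed
  show "emeasure M (prod_emb I (\<lambda>_. borel) J (Pi\<^sub>E J A)) = emeasure N (prod_emb I (\<lambda>_. borel) J (Pi\<^sub>E J A))"
    using meq[OF sets(1) fin(1)] meq[OF sets(2) fin(2)] claim[of J "\<lambda>_. 0" 0] J
    by (simp add: M.emeasure_eq_measure N.emeasure_eq_measure)
qed (rule fin(1))

subsection \<open>The standard Gaussian measure\<close>

text \<open>
  A single measure on sequences serves all dimensions: a function on \<open>\<real>\<^sup>d\<close> is regarded as a function of
  the first \<open>d\<close> coordinates.
\<close>

definition gauss :: "(nat \<Rightarrow> real) measure"
  where "gauss = PiM UNIV (\<lambda>_. std_normal_distribution)"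

lemma prob_space_std_normal: "prob_space std_normal_distribution"
  by (intro prob_space_normal_density) simp

lemma product_prob_space_std_normal: "product_prob_space (\<lambda>_::nat. std_normal_distribution)"
  by (simp add: product_prob_space_def product_sigma_finite_def product_prob_space_axioms_def
      prob_space_std_normal prob_space_imp_sigma_finite)

lemma sets_gauss: "sets gauss = sets (PiM UNIV (\<lambda>_. borel))"
  unfolding gauss_def by (intro sets_PiM_cong) auto

lemma sets_gauss_borel[measurable_cong, simp]: "sets gauss = sets borel"
  unfolding sets_gauss by (rule sets_PiM_equal_borel)

lemma space_gauss[simp]: "space gauss = UNIV"
  unfolding gauss_def by (simp add: space_PiM)

interpretation gauss: prob_space gauss
  unfolding gauss_def by (intro prob_space_PiM prob_space_std_normal)

lemma measurable_coord[measurable]: "(\<lambda>\<omega>::nat \<Rightarrow> real. \<omega> q) \<in> borel_measurable borel"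
  by (rule measurable_product_coordinates)

lemma measurable_into_fun: "(\<And>q. (\<lambda>x. f x q) \<in> borel_measurable M) \<Longrightarrow> f \<in> measurable M (borel :: (nat \<Rightarrow> real) measure)"
  by (rule measurable_coordinatewise_then_product)

lemma distr_gauss_restrict: 
  assumes "finite J"
  shows "distr gauss (PiM J (\<lambda>_. std_normal_distribution)) (\<lambda>\<omega>. restrict \<omega> J) = PiM J (\<lambda>_. std_normal_distribution)"
  unfolding gauss_def by (rule product_prob_space.distr_PiM_restrict_finite[OF product_prob_space_std_normal]) (use assms in auto)

text \<open>Independence of the coordinates. The values lie in a normed field because both real
  moments and complex exponentials are integrated this way.\<close>

lemma gauss_prod:
  fixes f :: "nat \<Rightarrow> real \<Rightarrow> 'b::{real_normed_field,banach,second_countable_topology}"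
  assumes J: "finite J" and i: "\<And>j. j \<in> J \<Longrightarrow> integrable std_normal_distribution (f j)"
  shows "integrable gauss (\<lambda>\<omega>. \<Prod>j\<in>J. f j (\<omega> j))"
    and "(\<integral>\<omega>. (\<Prod>j\<in>J. f j (\<omega> j)) \<partial>gauss) = (\<Prod>j\<in>J. \<integral>x. f j x \<partial>std_normal_distribution)"
proof -
  interpret product_prob_space "\<lambda>_::nat. std_normal_distribution" by (rule product_prob_space_std_normal)
  have mr: "(\<lambda>\<omega>. restrict \<omega> J) \<in> measurable gauss (PiM J (\<lambda>_. std_normal_distribution))"
    unfolding gauss_def by (rule measurable_restrict_subset) simp
  have I: "integrable (PiM J (\<lambda>_. std_normal_distribution)) (\<lambda>\<omega>. \<Prod>j\<in>J. f j (\<omega> j))"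
    by (rule product_integrable_prod[OF J i])
  have c: "(\<Prod>j\<in>J. f j (restrict \<omega> J j)) = (\<Prod>j\<in>J. f j (\<omega> j))" for \<omega>
    by (intro prod.cong) auto
  have I': "integrable (distr gauss (PiM J (\<lambda>_. std_normal_distribution)) (\<lambda>\<omega>. restrict \<omega> J)) (\<lambda>\<omega>. \<Prod>j\<in>J. f j (\<omega> j))"
    using I by (simp only: distr_gauss_restrict[OF J])
  show "integrable gauss (\<lambda>\<omega>. \<Prod>j\<in>J. f j (\<omega> j))"
    using integrable_distr[OF mr I'] by (simp only: c)
  have "(\<integral>\<omega>. (\<Prod>j\<in>J. f j (\<omega> j)) \<partial>gauss) = (\<integral>\<omega>. (\<Prod>j\<in>J. f j (\<omega> j)) \<partial>PiM J (\<lambda>_. std_normal_distribution))"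
    using integral_distr[OF mr borel_measurable_integrable[OF I]] by (simp only: c distr_gauss_restrict[OF J])
  also have "\<dots> = (\<Prod>j\<in>J. \<integral>x. f j x \<partial>std_normal_distribution)"
    by (rule product_integral_prod[OF J i])
  finally show "(\<integral>\<omega>. (\<Prod>j\<in>J. f j (\<omega> j)) \<partial>gauss) = (\<Prod>j\<in>J. \<integral>x. f j x \<partial>std_normal_distribution)" .
qed

lemma cos_integral_of_iexp:
  assumes "finite_measure M" "X \<in> borel_measurable M"
  shows "(\<integral>x. cos (X x + s) \<partial>M) = Re (iexp s * (CLINT x|M. iexp (X x)))"
proof -
  have i: "integrable M (\<lambda>x. iexp (X x))"
    using assms by (intro finite_measure.integrable_const_bound[where B=1]) auto
  have "iexp s * (CLINT x|M. iexp (X x)) = (CLINT x|M. iexp s * iexp (X x))" by simp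
  also have "Re \<dots> = (\<integral>x. Re (iexp s * iexp (X x)) \<partial>M)"
    by (rule integral_Re[symmetric]) (use i in simp)
  also have "\<dots> = (\<integral>x. cos (X x + s) \<partial>M)"
    by (intro Bochner_Integration.integral_cong refl) (simp add: exp_add[symmetric] Re_exp add.commute)
  finally show ?thesis ..
qed

lemma iexp_sum: "finite J \<Longrightarrow> iexp (\<Sum>j\<in>J. \<theta> j * x j) = (\<Prod>j\<in>J. iexp (\<theta> j * x j))"
  by (simp add: exp_sum sum_distrib_left)

lemma integrable_iexp_std_normal: "integrable std_normal_distribution (\<lambda>x. iexp (t * x))"
proof -
  interpret prob_space std_normal_distribution by (rule prob_space_std_normal)
  show ?thesis by (intro integrable_const_bound[where B=1]) auto
qed

lemma gauss_char:
  assumes J: "finite J"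
  shows "(CLINT \<omega>|gauss. iexp (\<Sum>j\<in>J. \<theta> j * \<omega> j)) = complex_of_real (exp (- (\<Sum>j\<in>J. (\<theta> j)\<^sup>2) / 2))"
proof -
  have "(CLINT \<omega>|gauss. iexp (\<Sum>j\<in>J. \<theta> j * \<omega> j)) = (CLINT \<omega>|gauss. (\<Prod>j\<in>J. iexp (\<theta> j * \<omega> j)))"
    by (simp only: iexp_sum[OF J])
  also have "\<dots> = (\<Prod>j\<in>J. char std_normal_distribution (\<theta> j))"
    unfolding char_def by (rule gauss_prod(2)[OF J integrable_iexp_std_normal])
  also have "\<dots> = complex_of_real (\<Prod>j\<in>J. exp (- (\<theta> j)\<^sup>2 / 2))"
    by (simp add: char_std_normal_distribution)
  also have "(\<Prod>j\<in>J. exp (- (\<theta> j)\<^sup>2 / 2)) = exp (- (\<Sum>j\<in>J. (\<theta> j)\<^sup>2) / 2)"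
    using J by (simp add: exp_sum[symmetric] sum_negf sum_divide_distrib)
  finally show ?thesis .
qed

lemma gauss_cos:
  assumes J: "finite J"
  shows "(\<integral>\<omega>. cos ((\<Sum>j\<in>J. \<theta> j * \<omega> j) + s) \<partial>gauss) = cos s * exp (- (\<Sum>j\<in>J. (\<theta> j)\<^sup>2) / 2)"
proof -
  have "(\<lambda>\<omega>. \<Sum>j\<in>J. \<theta> j * \<omega> j) \<in> borel_measurable gauss" by simp
  from cos_integral_of_iexp[OF gauss.finite_measure_axioms this]
  show ?thesis unfolding gauss_char[OF J] by (simp add: Re_exp)
qed

subsection \<open>Heat semigroup\<close>

text \<open>The semigroup generated by half the Laplacian, with \<open>t\<close> as variance. The
  noise moves all coordinates, which is invisible to a function of the first n of them.\<close>

definition heat :: "real \<Rightarrow> ((nat \<Rightarrow> real) \<Rightarrow> real) \<Rightarrow> (nat \<Rightarrow> real) \<Rightarrow> real"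
  where "heat t F x = (\<integral>\<omega>. F (\<lambda>q. x q + sqrt t * \<omega> q) \<partial>gauss)"

text \<open>Variances of independent Gaussians add: integrating the cosine over the second factor
  leaves a constant exponential, and the two exponentials multiply.\<close>

lemma gauss_add:
  assumes "0 \<le> t" "0 \<le> s"
  shows "distr (gauss \<Otimes>\<^sub>M gauss) borel (\<lambda>(\<omega>,\<omega>') q. sqrt t * \<omega> q + sqrt s * \<omega>' q)
    = distr gauss borel (\<lambda>\<omega> q. sqrt (t + s) * \<omega> q)"
proof (rule measure_eq_of_cos_integrals[where I=UNIV])
  interpret GG: pair_prob_space gauss gauss ..
  have m1: "(\<lambda>(\<omega>,\<omega>') q. sqrt t * \<omega> q + sqrt s * \<omega>' q) \<in> measurable (gauss \<Otimes>\<^sub>M gauss) (borel :: (nat \<Rightarrow> real) measure)"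
    by (rule measurable_into_fun) (simp add: split_beta')
  have m2: "(\<lambda>\<omega> q. sqrt (t + s) * \<omega> q) \<in> measurable gauss (borel :: (nat \<Rightarrow> real) measure)"
    by (rule measurable_into_fun) simp
  show "finite_measure (distr (gauss \<Otimes>\<^sub>M gauss) borel (\<lambda>(\<omega>,\<omega>') q. sqrt t * \<omega> q + sqrt s * \<omega>' q))"
    using GG.prob_space_distr[OF m1] by (simp add: prob_space_def)
  show "finite_measure (distr gauss borel (\<lambda>\<omega> q. sqrt (t + s) * \<omega> q))"
    using gauss.prob_space_distr[OF m2] by (simp add: prob_space_def)
  fix J :: "nat set" and \<theta> r assume J: "finite J"
  have mc: "(\<lambda>x. cos ((\<Sum>j\<in>J. \<theta> j * x j) + r)) \<in> borel_measurable (borel :: (nat \<Rightarrow> real) measure)" by simp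
  have "(\<integral>x. cos ((\<Sum>j\<in>J. \<theta> j * x j) + r) \<partial>distr (gauss \<Otimes>\<^sub>M gauss) borel (\<lambda>(\<omega>,\<omega>') q. sqrt t * \<omega> q + sqrt s * \<omega>' q))
    = (\<integral>z. cos ((\<Sum>j\<in>J. \<theta> j * (sqrt t * fst z j + sqrt s * snd z j)) + r) \<partial>(gauss \<Otimes>\<^sub>M gauss))"
    by (subst integral_distr[OF m1 mc]) (simp add: split_beta')
  also have "\<dots> = (\<integral>\<omega>. (\<integral>\<omega>'. cos ((\<Sum>j\<in>J. \<theta> j * (sqrt t * \<omega> j + sqrt s * \<omega>' j)) + r) \<partial>gauss) \<partial>gauss)"
    by (subst GG.integral_fst'[symmetric]) (auto intro!: GG.P.integrable_const_bound[where B=1] GG.integrable_const_bound[where B=1])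
  also have "\<dots> = (\<integral>\<omega>. (\<integral>\<omega>'. cos ((\<Sum>j\<in>J. (\<theta> j * sqrt s) * \<omega>' j) + ((\<Sum>j\<in>J. (\<theta> j * sqrt t) * \<omega> j) + r)) \<partial>gauss) \<partial>gauss)"
    by (simp add: sum.distrib algebra_simps)
  also have "\<dots> = (\<integral>\<omega>. cos ((\<Sum>j\<in>J. (\<theta> j * sqrt t) * \<omega> j) + r) \<partial>gauss) * exp (- (\<Sum>j\<in>J. (\<theta> j * sqrt s)\<^sup>2) / 2)"
    by (simp only: gauss_cos[OF J] Bochner_Integration.integral_mult_left_zero)
  also have "\<dots> = cos r * exp (- (\<Sum>j\<in>J. (\<theta> j * sqrt (t + s))\<^sup>2) / 2)"
    using assms by (simp add: gauss_cos[OF J] power_mult_distrib distrib_left sum.distrib exp_add[symmetric] add_divide_distrib)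
  also have "\<dots> = (\<integral>x. cos ((\<Sum>j\<in>J. \<theta> j * x j) + r) \<partial>distr gauss borel (\<lambda>\<omega> q. sqrt (t + s) * \<omega> q))"
    by (subst integral_distr[OF m2 mc]) (simp only: gauss_cos[OF J, symmetric] mult.assoc)
  finally show "(\<integral>x. cos ((\<Sum>j\<in>J. \<theta> j * x j) + r) \<partial>distr (gauss \<Otimes>\<^sub>M gauss) borel (\<lambda>(\<omega>,\<omega>') q. sqrt t * \<omega> q + sqrt s * \<omega>' q))
    = (\<integral>x. cos ((\<Sum>j\<in>J. \<theta> j * x j) + r) \<partial>distr gauss borel (\<lambda>\<omega> q. sqrt (t + s) * \<omega> q))" .
qed (simp_all add: sets_PiM_equal_borel)

lemma measurable_shift[measurable]: "(\<lambda>\<omega> q. x q + c * \<omega> q) \<in> measurable gauss (borel :: (nat \<Rightarrow> real) measure)"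
  by (rule measurable_into_fun) simp

lemma borel_measurable_heat[measurable]:
  assumes [measurable]: "F \<in> borel_measurable borel"
  shows "heat t F \<in> borel_measurable borel"
proof -
  have [measurable]: "(\<lambda>z q. fst z q + sqrt t * snd z q) \<in> measurable (borel \<Otimes>\<^sub>M gauss) (borel :: (nat \<Rightarrow> real) measure)"
    by (rule measurable_into_fun) simp
  have "(\<lambda>z. F (\<lambda>q. fst z q + sqrt t * snd z q)) \<in> borel_measurable (borel \<Otimes>\<^sub>M gauss)"
    by simp
  from gauss.borel_measurable_lebesgue_integral[of "\<lambda>x \<omega>. F (\<lambda>q. x q + sqrt t * \<omega> q)" borel] this
  show ?thesis unfolding heat_def[abs_def] by (simp add: split_beta')
qed

lemma integrable_heat:
  assumes [measurable]: "F \<in> borel_measurable borel" and b: "\<And>x. \<bar>F x\<bar> \<le> (K::real)"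
  shows "integrable gauss (\<lambda>\<omega>. F (\<lambda>q. x q + c * \<omega> q))"
  by (intro gauss.integrable_const_bound[where B=K]) (use b in auto)

lemma heat_bounds:
  assumes "F \<in> borel_measurable borel" and b: "\<And>x. u \<le> F x" "\<And>x. F x \<le> v"
  shows "u \<le> heat t F x" "heat t F x \<le> v"
proof -
  have "\<bar>F x\<bar> \<le> \<bar>u\<bar> + \<bar>v\<bar>" for x using b[of x] by linarith
  from integrable_heat[OF assms(1) this] have i: "integrable gauss (\<lambda>\<omega>. F (\<lambda>q. x q + sqrt t * \<omega> q))" .
  show "u \<le> heat t F x" unfolding heat_def by (rule gauss.integral_ge_const[OF i]) (use b in simp)
  show "heat t F x \<le> v" unfolding heat_def by (rule gauss.integral_le_const[OF i]) (use b in simp)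
qed

lemma heat_heat:
  assumes F[measurable]: "F \<in> borel_measurable borel" and b: "\<And>x. \<bar>F x\<bar> \<le> (K::real)" and ts: "0 \<le> t" "0 \<le> s"
  shows "heat t (heat s F) x = heat (t + s) F x"
proof -
  interpret GG: pair_prob_space gauss gauss ..
  have m1[measurable]: "(\<lambda>(\<omega>,\<omega>') q. sqrt t * \<omega> q + sqrt s * \<omega>' q) \<in> measurable (gauss \<Otimes>\<^sub>M gauss) (borel :: (nat \<Rightarrow> real) measure)"
    by (rule measurable_into_fun) (simp add: split_beta')
  have m2: "(\<lambda>\<omega> q. sqrt (t + s) * \<omega> q) \<in> measurable gauss (borel :: (nat \<Rightarrow> real) measure)"
    by (rule measurable_into_fun) simp
  have m3[measurable]: "(\<lambda>y q. x q + y q) \<in> measurable (borel :: (nat \<Rightarrow> real) measure) (borel :: (nat \<Rightarrow> real) measure)"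
    by (rule measurable_into_fun) simp
  have m4[measurable]: "(\<lambda>z q. x q + (sqrt t * fst z q + sqrt s * snd z q)) \<in> measurable (gauss \<Otimes>\<^sub>M gauss) (borel :: (nat \<Rightarrow> real) measure)"
    by (rule measurable_into_fun) simp
  have mF: "(\<lambda>y. F (\<lambda>q. x q + y q)) \<in> borel_measurable borel" by simp
  have "heat (t + s) F x = (\<integral>y. F (\<lambda>q. x q + y q) \<partial>distr gauss borel (\<lambda>\<omega> q. sqrt (t + s) * \<omega> q))"
    unfolding heat_def by (subst integral_distr[OF m2 mF]) simp
  also have "\<dots> = (\<integral>z. F (\<lambda>q. x q + (sqrt t * fst z q + sqrt s * snd z q)) \<partial>(gauss \<Otimes>\<^sub>M gauss))"
    unfolding gauss_add[OF ts, symmetric] by (subst integral_distr[OF m1 mF]) (simp add: split_beta')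
  also have "\<dots> = (\<integral>\<omega>. (\<integral>\<omega>'. F (\<lambda>q. x q + (sqrt t * \<omega> q + sqrt s * \<omega>' q)) \<partial>gauss) \<partial>gauss)"
    by (subst GG.integral_fst'[symmetric]) (auto intro!: GG.integrable_const_bound[where B=K] b)
  also have "\<dots> = heat t (heat s F) x"
    unfolding heat_def by (simp add: add.assoc)
  finally show ?thesis ..
qed

subsection \<open>Orthonormal images\<close>

text \<open>The image is Gaussian with covariance \<open>b\<close> times its transpose, the identity
  for orthonormal rows. Only \<open>d\<close> coordinates are under control, so both laws are
  compared on \<open>{..<d}\<close>.\<close>

lemma gauss_orthonormal_image:
  assumes b: "\<And>p r. p < d \<Longrightarrow> r < d \<Longrightarrow> (\<Sum>q<n. b p q * b r q) = (if p = r then 1 else 0)"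
  shows "distr gauss (PiM {..<d} (\<lambda>_. borel)) (\<lambda>\<omega>. \<lambda>p\<in>{..<d}. \<Sum>q<n. b p q * \<omega> q)
     = distr gauss (PiM {..<d} (\<lambda>_. borel)) (\<lambda>\<omega>. restrict \<omega> {..<d})"
proof (rule measure_eq_of_cos_integrals[where I="{..<d}"])
  have m1: "(\<lambda>\<omega>. \<lambda>p\<in>{..<d}. \<Sum>q<n. b p q * \<omega> q) \<in> measurable gauss (PiM {..<d} (\<lambda>_. borel))"
    by (rule measurable_restrict) simp
  have m2: "(\<lambda>\<omega>. restrict \<omega> {..<d}) \<in> measurable gauss (PiM {..<d} (\<lambda>_. borel))"
    by (rule measurable_restrict) simp
  show "finite_measure (distr gauss (PiM {..<d} (\<lambda>_. borel)) (\<lambda>\<omega>. \<lambda>p\<in>{..<d}. \<Sum>q<n. b p q * \<omega> q))"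
    using gauss.prob_space_distr[OF m1] by (simp add: prob_space_def)
  show "finite_measure (distr gauss (PiM {..<d} (\<lambda>_. borel)) (\<lambda>\<omega>. restrict \<omega> {..<d}))"
    using gauss.prob_space_distr[OF m2] by (simp add: prob_space_def)
  fix J and \<theta> :: "nat \<Rightarrow> real" and r :: real assume J: "finite J" "J \<subseteq> {..<d}"
  have mc: "(\<lambda>x. cos ((\<Sum>j\<in>J. \<theta> j * x j) + r)) \<in> borel_measurable (PiM {..<d} (\<lambda>_. borel :: real measure))"
  proof -
    have mcj: "(\<lambda>x. x j) \<in> borel_measurable (PiM {..<d} (\<lambda>_. borel :: real measure))" if "j \<in> J" for j
      using that J by (intro measurable_component_singleton) auto
    have "(\<lambda>x. (\<Sum>j\<in>J. \<theta> j * x j) + r) \<in> borel_measurable (PiM {..<d} (\<lambda>_. borel :: real measure))"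
      by (auto intro!: borel_measurable_add borel_measurable_sum borel_measurable_times mcj)
    then show ?thesis by simp
  qed
  have sw: "(\<Sum>j\<in>J. \<theta> j * (\<Sum>q<n. b j q * \<omega> q)) = (\<Sum>q<n. (\<Sum>j\<in>J. \<theta> j * b j q) * \<omega> q)" for \<omega>
    unfolding sum_distrib_left sum_distrib_right by (subst sum.swap) (simp add: mult.assoc)
  have "(\<Sum>q<n. (\<Sum>j\<in>J. \<theta> j * b j q)\<^sup>2) = (\<Sum>q<n. \<Sum>j\<in>J. \<Sum>k\<in>J. \<theta> j * \<theta> k * (b j q * b k q))"
    by (simp add: power2_eq_square sum_product mult_ac)
  also have "\<dots> = (\<Sum>j\<in>J. \<Sum>k\<in>J. \<theta> j * \<theta> k * (\<Sum>q<n. b j q * b k q))"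
    unfolding sum_distrib_left
    by (rule trans[OF sum.swap], rule sum.cong[OF refl], rule sum.swap)
  also have "\<dots> = (\<Sum>j\<in>J. \<Sum>k\<in>J. if j = k then \<theta> j * \<theta> k else 0)"
    using J by (intro sum.cong refl) (auto simp: b subset_eq)
  also have "\<dots> = (\<Sum>j\<in>J. (\<theta> j)\<^sup>2)"
    using J by (simp add: power2_eq_square)
  finally have sq: "(\<Sum>q<n. (\<Sum>j\<in>J. \<theta> j * b j q)\<^sup>2) = (\<Sum>j\<in>J. (\<theta> j)\<^sup>2)" .
  have c1: "(\<Sum>j\<in>J. \<theta> j * (\<lambda>p\<in>{..<d}. \<Sum>q<n. b p q * \<omega> q) j) = (\<Sum>q<n. (\<Sum>j\<in>J. \<theta> j * b j q) * \<omega> q)" for \<omega>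
    unfolding sw[symmetric] using J by (intro sum.cong) auto
  have c2: "(\<Sum>j\<in>J. \<theta> j * restrict \<omega> {..<d} j) = (\<Sum>j\<in>J. \<theta> j * \<omega> j)" for \<omega>
    using J by (intro sum.cong) auto
  show "(\<integral>x. cos ((\<Sum>j\<in>J. \<theta> j * x j) + r) \<partial>distr gauss (PiM {..<d} (\<lambda>_. borel)) (\<lambda>\<omega>. \<lambda>p\<in>{..<d}. \<Sum>q<n. b p q * \<omega> q))
    = (\<integral>x. cos ((\<Sum>j\<in>J. \<theta> j * x j) + r) \<partial>distr gauss (PiM {..<d} (\<lambda>_. borel)) (\<lambda>\<omega>. restrict \<omega> {..<d}))"
    by (subst integral_distr[OF m1 mc], subst integral_distr[OF m2 mc])
      (simp only: c1 c2 gauss_cos[OF finite_lessThan] gauss_cos[OF J(1)] sq)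
qed simp_all

subsection \<open>Norms and moments\<close>

definition dot :: "nat \<Rightarrow> (nat \<Rightarrow> real) \<Rightarrow> (nat \<Rightarrow> real) \<Rightarrow> real"
  where "dot n x y = (\<Sum>q<n. x q * y q)"

definition nrm :: "nat \<Rightarrow> (nat \<Rightarrow> real) \<Rightarrow> real"
  where "nrm n x = L2_set x {..<n}"

text \<open>The l1 norm serves as a majorant of \<open>nrm\<close> whose exponential is a product
  over independent coordinates and hence integrable.\<close>

definition sumabs :: "nat \<Rightarrow> (nat \<Rightarrow> real) \<Rightarrow> real"
  where "sumabs n x = (\<Sum>q<n. \<bar>x q\<bar>)"

lemma nrm_nonneg[simp]: "0 \<le> nrm n x" by (simp add: nrm_def L2_set_nonneg)
lemma sumabs_nonneg[simp]: "0 \<le> sumabs n x" by (simp add: sumabs_def sum_nonneg)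
lemma nrm_sq: "(nrm n x)\<^sup>2 = dot n x x"
  by (simp add: nrm_def L2_set_def dot_def sum_nonneg power2_eq_square)
lemma nrm_le_sumabs: "nrm n x \<le> sumabs n x"
  unfolding nrm_def sumabs_def by (rule L2_set_le_sum_abs)
lemma nrm_scale: "nrm n (\<lambda>q. c * x q) = \<bar>c\<bar> * nrm n x"
  unfolding nrm_def L2_set_def by (simp add: power_mult_distrib sum_distrib_left[symmetric] real_sqrt_mult)
lemma nrm_triangle: "nrm n (\<lambda>q. x q + y q) \<le> nrm n x + nrm n y"
  unfolding nrm_def by (rule L2_set_triangle_ineq)
lemma abs_dot_le: "\<bar>dot n x y\<bar> \<le> nrm n x * nrm n y"
proof -
  have "\<bar>dot n x y\<bar> \<le> (\<Sum>q<n. \<bar>x q\<bar> * \<bar>y q\<bar>)"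
    unfolding dot_def by (rule order_trans[OF sum_abs]) (simp add: abs_mult)
  also have "\<dots> \<le> nrm n x * nrm n y" unfolding nrm_def by (rule L2_set_mult_ineq)
  finally show ?thesis .
qed
lemma dot_commute: "dot n x y = dot n y x" by (simp add: dot_def mult.commute)
lemma dot_scale_right: "dot n x (\<lambda>q. c * y q) = c * dot n x y"
  by (simp add: dot_def sum_distrib_left mult_ac)
lemma dot_scale_left: "dot n (\<lambda>q. c * x q) y = c * dot n x y"
  by (simp add: dot_def sum_distrib_left mult_ac)
lemma dot_diff_right: "dot n x (\<lambda>q. y q - z q) = dot n x y - dot n x z"
  by (simp add: dot_def sum_subtractf right_diff_distrib)
lemma abs_dot_le_sumabs: "\<bar>dot n x y\<bar> \<le> nrm n x * sumabs n y"
  using abs_dot_le[of n x y] mult_left_mono[OF nrm_le_sumabs[of n y] nrm_nonneg[of n x]] by linarith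

lemma measurable_sumabs[measurable]: "sumabs n \<in> borel_measurable borel"
  unfolding sumabs_def[abs_def] by simp
lemma measurable_dot[measurable]: "dot n x \<in> borel_measurable borel"
  unfolding dot_def[abs_def] by simp
lemma measurable_nrm[measurable]: "nrm n \<in> borel_measurable borel"
  unfolding nrm_def[abs_def] L2_set_def by simp

lemma std_normal_density_tilt: "std_normal_density x * exp (e * x - e\<^sup>2 / 2) = std_normal_density (x - e)"
  by (simp add: normal_density_def mult.assoc exp_add[symmetric] power2_eq_square field_simps)

text \<open>Completing the square: an exponentially tilted standard Gaussian is a translated one.
  Banach-valued \<open>f\<close> covers the constant 1 and complex exponentials alike.\<close>

lemma integrable_std_normal_tilt:
  assumes [measurable]: "f \<in> borel_measurable borel" and b: "\<And>x. norm (f x :: 'b::{banach,second_countable_topology}) \<le> 1"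
  shows "integrable std_normal_distribution (\<lambda>x. exp (e * x - e\<^sup>2 / 2) *\<^sub>R f x)"
    and "(\<integral>x. exp (e * x - e\<^sup>2 / 2) *\<^sub>R f x \<partial>std_normal_distribution) = (\<integral>x. f (x + e) \<partial>std_normal_distribution)"
proof -
  interpret prob_space std_normal_distribution by (rule prob_space_std_normal)
  have i: "integrable std_normal_distribution (\<lambda>x. f (x + e))"
    by (intro integrable_const_bound[where B=1]) (use b in auto)
  have i2: "integrable lborel (\<lambda>x. std_normal_density x *\<^sub>R f (x + e))"
    using i by (subst (asm) integrable_density) auto
  have i3: "integrable lborel (\<lambda>x. std_normal_density (x - e) *\<^sub>R f x)"
    using lborel_integrable_real_affine[OF i2, of 1 "- e"] by simp
  show "integrable std_normal_distribution (\<lambda>x. exp (e * x - e\<^sup>2 / 2) *\<^sub>R f x)"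
    using i3 by (subst integrable_density) (auto simp: std_normal_density_tilt)
  have "(\<integral>x. exp (e * x - e\<^sup>2 / 2) *\<^sub>R f x \<partial>std_normal_distribution) = (\<integral>x. std_normal_density (x - e) *\<^sub>R f x \<partial>lborel)"
    by (subst integral_density) (auto simp: std_normal_density_tilt)
  also have "\<dots> = (\<integral>x. std_normal_density x *\<^sub>R f (x + e) \<partial>lborel)"
    by (subst lborel_integral_real_affine[where c=1 and t=e]) (auto simp: add.commute)
  also have "\<dots> = (\<integral>x. f (x + e) \<partial>std_normal_distribution)"
    by (subst integral_density) auto
  finally show "(\<integral>x. exp (e * x - e\<^sup>2 / 2) *\<^sub>R f x \<partial>std_normal_distribution) = (\<integral>x. f (x + e) \<partial>std_normal_distribution)" .
qed

lemma integrable_std_normal_exp_abs: "integrable std_normal_distribution (\<lambda>x. exp (k * \<bar>x\<bar>))"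
proof -
  have i: "integrable std_normal_distribution (\<lambda>x. exp (e * x))" for e
  proof -
    have "integrable std_normal_distribution (\<lambda>x. exp (e\<^sup>2 / 2) * (exp (e * x - e\<^sup>2 / 2) *\<^sub>R (1::real)))"
      by (intro integrable_mult_right integrable_std_normal_tilt) auto
    then show ?thesis by (simp add: exp_add[symmetric])
  qed
  have "norm (exp (k * \<bar>x\<bar>)) \<le> norm (exp (k * x) + exp (- k * x))" for x :: real
    by (cases "0 \<le> x") (auto simp: abs_of_pos[OF add_pos_pos[OF exp_gt_zero exp_gt_zero]])
  then show ?thesis
    by (intro Bochner_Integration.integrable_bound[OF Bochner_Integration.integrable_add[OF i[of k] i[of "-k"]]]) auto
qed

lemma integrable_exp_sumabs: "integrable gauss (\<lambda>\<omega>. exp (k * sumabs n \<omega>))"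
  using gauss_prod(1)[where J="{..<n}" and f="\<lambda>_ x. exp (k * \<bar>x\<bar>)", OF finite_lessThan integrable_std_normal_exp_abs]
  by (simp add: sumabs_def exp_sum sum_distrib_left)

lemma std_normal_moments:
  "integrable std_normal_distribution (\<lambda>x. x)" "(\<integral>x. x \<partial>std_normal_distribution) = 0"
  "integrable std_normal_distribution (\<lambda>x. x\<^sup>2)" "(\<integral>x. x\<^sup>2 \<partial>std_normal_distribution) = 1"
  using integrable_std_normal_distribution_moment[of 1] integral_std_normal_distribution_moment_odd[of 1]
    integrable_std_normal_distribution_moment[of 2] std_normal_distribution_even_moments[of 1] by auto

lemma gauss_coord:
  "integrable gauss (\<lambda>\<omega>. \<omega> q)" "(\<integral>\<omega>. \<omega> q \<partial>gauss) = 0"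
  using gauss_prod[of "{q}" "\<lambda>_ x. x"] std_normal_moments by auto

lemma gauss_coord2:
  "integrable gauss (\<lambda>\<omega>. \<omega> q * \<omega> r)" "(\<integral>\<omega>. \<omega> q * \<omega> r \<partial>gauss) = (if q = r then 1 else 0)"
proof -
  have "integrable gauss (\<lambda>\<omega>. \<omega> q * \<omega> r) \<and> (\<integral>\<omega>. \<omega> q * \<omega> r \<partial>gauss) = (if q = r then 1 else 0)"
  proof (cases "q = r")
    case True
    then show ?thesis using gauss_prod[of "{q}" "\<lambda>_ x. x\<^sup>2"] std_normal_moments by (auto simp: power2_eq_square)
  next
    case False
    then show ?thesis using gauss_prod[of "{q, r}" "\<lambda>_ x. x"] std_normal_moments by auto
  qed
  then show "integrable gauss (\<lambda>\<omega>. \<omega> q * \<omega> r)" "(\<integral>\<omega>. \<omega> q * \<omega> r \<partial>gauss) = (if q = r then 1 else 0)" by auto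
qed

lemma gauss_dot:
  "integrable gauss (dot n x)" "(\<integral>\<omega>. dot n x \<omega> \<partial>gauss) = 0"
  by (auto simp: dot_def[abs_def] gauss_coord intro!: Bochner_Integration.integrable_sum integrable_mult_right)

lemma gauss_dot_sq:
  "integrable gauss (\<lambda>\<omega>. (dot n x \<omega>)\<^sup>2)" "(\<integral>\<omega>. (dot n x \<omega>)\<^sup>2 \<partial>gauss) = (nrm n x)\<^sup>2"
proof -
  have e: "(dot n x \<omega>)\<^sup>2 = (\<Sum>q<n. \<Sum>r<n. x q * x r * (\<omega> q * \<omega> r))" for \<omega>
    by (simp add: dot_def power2_eq_square sum_product mult_ac)
  have i: "integrable gauss (\<lambda>\<omega>. \<Sum>r<n. x q * x r * (\<omega> q * \<omega> r))" for q
    by (intro Bochner_Integration.integrable_sum integrable_mult_right gauss_coord2)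
  show "integrable gauss (\<lambda>\<omega>. (dot n x \<omega>)\<^sup>2)"
    unfolding e by (intro Bochner_Integration.integrable_sum i)
  have "(\<integral>\<omega>. (dot n x \<omega>)\<^sup>2 \<partial>gauss) = (\<Sum>q<n. \<Sum>r<n. x q * x r * (if q = r then 1 else 0))"
    unfolding e
    by (subst Bochner_Integration.integral_sum[OF i], rule sum.cong[OF refl],
        subst Bochner_Integration.integral_sum) (auto intro!: integrable_mult_right gauss_coord2 simp: gauss_coord2)
  also have "\<dots> = (nrm n x)\<^sup>2"
    by (simp add: nrm_sq dot_def if_distrib cong: if_cong)
  finally show "(\<integral>\<omega>. (dot n x \<omega>)\<^sup>2 \<partial>gauss) = (nrm n x)\<^sup>2" .
qed

subsection \<open>Cameron--Martin formula\<close>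

text \<open>Against a complex exponential both measures give products of one-dimensional integrals,
  and factor by factor the tilt is a translation. Only coordinates below \<open>n\<close> are
  shifted, so the density is a finite product.\<close>

lemma cameron_martin:
  "distr gauss borel (\<lambda>\<omega> q. \<omega> q + (if q < n then e q else 0))
   = density gauss (\<lambda>\<omega>. ennreal (exp (dot n e \<omega> - (nrm n e)\<^sup>2 / 2)))"
proof (rule measure_eq_of_cos_integrals[where I=UNIV])
  define w where "w \<omega> = exp (dot n e \<omega> - (nrm n e)\<^sup>2 / 2)" for \<omega>
  define e' where "e' q = (if q < n then e q else 0)" for q
  have [measurable]: "w \<in> borel_measurable borel" unfolding w_def[abs_def] by simp
  have m[measurable]: "(\<lambda>\<omega> q. \<omega> q + (if q < n then e q else 0)) \<in> measurable gauss (borel :: (nat \<Rightarrow> real) measure)"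
    by (rule measurable_into_fun) simp
  have wprod: "w \<omega> = (\<Prod>q\<in>K. exp (e' q * \<omega> q - (e' q)\<^sup>2 / 2))" if "finite K" "{..<n} \<subseteq> K" for K \<omega>
  proof -
    have "dot n e \<omega> - (nrm n e)\<^sup>2 / 2 = (\<Sum>q<n. e' q * \<omega> q - (e' q)\<^sup>2 / 2)"
      unfolding nrm_sq dot_def by (simp add: e'_def sum_subtractf power2_eq_square sum_divide_distrib)
    also have "\<dots> = (\<Sum>q\<in>K. e' q * \<omega> q - (e' q)\<^sup>2 / 2)"
      using that by (intro sum.mono_neutral_left) (auto simp: e'_def)
    finally show ?thesis using that by (simp add: w_def exp_sum)
  qed
  have key: "integrable gauss (\<lambda>\<omega>. w \<omega> *\<^sub>R iexp (\<Sum>j\<in>J. \<theta> j * \<omega> j))"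
     "(CLINT \<omega>|gauss. w \<omega> *\<^sub>R iexp (\<Sum>j\<in>J. \<theta> j * \<omega> j)) = (CLINT \<omega>|gauss. iexp (\<Sum>j\<in>J. \<theta> j * (\<omega> j + e' j)))"
    if J: "finite J" for J \<theta>
  proof -
    \<comment> \<open>Frequencies and shift are extended by zero to a common finite index set, so
      that one product formula covers both.\<close>
    define K where "K = J \<union> {..<n}"
    define \<theta>' where "\<theta>' j = (if j \<in> J then \<theta> j else 0)" for j
    have K: "finite K" "{..<n} \<subseteq> K" using J by (auto simp: K_def)
    have S: "(\<Sum>j\<in>J. \<theta> j * x j) = (\<Sum>j\<in>K. \<theta>' j * x j)" for x
      using J by (intro sum.mono_neutral_cong_left) (auto simp: K_def \<theta>'_def)
    have P: "w \<omega> *\<^sub>R iexp (\<Sum>j\<in>J. \<theta> j * \<omega> j) = (\<Prod>j\<in>K. exp (e' j * \<omega> j - (e' j)\<^sup>2 / 2) *\<^sub>R iexp (\<theta>' j * \<omega> j))" for \<omega>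
      unfolding S wprod[OF K] iexp_sum[OF K(1)] scaleR_conv_of_real of_real_prod prod.distrib by simp
    have i1: "integrable std_normal_distribution (\<lambda>x. exp (e' j * x - (e' j)\<^sup>2 / 2) *\<^sub>R iexp (\<theta>' j * x))" for j
      by (rule integrable_std_normal_tilt) auto
    have i2: "integrable std_normal_distribution (\<lambda>x. iexp (\<theta>' j * (x + e' j)))" for j
    proof -
      interpret prob_space std_normal_distribution by (rule prob_space_std_normal)
      show ?thesis by (intro integrable_const_bound[where B=1]) auto
    qed
    show "integrable gauss (\<lambda>\<omega>. w \<omega> *\<^sub>R iexp (\<Sum>j\<in>J. \<theta> j * \<omega> j))"
      unfolding P by (rule gauss_prod(1)[OF K(1) i1])
    have "(CLINT \<omega>|gauss. w \<omega> *\<^sub>R iexp (\<Sum>j\<in>J. \<theta> j * \<omega> j)) = (\<Prod>j\<in>K. CLINT x|std_normal_distribution. exp (e' j * x - (e' j)\<^sup>2 / 2) *\<^sub>R iexp (\<theta>' j * x))"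
      unfolding P by (rule gauss_prod(2)[OF K(1) i1])
    also have "\<dots> = (\<Prod>j\<in>K. CLINT x|std_normal_distribution. iexp (\<theta>' j * (x + e' j)))"
      by (intro prod.cong refl, rule integrable_std_normal_tilt(2)) auto
    also have "\<dots> = (CLINT \<omega>|gauss. (\<Prod>j\<in>K. iexp (\<theta>' j * (\<omega> j + e' j))))"
      by (rule gauss_prod(2)[OF K(1) i2, symmetric])
    also have "\<dots> = (CLINT \<omega>|gauss. iexp (\<Sum>j\<in>J. \<theta> j * (\<omega> j + e' j)))"
      by (simp only: S iexp_sum[OF K(1)])
    finally show "(CLINT \<omega>|gauss. w \<omega> *\<^sub>R iexp (\<Sum>j\<in>J. \<theta> j * \<omega> j)) = (CLINT \<omega>|gauss. iexp (\<Sum>j\<in>J. \<theta> j * (\<omega> j + e' j)))" .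
  qed
  have wi: "integrable gauss w" using integrable_Re[OF key(1)[of "{}"]] by simp
  have wn: "\<And>\<omega>. 0 \<le> w \<omega>" by (simp add: w_def)
  show "finite_measure (distr gauss borel (\<lambda>\<omega> q. \<omega> q + (if q < n then e q else 0)))"
    using gauss.prob_space_distr[OF m] by (simp add: prob_space_def)
  have "finite_measure (density gauss (\<lambda>\<omega>. ennreal (w \<omega>)))"
    using wi wn by (intro finite_measureI) (auto simp: emeasure_density integrable_iff_bounded less_top)
  then show "finite_measure (density gauss (\<lambda>\<omega>. ennreal (exp (dot n e \<omega> - (nrm n e)\<^sup>2 / 2))))"
    by (simp add: w_def)
  fix J :: "nat set" and \<theta> :: "nat \<Rightarrow> real" and s :: real assume J: "finite J"
  have "(\<integral>x. cos ((\<Sum>j\<in>J. \<theta> j * x j) + s) \<partial>distr gauss borel (\<lambda>\<omega> q. \<omega> q + (if q < n then e q else 0)))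
    = (\<integral>\<omega>. cos ((\<Sum>j\<in>J. \<theta> j * (\<omega> j + e' j)) + s) \<partial>gauss)"
    by (subst integral_distr[OF m]) (auto simp: e'_def)
  also have "\<dots> = Re (iexp s * (CLINT \<omega>|gauss. iexp (\<Sum>j\<in>J. \<theta> j * (\<omega> j + e' j))))"
    by (rule cos_integral_of_iexp[OF gauss.finite_measure_axioms]) simp
  also have "\<dots> = Re (CLINT \<omega>|gauss. iexp s * (w \<omega> *\<^sub>R iexp (\<Sum>j\<in>J. \<theta> j * \<omega> j)))"
    unfolding key(2)[OF J, symmetric] by (simp only: Bochner_Integration.integral_mult_right_zero)
  also have "\<dots> = (\<integral>\<omega>. Re (iexp s * (w \<omega> *\<^sub>R iexp (\<Sum>j\<in>J. \<theta> j * \<omega> j))) \<partial>gauss)"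
    by (rule integral_Re[symmetric]) (intro integrable_mult_right key(1) J)
  also have "\<dots> = (\<integral>\<omega>. w \<omega> *\<^sub>R cos ((\<Sum>j\<in>J. \<theta> j * \<omega> j) + s) \<partial>gauss)"
    by (intro Bochner_Integration.integral_cong refl) (simp add: Re_exp Im_exp cos_add algebra_simps)
  also have "\<dots> = (\<integral>\<omega>. cos ((\<Sum>j\<in>J. \<theta> j * \<omega> j) + s) \<partial>density gauss (\<lambda>\<omega>. ennreal (w \<omega>)))"
    using wn by (subst integral_density) auto
  finally show "(\<integral>x. cos ((\<Sum>j\<in>J. \<theta> j * x j) + s) \<partial>distr gauss borel (\<lambda>\<omega> q. \<omega> q + (if q < n then e q else 0)))
    = (\<integral>x. cos ((\<Sum>j\<in>J. \<theta> j * x j) + s) \<partial>density gauss (\<lambda>\<omega>. ennreal (exp (dot n e \<omega> - (nrm n e)\<^sup>2 / 2))))"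
    by (simp add: w_def)
qed (simp_all add: sets_PiM_equal_borel)

subsection \<open>Heat-regularised functions\<close>

text \<open>A bounded Lipschitz gradient, encoded without derivatives as a first-order expansion
  with quadratic error. It is required for all \<open>y\<close>, not only small ones, so that it can
  be integrated against Gaussian increments.\<close>

definition C11 :: "nat \<Rightarrow> real \<Rightarrow> ((nat \<Rightarrow> real) \<Rightarrow> real) \<Rightarrow> bool"
  where "C11 n L v \<longleftrightarrow> (\<forall>x. \<exists>g. nrm n g \<le> L \<and>
    (\<forall>y. \<bar>v (\<lambda>q. x q + y q) - v x - dot n g y\<bar> \<le> L * (nrm n y)\<^sup>2))"

lemma exp_remainder: "\<bar>exp u - 1 - u\<bar> \<le> u\<^sup>2 * exp \<bar>u\<bar>" for u :: real
proof -
  obtain t where t: "\<bar>t\<bar> \<le> \<bar>u\<bar>" "exp u = (\<Sum>m<2. u ^ m / fact m) + exp t / fact 2 * u ^ 2"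
    using Maclaurin_exp_le[of u 2] by blast
  then have "\<bar>exp u - 1 - u\<bar> = exp t / 2 * u\<^sup>2"
    by (simp add: numeral_2_eq_2 abs_mult)
  also have "\<dots> \<le> exp \<bar>u\<bar> * u\<^sup>2"
  proof (intro mult_right_mono)
    have "exp t \<le> exp \<bar>u\<bar>" using t(1) by simp
    moreover have "0 < exp t" by simp
    ultimately show "exp t / 2 \<le> exp \<bar>u\<bar>" by linarith
  qed simp
  finally show ?thesis by (simp add: mult.commute)
qed

lemma square_le_exp: "0 \<le> z \<Longrightarrow> z\<^sup>2 \<le> 2 * exp z" for z :: real
  using exp_lower_Taylor_quadratic[of z] by simp

text \<open>With \<open>r\<close> the length of the shift \<open>e\<close> and
  \<open>D = dot n e \<omega>\<close>, the exponential is the Cameron-Martin density, expanded here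
  to first order in the shift. The error is r^2 times a weight that remains integrable for
  \<open>T = sumabs n \<omega>\<close>.\<close>

lemma tilt_remainder:
  assumes "0 \<le> r" "r \<le> 1" "\<bar>D\<bar> \<le> r * T" "0 \<le> (T::real)"
  shows "\<bar>exp (D - r\<^sup>2 / 2) - 1 - D\<bar> \<le> 3 * r\<^sup>2 * exp (2 * T + 2)"
proof -
  define u where "u = D - r\<^sup>2 / 2"
  have r2: "r\<^sup>2 \<le> r" using assms by (simp add: power2_eq_square mult_left_le)
  have "\<bar>u\<bar> \<le> \<bar>D\<bar> + r\<^sup>2" using abs_triangle_ineq4[of D "r\<^sup>2 / 2"] zero_le_power2[of r] unfolding u_def abs_divide abs_power2 by linarith
  then have "\<bar>u\<bar> \<le> r * T + r" using assms(3) r2 by linarith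
  then have u1: "\<bar>u\<bar> \<le> r * (T + 1)" by (simp add: algebra_simps)
  have u2: "\<bar>u\<bar> \<le> T + 1"
  proof -
    have "r * (T + 1) \<le> 1 * (T + 1)" using assms by (intro mult_right_mono) auto
    then have "r * (T + 1) \<le> T + 1" by (simp only: mult_1)
    with u1 show ?thesis by (rule order_trans)
  qed
  have "u\<^sup>2 \<le> (r * (T + 1))\<^sup>2" using u1 by (metis abs_ge_zero power2_abs power_mono)
  also have "\<dots> = r\<^sup>2 * (T + 1)\<^sup>2" by (rule power_mult_distrib)
  also have "\<dots> \<le> r\<^sup>2 * (2 * exp (T + 1))"
    using square_le_exp[of "T + 1"] assms by (intro mult_left_mono) auto
  finally have "u\<^sup>2 * exp \<bar>u\<bar> \<le> r\<^sup>2 * (2 * exp (T + 1)) * exp (T + 1)"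
    using u2 by (intro mult_mono) auto
  also have "\<dots> = 2 * r\<^sup>2 * exp (2 * T + 2)" by (simp add: exp_add[symmetric] mult_ac)
  finally have a: "\<bar>exp u - 1 - u\<bar> \<le> 2 * r\<^sup>2 * exp (2 * T + 2)" using exp_remainder[of u] by linarith
  define W where "W = r\<^sup>2 * exp (2 * T + 2)"
  have "r\<^sup>2 * 1 \<le> W" unfolding W_def using assms by (intro mult_left_mono) auto
  moreover have "exp (D - r\<^sup>2 / 2) - 1 - D = (exp u - 1 - u) - r\<^sup>2 / 2" by (simp add: u_def)
  moreover have "0 \<le> r\<^sup>2" by simp
  moreover have "\<bar>exp u - 1 - u\<bar> \<le> 2 * W" using a by (simp add: W_def)
  ultimately have "\<bar>exp (D - r\<^sup>2 / 2) - 1 - D\<bar> \<le> 3 * W" by linarith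
  then show ?thesis by (simp add: W_def)
qed

lemma integrable_dominated_sumabs:
  assumes [measurable]: "f \<in> borel_measurable borel" and b: "\<And>\<omega>. \<bar>f \<omega>\<bar> \<le> K * exp (k * sumabs n \<omega>)"
  shows "integrable gauss (f :: _ \<Rightarrow> real)"
    and "\<bar>\<integral>\<omega>. f \<omega> \<partial>gauss\<bar> \<le> K * (\<integral>\<omega>. exp (k * sumabs n \<omega>) \<partial>gauss)"
proof -
  have i: "integrable gauss (\<lambda>\<omega>. K * exp (k * sumabs n \<omega>))" by (intro integrable_mult_right integrable_exp_sumabs)
  show j: "integrable gauss f"
    by (rule Bochner_Integration.integrable_bound[OF i]) (use b in \<open>auto intro: order_trans[OF _ abs_ge_self]\<close>)
  have "\<bar>\<integral>\<omega>. f \<omega> \<partial>gauss\<bar> \<le> (\<integral>\<omega>. K * exp (k * sumabs n \<omega>) \<partial>gauss)"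
    by (rule order_trans[OF integral_abs_bound integral_mono[OF integrable_abs[OF j] i b]])
  then show "\<bar>\<integral>\<omega>. f \<omega> \<partial>gauss\<bar> \<le> K * (\<integral>\<omega>. exp (k * sumabs n \<omega>) \<partial>gauss)" by simp
qed

text \<open>A shift of the starting point is moved from \<open>F\<close> to the Gaussian density,
  which is smooth; hence boundedness of \<open>F\<close> is enough and the constant depends on
  \<open>n\<close> and \<tau> only. This uniformity later makes the error per step independent of
  time.\<close>

lemma heat_C11:
  assumes tau: "0 < \<tau>"
  obtains L where "L > 0" "\<And>F. F \<in> borel_measurable borel \<Longrightarrow> (\<And>x. 0 \<le> F x) \<Longrightarrow> (\<And>x. F x \<le> 1) \<Longrightarrow>
    (\<And>x y. (\<And>q. q < n \<Longrightarrow> x q = y q) \<Longrightarrow> F x = F y) \<Longrightarrow> C11 n L (heat \<tau> F)"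
proof -
  define E where "E = (\<integral>\<omega>. exp (2 * sumabs n \<omega>) \<partial>gauss)"
  have E1: "1 \<le> E" unfolding E_def
    by (rule gauss.integral_ge_const[OF integrable_exp_sumabs]) simp
  \<comment> \<open>First summand: quadratic error after rescaling the shift by sqrt \<tau>. Second
    summand: bound for the gradient.\<close>
  define L where "L = 3 * exp 2 * E / \<tau> + E / sqrt \<tau>"
  have st: "0 < sqrt \<tau>" using tau by simp
  have L: "3 * exp 2 * E / \<tau> \<le> L" "E / sqrt \<tau> \<le> L" "0 < L"
    using E1 tau by (auto simp: L_def intro!: add_pos_pos)
  show thesis
  proof (rule that[OF L(3)])
    fix F :: "(nat \<Rightarrow> real) \<Rightarrow> real"
    assume F[measurable]: "F \<in> borel_measurable borel" and F0: "\<And>x. 0 \<le> F x" and F1: "\<And>x. F x \<le> 1"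
      and Fn: "\<And>x y. (\<And>q. q < n \<Longrightarrow> x q = y q) \<Longrightarrow> F x = F y"
    have absF: "\<bar>F x\<bar> \<le> 1" for x using F0[of x] F1[of x] by simp
    show "C11 n L (heat \<tau> F)"
      unfolding C11_def
    proof
      fix x
      define G where "G \<omega> = F (\<lambda>q. x q + sqrt \<tau> * \<omega> q)" for \<omega>
      have G01: "0 \<le> G \<omega>" "G \<omega> \<le> 1" for \<omega> using F0 F1 by (auto simp: G_def)
      have [measurable]: "(\<lambda>\<omega> q. x q + sqrt \<tau> * \<omega> q) \<in> measurable borel (borel :: (nat \<Rightarrow> real) measure)"
        by (rule measurable_into_fun) simp
      have [measurable]: "G \<in> borel_measurable borel" unfolding G_def[abs_def] by simp
      have Gi: "integrable gauss G" by (intro gauss.integrable_const_bound[where B=1]) (use G01 in auto)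
      have Gc: "integrable gauss (\<lambda>\<omega>. G \<omega> * \<omega> q)" for q
        by (rule Bochner_Integration.integrable_bound[OF gauss_coord(1)[of q]])
          (use G01 in \<open>auto simp: abs_mult intro!: mult_left_le_one_le\<close>)
      \<comment> \<open>Gaussian integration by parts: the gradient of the smoothed function is the
        mean of \<open>G \<omega>\<close> times \<omega>, divided by sqrt \<tau>.\<close>
      define g where "g q = (\<integral>\<omega>. G \<omega> * \<omega> q \<partial>gauss) / sqrt \<tau>" for q
      have dg: "dot n g (\<lambda>q. sqrt \<tau> * e q) = (\<integral>\<omega>. G \<omega> * dot n e \<omega> \<partial>gauss)" for e
      proof -
        have "(\<integral>\<omega>. G \<omega> * dot n e \<omega> \<partial>gauss) = (\<integral>\<omega>. (\<Sum>q<n. e q * (G \<omega> * \<omega> q)) \<partial>gauss)"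
          by (simp add: dot_def sum_distrib_left mult_ac)
        also have "\<dots> = (\<Sum>q<n. e q * (\<integral>\<omega>. G \<omega> * \<omega> q \<partial>gauss))"
          by (subst Bochner_Integration.integral_sum) (use Gc in auto)
        also have "\<dots> = dot n g (\<lambda>q. sqrt \<tau> * e q)"
          using st by (simp add: dot_def g_def mult_ac)
        finally show ?thesis ..
      qed
      have x_exp: "z \<le> exp (2 * z)" if "0 \<le> z" for z :: real
        using exp_ge_add_one_self[of "2 * z"] that by linarith
      have Gd: "\<bar>G \<omega> * dot n e \<omega>\<bar> \<le> nrm n e * exp (2 * sumabs n \<omega>)" for e \<omega>
      proof -
        have "\<bar>G \<omega> * dot n e \<omega>\<bar> \<le> 1 * \<bar>dot n e \<omega>\<bar>"
          unfolding abs_mult using G01[of \<omega>] by (intro mult_right_mono) auto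
        also have "\<dots> \<le> nrm n e * sumabs n \<omega>" using abs_dot_le_sumabs by simp
        also have "\<dots> \<le> nrm n e * exp (2 * sumabs n \<omega>)" by (intro mult_left_mono x_exp) auto
        finally show ?thesis .
      qed
      have dgb: "\<bar>dot n g (\<lambda>q. sqrt \<tau> * e q)\<bar> \<le> nrm n e * E" for e
        unfolding dg E_def by (rule integrable_dominated_sumabs(2)[OF _ Gd]) simp
      have gL: "nrm n g \<le> L"
      proof -
        \<comment> \<open>The bound on the linear functional, tested in the direction of
          \<open>g\<close> itself.\<close>
        have "sqrt \<tau> * (nrm n g)\<^sup>2 \<le> nrm n g * E"
          using dgb[of g] by (simp add: dot_scale_right nrm_sq[symmetric])
        then have "(sqrt \<tau> * nrm n g) * nrm n g \<le> E * nrm n g" by (simp add: power2_eq_square mult_ac)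
        then have "nrm n g = 0 \<or> sqrt \<tau> * nrm n g \<le> E"
          using mult_right_le_imp_le[of "sqrt \<tau> * nrm n g" "nrm n g" E] nrm_nonneg[of n g] by linarith
        then have "nrm n g \<le> E / sqrt \<tau>" using st E1 by (auto simp: field_simps)
        then show ?thesis using L by linarith
      qed
      show "\<exists>g. nrm n g \<le> L \<and> (\<forall>y. \<bar>heat \<tau> F (\<lambda>q. x q + y q) - heat \<tau> F x - dot n g y\<bar> \<le> L * (nrm n y)\<^sup>2)"
      proof (intro exI[of _ g] conjI gL allI)
        fix y :: "nat \<Rightarrow> real"
        define e where "e q = y q / sqrt \<tau>" for q
        have ye: "y = (\<lambda>q. sqrt \<tau> * e q)" using st by (auto simp: e_def)
        have ny: "(nrm n y)\<^sup>2 = \<tau> * (nrm n e)\<^sup>2"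
          unfolding ye nrm_scale using tau by (simp add: power_mult_distrib)
        define r where "r = nrm n e"
        have h0: "heat \<tau> F x = (\<integral>\<omega>. G \<omega> \<partial>gauss)" by (simp add: heat_def G_def)
        have "\<bar>heat \<tau> F (\<lambda>q. x q + y q) - heat \<tau> F x - dot n g y\<bar> \<le> r\<^sup>2 * (3 * exp 2 * E)"
        \<comment> \<open>The expansion is needed for short shifts only; for r \<ge> 1 an
          oscillation of at most 1 and a linear term of at most \<open>r * E\<close> are absorbed by
          r^2.\<close>
        proof (cases "r \<le> 1")
          case True
          have m: "(\<lambda>\<omega> q. \<omega> q + (if q < n then e q else 0)) \<in> measurable gauss (borel :: (nat \<Rightarrow> real) measure)"
            by (rule measurable_into_fun) simp
          define w where "w \<omega> = exp (dot n e \<omega> - r\<^sup>2 / 2)" for \<omega>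
          have [measurable]: "w \<in> borel_measurable borel" unfolding w_def[abs_def] by simp
          \<comment> \<open>As \<open>F\<close> sees only \<open>n\<close> coordinates, the shift
            may be cut off there, which brings it into the scope of
            \<open>cameron_martin\<close>.\<close>
          have "heat \<tau> F (\<lambda>q. x q + y q) = (\<integral>\<omega>. G (\<lambda>q. \<omega> q + (if q < n then e q else 0)) \<partial>gauss)"
            unfolding heat_def G_def ye by (intro Bochner_Integration.integral_cong refl Fn) (auto simp: algebra_simps)
          also have "\<dots> = (\<integral>\<omega>. G \<omega> \<partial>distr gauss borel (\<lambda>\<omega> q. \<omega> q + (if q < n then e q else 0)))"
            by (subst integral_distr[OF m]) auto
          also have "\<dots> = (\<integral>\<omega>. w \<omega> * G \<omega> \<partial>gauss)"
            unfolding cameron_martin by (subst integral_density) (auto simp: w_def r_def)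
          finally have h1: "heat \<tau> F (\<lambda>q. x q + y q) = (\<integral>\<omega>. w \<omega> * G \<omega> \<partial>gauss)" .
          have R: "\<bar>G \<omega> * (w \<omega> - 1 - dot n e \<omega>)\<bar> \<le> (r\<^sup>2 * (3 * exp 2)) * exp (2 * sumabs n \<omega>)" for \<omega>
          proof -
            have "\<bar>G \<omega> * (w \<omega> - 1 - dot n e \<omega>)\<bar> \<le> 1 * \<bar>w \<omega> - 1 - dot n e \<omega>\<bar>"
              unfolding abs_mult using G01[of \<omega>] by (intro mult_right_mono) auto
            also have "\<dots> \<le> 3 * r\<^sup>2 * exp (2 * sumabs n \<omega> + 2)"
              unfolding w_def mult_1 by (rule tilt_remainder) (use True abs_dot_le_sumabs in \<open>auto simp: r_def\<close>)
            finally show ?thesis by (simp add: exp_add mult_ac)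
          qed
          note I = integrable_dominated_sumabs[OF _ R]
          have i1: "integrable gauss (\<lambda>\<omega>. G \<omega> * (w \<omega> - 1 - dot n e \<omega>))" by (rule I(1)) simp
          have i2: "integrable gauss (\<lambda>\<omega>. G \<omega> * dot n e \<omega>)" by (rule integrable_dominated_sumabs(1)[OF _ Gd]) simp
          have "(\<integral>\<omega>. w \<omega> * G \<omega> \<partial>gauss) = (\<integral>\<omega>. G \<omega> * (w \<omega> - 1 - dot n e \<omega>) + (G \<omega> + G \<omega> * dot n e \<omega>) \<partial>gauss)"
            by (simp add: algebra_simps)
          also have "\<dots> = (\<integral>\<omega>. G \<omega> * (w \<omega> - 1 - dot n e \<omega>) \<partial>gauss) + (heat \<tau> F x + dot n g y)"
            unfolding h0 ye dg using i1 i2 Gi by simp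
          finally have "heat \<tau> F (\<lambda>q. x q + y q) - heat \<tau> F x - dot n g y = (\<integral>\<omega>. G \<omega> * (w \<omega> - 1 - dot n e \<omega>) \<partial>gauss)"
            unfolding h1 by simp
          then show ?thesis using I(2) by (simp add: E_def mult_ac)
        next
          case False
          then have r: "1 \<le> r" by simp
          have "\<bar>heat \<tau> F (\<lambda>q. x q + y q) - heat \<tau> F x\<bar> \<le> 1"
            using heat_bounds[OF F F0 F1, of \<tau> "\<lambda>q. x q + y q"] heat_bounds[OF F F0 F1, of \<tau> x] by (simp add: abs_le_iff)
          moreover have "\<bar>dot n g y\<bar> \<le> r * E" using dgb[of e] by (simp add: ye r_def)
          moreover have "1 + r * E \<le> r\<^sup>2 * (2 * E)"
          proof -
            have "r \<le> r\<^sup>2" using r by (simp add: power2_eq_square mult_left_le)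
            then have "r * E \<le> r\<^sup>2 * E" "1 \<le> r\<^sup>2 * E"
              using r E1 mult_mono[of 1 "r\<^sup>2" 1 E] by (auto intro: mult_right_mono)
            then show ?thesis by simp
          qed
          moreover have "r\<^sup>2 * (2 * E) \<le> r\<^sup>2 * (3 * exp 2 * E)"
          proof (intro mult_left_mono mult_right_mono)
            have "1 \<le> exp (2::real)" by simp
            then show "2 \<le> 3 * exp (2::real)" by linarith
          qed (use E1 in auto)
          ultimately show ?thesis by (simp add: abs_le_iff)
        qed
        also have "r\<^sup>2 * (3 * exp 2 * E) = 3 * exp 2 * E / \<tau> * (nrm n y)\<^sup>2"
          unfolding ny r_def using tau by simp
        also have "\<dots> \<le> L * (nrm n y)\<^sup>2" using L by (intro mult_right_mono) auto
        finally show "\<bar>heat \<tau> F (\<lambda>q. x q + y q) - heat \<tau> F x - dot n g y\<bar> \<le> L * (nrm n y)\<^sup>2" .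
      qed
    qed
  qed
qed

subsection \<open>The Gaussian distribution function\<close>

definition Phi :: "real \<Rightarrow> real" where "Phi = cdf std_normal_distribution"

text \<open>Real-valued companion of \<open>Phi_inv\<close>, meaningful on ]0,1[ only; elsewhere its
  value is arbitrary.\<close>

definition Phinv :: "real \<Rightarrow> real" where "Phinv = inv_into UNIV Phi"

lemma continuous_std_normal_density: "continuous_on S std_normal_density"
  unfolding normal_density_def by (intro continuous_intros) auto

lemma Phi_diff: "a \<le> b \<Longrightarrow> Phi b - Phi a = integral {a..b} std_normal_density"
proof -
  assume ab: "a \<le> b"
  interpret real_distribution std_normal_distribution by (rule real_dist_normal_dist)
  have fin: "finite_borel_measure std_normal_distribution" ..
  have i: "set_integrable lborel {a..b} std_normal_density"
    unfolding set_integrable_def by (intro integrable_mult_indicator) auto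
  have "Phi b - Phi a = measure std_normal_distribution {a<..b}"
    using cdf_diff_eq[of a b] ab by (cases "a = b") (auto simp: Phi_def)
  also have "\<dots> = (LBINT x:{a<..b}. std_normal_density x)"
    by (simp add: measure_def emeasure_density set_lebesgue_integral_def integral_eq_nn_integral
        ennreal_mult' mult.commute ennreal_indicator) 
  also have "\<dots> = (LBINT x:{a..b}. std_normal_density x)"
  proof (rule set_integral_null_delta)
    have "sym_diff {a<..b} {a..b} = {a}" using ab by auto
    then show "sym_diff {a<..b} {a..b} \<in> null_sets lborel" by (auto intro!: null_setsI)
  qed auto
  also have "\<dots> = integral {a..b} std_normal_density"
    by (rule set_borel_integral_eq_integral(2)[OF i])
  finally show ?thesis .
qed

lemma Phi_deriv: "(Phi has_real_derivative std_normal_density x) (at x)"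
proof -
  have "((\<lambda>u. integral {x - 1..u} std_normal_density) has_real_derivative std_normal_density x) (at x within {x - 1..x + 1})"
    by (rule integral_has_real_derivative) (auto intro: continuous_std_normal_density)
  then have "((\<lambda>u. Phi (x - 1) + integral {x - 1..u} std_normal_density) has_real_derivative std_normal_density x) (at x within {x - 1..x + 1})"
    by (auto intro!: derivative_eq_intros)
  then have "(Phi has_real_derivative std_normal_density x) (at x within {x - 1..x + 1})"
    by (rule has_field_derivative_transform_within[where d=1]) (auto simp: Phi_diff[symmetric])
  then show ?thesis by (simp add: at_within_Icc_at)
qed

lemma phi_pos[simp]: "0 < std_normal_density x" by (simp add: normal_density_pos)

lemma phi_nonzero[simp]: "std_normal_density x \<noteq> 0"
  using phi_pos[of x] by linarith

lemma Phi_strict_mono: "x < y \<Longrightarrow> Phi x < Phi y"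
  by (rule DERIV_pos_imp_increasing) (auto intro!: Phi_deriv exI)

lemma Phi_less_iff[simp]: "Phi x < Phi y \<longleftrightarrow> x < y"
  using Phi_strict_mono by (metis less_asym linorder_neqE)

lemma Phi_le_iff[simp]: "Phi x \<le> Phi y \<longleftrightarrow> x \<le> y"
  by (simp add: not_less[symmetric])

lemma inj_Phi: "inj Phi"
  by (rule injI) (metis Phi_less_iff linorder_neqE_linordered_idom order_less_irrefl)

lemma isCont_Phi: "isCont Phi x" using DERIV_isCont[OF Phi_deriv] .

lemma borel_measurable_Phi[measurable]: "Phi \<in> borel_measurable borel"
  by (intro borel_measurable_continuous_onI continuous_at_imp_continuous_on) (auto intro: isCont_Phi)

lemma Phi_lim: "(Phi \<longlongrightarrow> 0) at_bot" "(Phi \<longlongrightarrow> 1) at_top"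
proof -
  interpret real_distribution std_normal_distribution by (rule real_dist_normal_dist)
  show "(Phi \<longlongrightarrow> 0) at_bot" "(Phi \<longlongrightarrow> 1) at_top"
    unfolding Phi_def using cdf_lim_at_bot cdf_lim_at_top_prob by auto
qed

lemma Phi_bounds[simp]: "0 < Phi x" "Phi x < 1" "0 \<le> Phi x" "Phi x \<le> 1"
proof -
  interpret real_distribution std_normal_distribution by (rule real_dist_normal_dist)
  have a: "0 \<le> Phi x" "Phi x \<le> 1" for x unfolding Phi_def by (auto simp: cdf_nonneg cdf_bounded_prob)
  show "0 < Phi x" "Phi x < 1" "0 \<le> Phi x" "Phi x \<le> 1"
    using a[of x] a[of "x - 1"] a[of "x + 1"] Phi_strict_mono[of "x - 1" x] Phi_strict_mono[of x "x + 1"] by linarith+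
qed

lemma Phi_surj: assumes "0 < p" "p < 1" shows "\<exists>x. Phi x = p"
proof -
  obtain u where u: "Phi u < p" using order_tendstoD(2)[OF Phi_lim(1) assms(1)]
    by (auto simp: eventually_at_bot_linorder)
  obtain v where v: "p < Phi v" using order_tendstoD(1)[OF Phi_lim(2) assms(2)]
    by (auto simp: eventually_at_top_linorder)
  have "u \<le> v" using u v Phi_less_iff[of u v] by linarith
  then show ?thesis using IVT[of Phi u p v] u v isCont_Phi by fastforce
qed

lemma Phinv_Phi[simp]: "Phinv (Phi x) = x"
  unfolding Phinv_def using inj_Phi by (simp add: inv_f_f)

lemma Phi_Phinv[simp]: "0 < p \<Longrightarrow> p < 1 \<Longrightarrow> Phi (Phinv p) = p"
  using Phi_surj Phinv_Phi by metis

lemma Phinv_mono: "0 < p \<Longrightarrow> p \<le> q \<Longrightarrow> q < 1 \<Longrightarrow> Phinv p \<le> Phinv q"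
  using Phi_le_iff[of "Phinv p" "Phinv q"] by simp

lemma isCont_Phinv: assumes "0 < p" "p < 1" shows "isCont Phinv p"
proof -
  have "isCont Phinv (Phi (Phinv p))"
    by (rule isCont_inverse_function[where d=1]) (auto intro: isCont_Phi)
  then show ?thesis using assms by simp
qed

lemma Phinv_deriv:
  assumes "0 < p" "p < 1" shows "(Phinv has_real_derivative inverse (std_normal_density (Phinv p))) (at p)"
  by (rule DERIV_inverse_function[where a=0 and b=1 and f=Phi])
    (use assms Phi_deriv[of "Phinv p"] isCont_Phinv in auto)

lemma phi_deriv: "(std_normal_density has_real_derivative - x * std_normal_density x) (at x)"
  unfolding normal_density_def by (auto intro!: derivative_eq_intros simp: field_simps power2_eq_square)

lemma phi_le_half: "std_normal_density x \<le> 1 / 2 * exp (- x\<^sup>2 / 2)"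
proof -
  have "2 \<le> sqrt (2 * pi)" using pi_gt3 by (intro real_le_rsqrt) simp
  then have "1 / sqrt (2 * pi) \<le> 1 / 2" by (intro divide_left_mono) auto
  then show ?thesis unfolding std_normal_density_def by (rule mult_right_mono) auto
qed

text \<open>The three quantities are, up to sign, the density and its first two derivatives. All are
  controlled by 1 + x^2 times the density, through 1 + x^2 \<le> 2 exp (x^2/2) and 2 \<le> sqrt (2
  pi).\<close>

lemma phi_bounds:
  "std_normal_density x \<le> 1" "\<bar>x * std_normal_density x\<bar> \<le> 1" "\<bar>(x\<^sup>2 - 1) * std_normal_density x\<bar> \<le> 1"
proof -
  have e: "1 + x\<^sup>2 \<le> 2 * exp (x\<^sup>2 / 2)" using exp_ge_add_one_self[of "x\<^sup>2 / 2"] by linarith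
  have "(1 + x\<^sup>2) * std_normal_density x \<le> (2 * exp (x\<^sup>2 / 2)) * (1 / 2 * exp (- x\<^sup>2 / 2))"
    by (intro mult_mono e phi_le_half) (auto intro: less_imp_le)
  also have "\<dots> = 1" by (simp add: exp_add[symmetric])
  finally have m: "(1 + x\<^sup>2) * std_normal_density x \<le> 1" .
  have ineq: "\<bar>y * std_normal_density x\<bar> \<le> 1" if "\<bar>y\<bar> \<le> 1 + x\<^sup>2" for y
    using mult_right_mono[OF that less_imp_le[OF phi_pos[of x]]] m
    unfolding abs_mult abs_of_pos[OF phi_pos] by linarith
  have "\<bar>x\<bar> \<le> 1 + x\<^sup>2"
    using sum_squares_bound[of "\<bar>x\<bar>" 1] by (auto simp: power2_eq_square abs_if)
  then show "\<bar>x * std_normal_density x\<bar> \<le> 1" by (rule ineq)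
  show "std_normal_density x \<le> 1" using ineq[of 1] by simp
  show "\<bar>(x\<^sup>2 - 1) * std_normal_density x\<bar> \<le> 1" by (rule ineq) (simp add: abs_le_iff)
qed

text \<open>The derivative of the density at b is -b times the density, hence the bracket r - b
  r^2/2; it is the source of the term v |\<nabla>v|^2 in the evolution equation of v. The third
  derivative of \<open>Phi\<close> is bounded by 1.\<close>

lemma Phi_Taylor3: "\<bar>Phi (b + r) - (Phi b + std_normal_density b * (r - b * r\<^sup>2 / 2))\<bar> \<le> \<bar>r\<bar> ^ 3"
proof (cases "r = 0")
  case False
  define diff where "diff m = (if m = 0 then Phi else if m = 1 then std_normal_density
    else if m = 2 then (\<lambda>x. - x * std_normal_density x) else (\<lambda>x. (x\<^sup>2 - 1) * std_normal_density x))" for m :: nat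
  have d2: "((\<lambda>x. - x * std_normal_density x) has_real_derivative (x\<^sup>2 - 1) * std_normal_density x) (at x)" for x
    by (auto intro!: derivative_eq_intros phi_deriv simp: algebra_simps power2_eq_square)
  have D: "\<forall>m t. m < 3 \<and> min b (b + r) \<le> t \<and> t \<le> max b (b + r) \<longrightarrow> DERIV (diff m) t :> diff (Suc m) t"
    using Phi_deriv phi_deriv d2 by (auto simp: diff_def numeral_3_eq_3 less_Suc_eq)
  obtain t where t: "Phi (b + r) = (\<Sum>m<3. (diff m b / fact m) * (b + r - b)^m) + (diff 3 t / fact 3) * (b + r - b)^3"
    using Taylor[of 3 diff Phi "min b (b + r)" "max b (b + r)" b "b + r", OF _ _ D] False
    by (auto simp: diff_def)
  have "Phi (b + r) - (Phi b + std_normal_density b * (r - b * r\<^sup>2 / 2)) = ((t\<^sup>2 - 1) * std_normal_density t) / 6 * r ^ 3"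
    unfolding t by (simp add: diff_def eval_nat_numeral algebra_simps)
  from arg_cong[OF this, of abs]
  have "\<bar>Phi (b + r) - (Phi b + std_normal_density b * (r - b * r\<^sup>2 / 2))\<bar> = \<bar>(t\<^sup>2 - 1) * std_normal_density t\<bar> / 6 * \<bar>r\<bar> ^ 3"
    unfolding abs_mult abs_divide power_abs by simp
  also have "\<dots> \<le> 1 * \<bar>r\<bar> ^ 3"
    using phi_bounds(3)[of t] by (intro mult_right_mono) auto
  finally show ?thesis by simp
qed simp

lemma phi_lower: assumes "\<bar>x\<bar> \<le> M" shows "std_normal_density M \<le> std_normal_density x"
proof -
  have "x\<^sup>2 \<le> M\<^sup>2" using assms by (metis abs_ge_zero power2_abs power_mono)
  then show ?thesis by (simp add: std_normal_density_def divide_right_mono)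
qed

text \<open>With f = \<open>Phinv\<close> one has f' = 1 / \<phi>(f) and f'' = f (f')^2, where
  \<phi> is the density; \<phi>(f) stays away from 0 as long as f is bounded, which monotonicity
  gives on a compact part of ]0,1[. One constant is used for all bounds.\<close>

lemma Phinv_smooth:
  assumes "0 < \<eta>" "\<eta> \<le> \<zeta>" "\<zeta> < 1"
  obtains K where "K \<ge> 1" "\<And>u. \<eta> \<le> u \<Longrightarrow> u \<le> \<zeta> \<Longrightarrow> \<bar>Phinv u\<bar> \<le> K"
    "\<And>u. \<eta> \<le> u \<Longrightarrow> u \<le> \<zeta> \<Longrightarrow> inverse (std_normal_density (Phinv u)) \<le> K"
    "\<And>u w. \<eta> \<le> u \<Longrightarrow> u \<le> \<zeta> \<Longrightarrow> \<eta> \<le> w \<Longrightarrow> w \<le> \<zeta> \<Longrightarrow> \<bar>Phinv u - Phinv w\<bar> \<le> K * \<bar>u - w\<bar>"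
    "\<And>u w. \<eta> \<le> u \<Longrightarrow> u \<le> \<zeta> \<Longrightarrow> \<eta> \<le> w \<Longrightarrow> w \<le> \<zeta> \<Longrightarrow>
      \<bar>Phinv u - Phinv w - inverse (std_normal_density (Phinv w)) * (u - w)\<bar> \<le> K * (u - w)\<^sup>2"
proof -
  define A where "A = \<bar>Phinv \<eta>\<bar> + \<bar>Phinv \<zeta>\<bar>"
  define B where "B = inverse (std_normal_density A)"
  define K where "K = 1 + A + B + A * B\<^sup>2"
  have A0: "0 \<le> A" and B0: "0 < B" by (auto simp: A_def B_def)
  have q: "\<bar>Phinv u\<bar> \<le> A" if "\<eta> \<le> u" "u \<le> \<zeta>" for u
    using Phinv_mono[of \<eta> u] Phinv_mono[of u \<zeta>] that assms unfolding A_def by linarith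
  have d: "inverse (std_normal_density (Phinv u)) \<le> B" "0 < inverse (std_normal_density (Phinv u))" if "\<eta> \<le> u" "u \<le> \<zeta>" for u
    using phi_lower[OF q[OF that]] unfolding B_def by (auto intro!: le_imp_inverse_le)
  have KB: "A \<le> K" "B \<le> K" "A * B\<^sup>2 \<le> K" "1 \<le> K" using A0 B0 by (auto simp: K_def)
  have D1: "(Phinv has_real_derivative inverse (std_normal_density (Phinv u))) (at u)" if "\<eta> \<le> u" "u \<le> \<zeta>" for u
    by (rule Phinv_deriv) (use that assms in auto)
  have D2: "((\<lambda>u. inverse (std_normal_density (Phinv u))) has_real_derivative
      Phinv u * (inverse (std_normal_density (Phinv u)))\<^sup>2) (at u)" if "\<eta> \<le> u" "u \<le> \<zeta>" for u
    using DERIV_inverse'[OF DERIV_chain2[OF phi_deriv D1[OF that]]] phi_pos[of "Phinv u"]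
    by (simp add: power2_eq_square field_simps)
  show thesis
  proof (rule that[of K])
    show "\<bar>Phinv u\<bar> \<le> K" if "\<eta> \<le> u" "u \<le> \<zeta>" for u using q[OF that] KB by linarith
    show "inverse (std_normal_density (Phinv u)) \<le> K" if "\<eta> \<le> u" "u \<le> \<zeta>" for u using d[OF that] KB by linarith
    have lip: "\<bar>f u - f w\<bar> \<le> C * \<bar>u - w\<bar>"
      if uw: "\<eta> \<le> u" "u \<le> \<zeta>" "\<eta> \<le> w" "w \<le> \<zeta>"
      and D: "\<And>x. \<eta> \<le> x \<Longrightarrow> x \<le> \<zeta> \<Longrightarrow> (f has_real_derivative f' x) (at x)"
      and b: "\<And>x. \<eta> \<le> x \<Longrightarrow> x \<le> \<zeta> \<Longrightarrow> \<bar>f' x\<bar> \<le> C" for f f' :: "real \<Rightarrow> real" and C u w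
    proof -
      have "norm (f u - f w) \<le> C * norm (u - w)"
        by (rule field_differentiable_bound[where S="{\<eta>..\<zeta>}" and f'=f'])
          (use uw D b in \<open>auto intro: has_field_derivative_at_within\<close>)
      then show ?thesis by simp
    qed
    show "\<bar>Phinv u - Phinv w\<bar> \<le> K * \<bar>u - w\<bar>" if "\<eta> \<le> u" "u \<le> \<zeta>" "\<eta> \<le> w" "w \<le> \<zeta>" for u w
    proof -
      have "\<bar>inverse (std_normal_density (Phinv x))\<bar> \<le> K" if "\<eta> \<le> x" "x \<le> \<zeta>" for x using d[OF that] KB by linarith
      from lip[OF that D1 this] show ?thesis .
    qed
    show "\<bar>Phinv u - Phinv w - inverse (std_normal_density (Phinv w)) * (u - w)\<bar> \<le> K * (u - w)\<^sup>2"
      if uw: "\<eta> \<le> u" "u \<le> \<zeta>" "\<eta> \<le> w" "w \<le> \<zeta>" for u w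
    proof -
      have bd: "\<bar>Phinv x * (inverse (std_normal_density (Phinv x)))\<^sup>2\<bar> \<le> K" if "\<eta> \<le> x" "x \<le> \<zeta>" for x
      proof -
        have "\<bar>Phinv x * (inverse (std_normal_density (Phinv x)))\<^sup>2\<bar> \<le> A * B\<^sup>2"
          unfolding abs_mult abs_power2 using q[OF that] d[OF that] A0 by (intro mult_mono power_mono) auto
        then show ?thesis using KB by linarith
      qed
      have lip2: "\<bar>inverse (std_normal_density (Phinv x)) - inverse (std_normal_density (Phinv w))\<bar> \<le> K * \<bar>x - w\<bar>"
        if "\<eta> \<le> x" "x \<le> \<zeta>" for x
        by (rule lip[OF that uw(3,4) D2 bd])
      \<comment> \<open>After removal of the tangent at \<open>w\<close> the derivative is at most K
        |u - w| between \<open>u\<close> and \<open>w\<close>, so the mean value bound becomes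
        quadratic.\<close>
      define f where "f x = Phinv x - inverse (std_normal_density (Phinv w)) * x" for x
      have "norm (f u - f w) \<le> (K * \<bar>u - w\<bar>) * norm (u - w)"
      proof (rule field_differentiable_bound[where S="{min u w..max u w}" and
            f'="\<lambda>x. inverse (std_normal_density (Phinv x)) - inverse (std_normal_density (Phinv w))"])
        fix z assume z: "z \<in> {min u w..max u w}"
        then have z': "\<eta> \<le> z" "z \<le> \<zeta>" using uw by auto
        show "(f has_real_derivative inverse (std_normal_density (Phinv z)) - inverse (std_normal_density (Phinv w))) (at z within {min u w..max u w})"
          unfolding f_def[abs_def] by (auto intro!: derivative_eq_intros has_field_derivative_at_within[OF D1[OF z']])
        have "\<bar>z - w\<bar> \<le> \<bar>u - w\<bar>" using z by auto
        then have "K * \<bar>z - w\<bar> \<le> K * \<bar>u - w\<bar>" using KB by (intro mult_left_mono) auto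
        then show "norm (inverse (std_normal_density (Phinv z)) - inverse (std_normal_density (Phinv w))) \<le> K * \<bar>u - w\<bar>"
          using lip2[OF z'] by simp
      qed auto
      then show ?thesis by (simp add: f_def power2_eq_square algebra_simps)
    qed
  qed (use KB in auto)
qed

subsection \<open>Small increments\<close>

text \<open>One integrable weight, at least 1, that dominates \<open>nrm n \<omega>\<close>. Its
  sixth power is the largest one used: increments are bounded by its square, and the Taylor
  remainder of \<open>Phi\<close> is cubic.\<close>

definition expabs :: "nat \<Rightarrow> (nat \<Rightarrow> real) \<Rightarrow> real" where "expabs n \<omega> = exp (sumabs n \<omega>)"

definition expmom :: "nat \<Rightarrow> real" where "expmom n = (\<integral>\<omega>. exp (6 * sumabs n \<omega>) \<partial>gauss)"

lemma expabs_ge_1[simp]: "1 \<le> expabs n \<omega>" by (simp add: expabs_def)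

lemma expabs_nonneg[simp]: "0 \<le> expabs n \<omega>" by (simp add: expabs_def)

lemma sumabs_le_expabs: "sumabs n \<omega> \<le> expabs n \<omega>"
  unfolding expabs_def using exp_ge_add_one_self[of "sumabs n \<omega>"] by linarith

lemma expabs_power6: "expabs n \<omega> ^ 6 = exp (6 * sumabs n \<omega>)"
  by (simp add: expabs_def exp_of_nat_mult[symmetric])

lemma expmom_ge_1: "1 \<le> expmom n"
  unfolding expmom_def by (rule gauss.integral_ge_const[OF integrable_exp_sumabs]) simp

lemma integrable_expabs_bound:
  assumes [measurable]: "f \<in> borel_measurable borel" and b: "\<And>\<omega>. \<bar>f \<omega>\<bar> \<le> K * expabs n \<omega> ^ j" and j: "j \<le> 6" and K: "0 \<le> K"
  shows "integrable gauss (f :: _ \<Rightarrow> real)" "\<bar>\<integral>\<omega>. f \<omega> \<partial>gauss\<bar> \<le> K * expmom n"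
proof -
  have c: "\<bar>f \<omega>\<bar> \<le> K * exp (6 * sumabs n \<omega>)" for \<omega>
    using b[of \<omega>] mult_left_mono[OF power_increasing[OF j expabs_ge_1[of n \<omega>]] K]
    by (simp add: expabs_power6)
  show "integrable gauss f" "\<bar>\<integral>\<omega>. f \<omega> \<partial>gauss\<bar> \<le> K * expmom n"
    unfolding expmom_def using integrable_dominated_sumabs[OF assms(1) c] by auto
qed

text \<open>
  Orders in \<open>\<sigma>\<close>: the increment \<open>r\<close> is linear of order \<open>\<sigma>\<close> up to \<open>O(\<sigma>\<^sup>2)\<close>, so that its mean and its second
  moment matter at order \<open>\<sigma>\<^sup>2\<close>, and everything else is \<open>O(\<sigma>\<^sup>3)\<close>.
\<close>

lemma small_perturbation:
  assumes [measurable]: "r \<in> borel_measurable borel"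
    and L: "0 \<le> L" and \<sigma>: "0 < \<sigma>" "\<sigma> \<le> 1" and g: "nrm n g \<le> L"
    and r: "\<And>\<omega>. \<bar>r \<omega> - \<sigma> * dot n g \<omega>\<bar> \<le> 2 * L * \<sigma>\<^sup>2 * (expabs n \<omega>)\<^sup>2"
  shows "integrable gauss r"
    and "\<bar>(\<integral>\<omega>. (r \<omega>)\<^sup>2 \<partial>gauss) - \<sigma>\<^sup>2 * (nrm n g)\<^sup>2\<bar> \<le> 8 * L\<^sup>2 * \<sigma>^3 * expmom n"
    and "\<bar>(\<integral>\<omega>. Phi (b + r \<omega>) \<partial>gauss) -
      (Phi b + std_normal_density b * ((\<integral>\<omega>. r \<omega> \<partial>gauss) - b * (\<integral>\<omega>. (r \<omega>)\<^sup>2 \<partial>gauss) / 2))\<bar> \<le> 27 * L^3 * \<sigma>^3 * expmom n"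
proof -
  let ?V = "expabs n"
  have \<sigma>2: "\<sigma>\<^sup>2 \<le> \<sigma>" using \<sigma> by (simp add: power2_eq_square mult_left_le)
  have VV: "?V \<omega> \<le> (?V \<omega>)\<^sup>2" for \<omega> by (rule self_le_power) auto
  have X: "\<bar>\<sigma> * dot n g \<omega>\<bar> \<le> L * \<sigma> * (?V \<omega>)\<^sup>2" for \<omega>
  proof -
    have "\<bar>dot n g \<omega>\<bar> \<le> nrm n g * sumabs n \<omega>" by (rule abs_dot_le_sumabs)
    also have "\<dots> \<le> L * (?V \<omega>)\<^sup>2" using g L sumabs_le_expabs[of n \<omega>] VV[of \<omega>] by (intro mult_mono) auto
    finally have "\<sigma> * \<bar>dot n g \<omega>\<bar> \<le> \<sigma> * (L * (?V \<omega>)\<^sup>2)" using \<sigma> by (intro mult_left_mono) auto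
    then show ?thesis using \<sigma> by (simp add: abs_mult mult_ac)
  qed
  have rem: "2 * L * \<sigma>\<^sup>2 * (?V \<omega>)\<^sup>2 \<le> 2 * L * \<sigma> * (?V \<omega>)\<^sup>2" for \<omega>
    using \<sigma>2 L by (intro mult_right_mono mult_left_mono) auto
  have rb: "\<bar>r \<omega>\<bar> \<le> 3 * L * \<sigma> * (?V \<omega>)\<^sup>2" for \<omega>
    using r[of \<omega>] X[of \<omega>] rem[of \<omega>] by linarith
  have ri: "integrable gauss r" by (rule integrable_expabs_bound(1)[OF _ rb]) (use L \<sigma> in auto)
  then show "integrable gauss r" .
  have r2b: "\<bar>(r \<omega>)\<^sup>2\<bar> \<le> (3 * L * \<sigma>)\<^sup>2 * (?V \<omega>)^4" for \<omega>
    using power_mono[OF rb[of \<omega>], of 2] by (simp add: power_mult_distrib)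
  have r2i: "integrable gauss (\<lambda>\<omega>. (r \<omega>)\<^sup>2)" by (rule integrable_expabs_bound(1)[OF _ r2b]) auto
  have r3b: "\<bar>r \<omega>\<bar>^3 \<le> 27 * L^3 * \<sigma>^3 * (?V \<omega>)^6" for \<omega>
    using power_mono[OF rb[of \<omega>], of 3] by (simp add: power_mult_distrib)
  have d2b: "\<bar>(r \<omega>)\<^sup>2 - \<sigma>\<^sup>2 * (dot n g \<omega>)\<^sup>2\<bar> \<le> 8 * L\<^sup>2 * \<sigma>^3 * (?V \<omega>)^4" for \<omega>
  proof -
    have "\<bar>(r \<omega>)\<^sup>2 - \<sigma>\<^sup>2 * (dot n g \<omega>)\<^sup>2\<bar> = \<bar>r \<omega> - \<sigma> * dot n g \<omega>\<bar> * \<bar>r \<omega> + \<sigma> * dot n g \<omega>\<bar>"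
      unfolding abs_mult[symmetric] by (simp add: power2_eq_square algebra_simps)
    also have "\<dots> \<le> (2 * L * \<sigma>\<^sup>2 * (?V \<omega>)\<^sup>2) * (4 * L * \<sigma> * (?V \<omega>)\<^sup>2)"
      using r[of \<omega>] rb[of \<omega>] X[of \<omega>] L by (intro mult_mono) auto
    also have "\<dots> = 8 * L\<^sup>2 * \<sigma>^3 * (?V \<omega>)^4" by (simp add: eval_nat_numeral algebra_simps)
    finally show ?thesis .
  qed
  have "(\<integral>\<omega>. (r \<omega>)\<^sup>2 - \<sigma>\<^sup>2 * (dot n g \<omega>)\<^sup>2 \<partial>gauss) = (\<integral>\<omega>. (r \<omega>)\<^sup>2 \<partial>gauss) - \<sigma>\<^sup>2 * (nrm n g)\<^sup>2"
    using r2i gauss_dot_sq[of n g] by simp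
  moreover have "\<bar>\<integral>\<omega>. (r \<omega>)\<^sup>2 - \<sigma>\<^sup>2 * (dot n g \<omega>)\<^sup>2 \<partial>gauss\<bar> \<le> 8 * L\<^sup>2 * \<sigma>^3 * expmom n"
    by (rule integrable_expabs_bound(2)[OF _ d2b]) (use \<sigma> in auto)
  ultimately show "\<bar>(\<integral>\<omega>. (r \<omega>)\<^sup>2 \<partial>gauss) - \<sigma>\<^sup>2 * (nrm n g)\<^sup>2\<bar> \<le> 8 * L\<^sup>2 * \<sigma>^3 * expmom n" by simp
  have Pi: "integrable gauss (\<lambda>\<omega>. Phi (b + r \<omega>))"
    by (intro gauss.integrable_const_bound[where B=1]) (auto simp: abs_of_pos)
  have T: "\<bar>Phi (b + r \<omega>) - (Phi b + std_normal_density b * (r \<omega> - b * (r \<omega>)\<^sup>2 / 2))\<bar> \<le> 27 * L^3 * \<sigma>^3 * (?V \<omega>)^6" for \<omega>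
    using Phi_Taylor3[of b "r \<omega>"] r3b[of \<omega>] by linarith
  have "(\<integral>\<omega>. Phi (b + r \<omega>) - (Phi b + std_normal_density b * (r \<omega> - b * (r \<omega>)\<^sup>2 / 2)) \<partial>gauss)
    = (\<integral>\<omega>. Phi (b + r \<omega>) \<partial>gauss) - (Phi b + std_normal_density b * ((\<integral>\<omega>. r \<omega> \<partial>gauss) - b * (\<integral>\<omega>. (r \<omega>)\<^sup>2 \<partial>gauss) / 2))"
    using Pi ri r2i by (simp add: gauss.prob_space[unfolded space_gauss])
  moreover have "\<bar>\<integral>\<omega>. Phi (b + r \<omega>) - (Phi b + std_normal_density b * (r \<omega> - b * (r \<omega>)\<^sup>2 / 2)) \<partial>gauss\<bar> \<le> 27 * L^3 * \<sigma>^3 * expmom n"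
    by (rule integrable_expabs_bound(2)[OF _ T]) (use \<sigma> L in auto)
  ultimately show "\<bar>(\<integral>\<omega>. Phi (b + r \<omega>) \<partial>gauss) -
      (Phi b + std_normal_density b * ((\<integral>\<omega>. r \<omega> \<partial>gauss) - b * (\<integral>\<omega>. (r \<omega>)\<^sup>2 \<partial>gauss) / 2))\<bar> \<le> 27 * L^3 * \<sigma>^3 * expmom n"
    by simp
qed

text \<open>If the mean of \<open>Phi\<close> does not change, the expansion of \<open>Phi\<close>
  determines the mean of the increment: half of b times its second moment, up to order \<sigma>^3.
  This is the evolution equation of v in discrete form; dividing by the density is harmless as long
  as b is bounded.\<close>

lemma mean_of_increment:
  assumes [measurable]: "r \<in> borel_measurable borel"
    and L: "0 \<le> L" and \<sigma>: "0 < \<sigma>" "\<sigma> \<le> 1" and g: "nrm n g \<le> L"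
    and r: "\<And>\<omega>. \<bar>r \<omega> - \<sigma> * dot n g \<omega>\<bar> \<le> 2 * L * \<sigma>\<^sup>2 * (expabs n \<omega>)\<^sup>2"
    and b: "\<bar>b\<bar> \<le> W" and eq: "(\<integral>\<omega>. Phi (b + r \<omega>) \<partial>gauss) = Phi b"
  shows "\<bar>(\<integral>\<omega>. r \<omega> \<partial>gauss) - b * \<sigma>\<^sup>2 * (nrm n g)\<^sup>2 / 2\<bar> \<le> (27 * L^3 / std_normal_density W + 4 * W * L\<^sup>2) * expmom n * \<sigma>^3"
proof -
  note sp = small_perturbation[OF assms(1-6)]
  define d where "d = (\<integral>\<omega>. r \<omega> \<partial>gauss) - b * (\<integral>\<omega>. (r \<omega>)\<^sup>2 \<partial>gauss) / 2"
  have p: "std_normal_density W \<le> std_normal_density b" by (rule phi_lower[OF b])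
  have "std_normal_density b * \<bar>d\<bar> \<le> 27 * L^3 * \<sigma>^3 * expmom n"
    using sp(3)[of b] unfolding eq d_def[symmetric] by (simp add: abs_mult abs_of_pos)
  then have "std_normal_density W * \<bar>d\<bar> \<le> 27 * L^3 * \<sigma>^3 * expmom n"
    using mult_right_mono[OF p, of "\<bar>d\<bar>"] by simp
  then have d: "\<bar>d\<bar> \<le> 27 * L^3 / std_normal_density W * expmom n * \<sigma>^3"
    using phi_pos[of W] by (simp add: field_simps)
  have "\<bar>b * ((\<integral>\<omega>. (r \<omega>)\<^sup>2 \<partial>gauss) - \<sigma>\<^sup>2 * (nrm n g)\<^sup>2) / 2\<bar> \<le> W * (8 * L\<^sup>2 * \<sigma>^3 * expmom n) / 2"
    unfolding abs_mult abs_divide abs_numeral using b sp(2) by (intro divide_right_mono mult_mono) auto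
  moreover have "(\<integral>\<omega>. r \<omega> \<partial>gauss) - b * \<sigma>\<^sup>2 * (nrm n g)\<^sup>2 / 2 = d + b * ((\<integral>\<omega>. (r \<omega>)\<^sup>2 \<partial>gauss) - \<sigma>\<^sup>2 * (nrm n g)\<^sup>2) / 2"
    by (simp add: d_def algebra_simps diff_divide_distrib)
  ultimately have "\<bar>(\<integral>\<omega>. r \<omega> \<partial>gauss) - b * \<sigma>\<^sup>2 * (nrm n g)\<^sup>2 / 2\<bar> \<le> 27 * L^3 / std_normal_density W * expmom n * \<sigma>^3 + W * (8 * L\<^sup>2 * \<sigma>^3 * expmom n) / 2"
    using d by linarith
  then show ?thesis by (simp add: algebra_simps)
qed

subsection \<open>One step of the induction in time\<close>

text \<open>
  \<open>P i\<close> is the matrix of \<open>B\<^sub>i\<^sup>*B\<^sub>i\<close>.  Since \<open>B\<^sub>iB\<^sub>i\<^sup>* = I\<close>, every \<open>x\<^sub>i\<close> is of the form \<open>B\<^sub>iy\<^sub>i\<close> with \<open>y\<^sub>i \<in> \<real>\<^sup>n\<close>, and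
  \<open>\<lambda>\<^sub>iB\<^sub>i\<^sup>*x\<^sub>i = \<lambda>\<^sub>iP\<^sub>iy\<^sub>i\<close>; thus all functions live on the same space \<open>\<real>\<^sup>n\<close> and can be driven by the same noise.
\<close>

locale projections =
  fixes n :: nat and I :: "'i set" and l :: "'i \<Rightarrow> real" and P :: "'i \<Rightarrow> nat \<Rightarrow> nat \<Rightarrow> real"
  assumes finite_I: "finite I" and l_pos: "\<And>i. i \<in> I \<Longrightarrow> 0 < l i"
    and P_sym: "\<And>i q r. i \<in> I \<Longrightarrow> P i q r = P i r q"
    and P_idem: "\<And>i q r. i \<in> I \<Longrightarrow> q < n \<Longrightarrow> r < n \<Longrightarrow> (\<Sum>s<n. P i q s * P i s r) = P i q r"
    and P_sum: "\<And>q r. q < n \<Longrightarrow> r < n \<Longrightarrow> (\<Sum>i\<in>I. l i * P i q r) = (if q = r then 1 else 0)"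
begin

text \<open>The value zero beyond \<open>n\<close> makes the range a subspace of the sequences, so
  that idempotence and linearity hold as equations between functions.\<close>

definition proj :: "'i \<Rightarrow> (nat \<Rightarrow> real) \<Rightarrow> nat \<Rightarrow> real"
  where "proj i x q = (if q < n then \<Sum>r<n. P i q r * x r else 0)"

definition comb :: "('i \<Rightarrow> nat \<Rightarrow> real) \<Rightarrow> nat \<Rightarrow> real"
  where "comb y q = (\<Sum>i\<in>I. l i * proj i (y i) q)"

definition lsum :: real where "lsum = (\<Sum>i\<in>I. l i)"

lemma lsum_nonneg: "0 \<le> lsum" unfolding lsum_def using l_pos by (intro sum_nonneg) (auto intro: less_imp_le)

lemma proj_add: "proj i (\<lambda>q. x q + y q) = (\<lambda>q. proj i x q + proj i y q)"
  by (auto simp: proj_def distrib_left sum.distrib)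

lemma proj_diff: "proj i (\<lambda>q. x q - y q) = (\<lambda>q. proj i x q - proj i y q)"
  by (auto simp: proj_def right_diff_distrib sum_subtractf)

lemma proj_scale: "proj i (\<lambda>q. c * x q) = (\<lambda>q. c * proj i x q)"
  by (auto simp: proj_def sum_distrib_left mult_ac)

lemma proj_cong: "(\<And>q. q < n \<Longrightarrow> x q = y q) \<Longrightarrow> proj i x = proj i y"
  by (auto simp: proj_def)

lemma proj_proj: assumes "i \<in> I" shows "proj i (proj i x) = proj i x"
proof
  fix q show "proj i (proj i x) q = proj i x q"
  proof (cases "q < n")
    case True
    have "(\<Sum>s<n. P i q s * (\<Sum>r<n. P i s r * x r)) = (\<Sum>r<n. (\<Sum>s<n. P i q s * P i s r) * x r)"
      unfolding sum_distrib_left sum_distrib_right by (subst sum.swap) (simp add: mult.assoc)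
    then show ?thesis using True assms by (simp add: proj_def P_idem)
  qed (simp add: proj_def)
qed

lemma dot_proj: assumes "i \<in> I" shows "dot n (proj i x) y = dot n x (proj i y)"
proof -
  have "(\<Sum>q<n. (\<Sum>r<n. P i q r * x r) * y q) = (\<Sum>r<n. x r * (\<Sum>q<n. P i r q * y q))"
    unfolding sum_distrib_left sum_distrib_right
    by (subst sum.swap) (simp add: mult_ac P_sym[OF assms])
  then show ?thesis by (simp add: dot_def proj_def)
qed

lemma sum_proj: assumes "q < n" shows "(\<Sum>i\<in>I. l i * proj i x q) = x q"
proof -
  have "(\<Sum>i\<in>I. l i * proj i x q) = (\<Sum>i\<in>I. \<Sum>r<n. l i * P i q r * x r)"
    using assms by (simp add: proj_def sum_distrib_left mult.assoc)
  also have "\<dots> = (\<Sum>r<n. (\<Sum>i\<in>I. l i * P i q r) * x r)"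
    unfolding sum_distrib_right by (rule sum.swap)
  also have "\<dots> = (\<Sum>r<n. (if q = r then x r else 0))"
    using assms by (intro sum.cong refl) (simp add: P_sum)
  finally show ?thesis using assms by simp
qed

lemma nrm_proj_le: assumes "i \<in> I" shows "nrm n (proj i x) \<le> nrm n x"
proof -
  have "(nrm n (proj i x))\<^sup>2 = dot n x (proj i x)"
    by (simp add: nrm_sq dot_proj[OF assms] proj_proj[OF assms])
  also have "\<dots> \<le> nrm n x * nrm n (proj i x)" using abs_dot_le[of n x "proj i x"] by simp
  finally have "nrm n (proj i x) * nrm n (proj i x) \<le> nrm n x * nrm n (proj i x)" by (simp add: power2_eq_square)
  then show ?thesis
    using mult_right_le_imp_le[of "nrm n (proj i x)" "nrm n (proj i x)" "nrm n x"] nrm_nonneg[of n "proj i x"] nrm_nonneg[of n x] by linarith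
qed

text \<open>The weighted projections sum to the identity, so a vector added to all
  \<open>y i\<close> is added to \<open>comb y\<close>. A common noise on the left thus becomes the
  same noise on the right.\<close>

lemma comb_shift:
  assumes "q < n"
  shows "comb (\<lambda>i q. y i q + x q) q = comb y q + x q"
proof -
  have "comb (\<lambda>i q. y i q + x q) q = comb y q + (\<Sum>i\<in>I. l i * proj i x q)"
    by (simp add: comb_def proj_add distrib_left sum.distrib)
  then show ?thesis using sum_proj[OF assms] by simp
qed

text \<open>An invariant function sees only the projected increment, so its gradient may be replaced
  by the projected one with the same constant. \<open>gradient_defect\<close> requires gradients of
  this kind.\<close>

lemma C11_invariant_gradient:
  assumes i: "i \<in> I" and C: "C11 n L v" and inv: "\<And>x. v (proj i x) = v x"
  obtains g where "nrm n g \<le> L" "proj i g = g" "\<And>y. \<bar>v (\<lambda>q. x q + y q) - v x - dot n g y\<bar> \<le> L * (nrm n y)\<^sup>2"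
proof -
  obtain g where g: "nrm n g \<le> L" "\<And>y. \<bar>v (\<lambda>q. x q + y q) - v x - dot n g y\<bar> \<le> L * (nrm n y)\<^sup>2"
    using C unfolding C11_def by blast
  have L0: "0 \<le> L" using g(1) nrm_nonneg[of n g] by linarith
  show thesis
  proof (rule that)
    show "nrm n (proj i g) \<le> L" using nrm_proj_le[OF i] g(1) by (rule order_trans)
    show "proj i (proj i g) = proj i g" by (rule proj_proj[OF i])
    fix y
    have "v (\<lambda>q. x q + y q) = v (\<lambda>q. x q + proj i y q)"
      using inv[of "\<lambda>q. x q + y q"] inv[of "\<lambda>q. x q + proj i y q"] by (simp add: proj_add proj_proj[OF i])
    then have "\<bar>v (\<lambda>q. x q + y q) - v x - dot n (proj i g) y\<bar> \<le> L * (nrm n (proj i y))\<^sup>2"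
      using g(2)[of "proj i y"] by (simp add: dot_proj[OF i])
    also have "\<dots> \<le> L * (nrm n y)\<^sup>2"
      using nrm_proj_le[OF i] L0 by (intro mult_left_mono power_mono) auto
    finally show "\<bar>v (\<lambda>q. x q + y q) - v x - dot n (proj i g) y\<bar> \<le> L * (nrm n y)\<^sup>2" .
  qed
qed

text \<open>
  Perturbing \<open>y\<^sub>i\<close> in the direction \<open>q\<^sub>i - p\<close> does not change \<open>comb y\<close> (third claim), so at a near-maximiser over a
  fibre of \<open>comb\<close> the directional derivative (first claim) is small; it equals the weighted distance of the
  gradients \<open>q\<^sub>i\<close> from \<open>P\<^sub>ip\<close> (second claim).
\<close>

lemma gradient_defect:
  assumes q: "\<And>i. i \<in> I \<Longrightarrow> proj i (q i) = q i" and p: "p = (\<lambda>r. \<Sum>i\<in>I. l i * q i r)"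
  shows "(\<Sum>i\<in>I. l i * dot n (q i) (\<lambda>r. q i r - p r)) = (\<Sum>i\<in>I. l i * (nrm n (q i))\<^sup>2) - (nrm n p)\<^sup>2"
    and "(\<Sum>i\<in>I. l i * (nrm n (\<lambda>r. q i r - proj i p r))\<^sup>2) = (\<Sum>i\<in>I. l i * (nrm n (q i))\<^sup>2) - (nrm n p)\<^sup>2"
    and "\<And>r. r < n \<Longrightarrow> comb (\<lambda>i r. q i r - p r) r = 0"
proof -
  have dp: "(\<Sum>i\<in>I. l i * dot n (q i) x) = dot n p x" for x
    unfolding p dot_def sum_distrib_left sum_distrib_right by (subst sum.swap) (simp add: mult.assoc)
  \<comment> \<open>This is the identity \<Sum> \<lambda>_i |P_i p|^2 = |p|^2, with |P_i p|^2
    written as the inner product of P_i p and p.\<close>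
  have dpp: "(\<Sum>i\<in>I. l i * dot n (proj i p) p) = dot n p p"
  proof -
    have "(\<Sum>i\<in>I. l i * dot n (proj i p) p) = (\<Sum>r<n. (\<Sum>i\<in>I. l i * proj i p r) * p r)"
      unfolding dot_def sum_distrib_left sum_distrib_right by (subst sum.swap) (simp add: mult.assoc)
    then show ?thesis by (simp add: sum_proj dot_def)
  qed
  show "(\<Sum>i\<in>I. l i * dot n (q i) (\<lambda>r. q i r - p r)) = (\<Sum>i\<in>I. l i * (nrm n (q i))\<^sup>2) - (nrm n p)\<^sup>2"
    by (simp add: dot_diff_right right_diff_distrib sum_subtractf nrm_sq dp)
  have e: "(nrm n (\<lambda>r. q i r - proj i p r))\<^sup>2 = (nrm n (q i))\<^sup>2 - 2 * dot n (q i) p + dot n (proj i p) p" if "i \<in> I" for i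
  proof -
    have "dot n (proj i p) (q i) = dot n (q i) p" "dot n (q i) (proj i p) = dot n (q i) p" "dot n (proj i p) (proj i p) = dot n (proj i p) p"
      using dot_proj[OF that, of p "q i"] dot_proj[OF that, of "q i" p] dot_proj[OF that, of "proj i p" p] q[OF that] proj_proj[OF that]
      by (simp_all add: dot_commute)
    moreover have "(nrm n (\<lambda>r. q i r - proj i p r))\<^sup>2 = dot n (q i) (q i) - dot n (q i) (proj i p) - dot n (proj i p) (q i) + dot n (proj i p) (proj i p)"
      by (simp add: nrm_sq dot_def algebra_simps sum.distrib sum_subtractf sum_distrib_left)
    ultimately show ?thesis by (simp add: nrm_sq)
  qed
  have "(\<Sum>i\<in>I. l i * (nrm n (\<lambda>r. q i r - proj i p r))\<^sup>2) = (\<Sum>i\<in>I. l i * (nrm n (q i))\<^sup>2 - 2 * (l i * dot n (q i) p) + l i * dot n (proj i p) p)"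
    by (intro sum.cong refl) (simp add: e algebra_simps)
  also have "\<dots> = (\<Sum>i\<in>I. l i * (nrm n (q i))\<^sup>2) - 2 * (\<Sum>i\<in>I. l i * dot n (q i) p) + (\<Sum>i\<in>I. l i * dot n (proj i p) p)"
    by (simp add: sum.distrib sum_subtractf sum_distrib_left)
  finally show "(\<Sum>i\<in>I. l i * (nrm n (\<lambda>r. q i r - proj i p r))\<^sup>2) = (\<Sum>i\<in>I. l i * (nrm n (q i))\<^sup>2) - (nrm n p)\<^sup>2"
    by (simp add: dp dpp nrm_sq)
  fix r assume r: "r < n"
  have "comb (\<lambda>i r. q i r - p r) r = (\<Sum>i\<in>I. l i * q i r) - (\<Sum>i\<in>I. l i * proj i p r)"
    unfolding comb_def proj_diff by (simp add: right_diff_distrib sum_subtractf q)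
  then show "comb (\<lambda>i r. q i r - p r) r = 0" by (simp add: sum_proj[OF r] p)
qed

text \<open>
  This is the second-order term of the induction step.  The constant \<open>a\<close> drops out up to the defect, and the rest has
  a sign because \<open>w\<^sub>i \<le> 0\<close> and \<open>|P\<^sub>ip| \<le> |p|\<close>.
\<close>

lemma quadratic_form_bound:
  assumes q: "\<And>i. i \<in> I \<Longrightarrow> proj i (q i) = q i" and p: "p = (\<lambda>r. \<Sum>i\<in>I. l i * q i r)"
    and \<sigma>: "0 < \<sigma>" "\<sigma> \<le> 1" and D: "(\<Sum>i\<in>I. l i * (nrm n (q i))\<^sup>2) - (nrm n p)\<^sup>2 \<le> K * \<sigma>\<^sup>2"
    and w: "\<And>i. i \<in> I \<Longrightarrow> - W \<le> w i" "\<And>i. i \<in> I \<Longrightarrow> w i \<le> 0" and W: "0 \<le> W" and m: "m \<le> 0" and pB: "nrm n p \<le> B"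
  shows "(\<Sum>i\<in>I. l i * ((w i + a) * (nrm n (q i))\<^sup>2)) - (a + m + (\<Sum>i\<in>I. l i * w i)) * (nrm n p)\<^sup>2
    \<ge> - (\<bar>a\<bar> * K + W * (lsum * B\<^sup>2 + 2 * K)) * \<sigma>"
proof -
  define D where "D = (\<Sum>i\<in>I. l i * (nrm n (q i))\<^sup>2) - (nrm n p)\<^sup>2"
  define e where "e i = nrm n (\<lambda>r. q i r - proj i p r)" for i
  have De: "D = (\<Sum>i\<in>I. l i * (e i)\<^sup>2)" unfolding D_def e_def using gradient_defect(2)[OF q p] by simp
  have D0: "0 \<le> D" unfolding De by (intro sum_nonneg mult_nonneg_nonneg) (auto intro: less_imp_le[OF l_pos])
  have DK: "D \<le> K * \<sigma>\<^sup>2" using D by (simp add: D_def)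
  have K0: "0 \<le> K" using D0 DK \<sigma> by (metis order_trans zero_less_power mult_nonneg_nonneg zero_le_mult_iff not_le)
  have \<sigma>2: "\<sigma>\<^sup>2 \<le> \<sigma>" using \<sigma> by (simp add: power2_eq_square mult_left_le)
  \<comment> \<open>Young's inequality with weight \<sigma>: the cross term 2 |p| e_i is split into
    \<sigma> |p|^2 and e_i^2 / \<sigma>. The factor 1 / \<sigma> is affordable because the weighted
    sum of the e_i^2 is O(\<sigma>^2).\<close>
  have ineq: "(nrm n (q i))\<^sup>2 - (nrm n p)\<^sup>2 \<le> \<sigma> * B\<^sup>2 + (1 + 1 / \<sigma>) * (e i)\<^sup>2" if i: "i \<in> I" for i
  proof -
    have "nrm n (q i) \<le> nrm n (proj i p) + e i"
      using nrm_triangle[of n "proj i p" "\<lambda>r. q i r - proj i p r"] by (simp add: e_def)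
    also have "\<dots> \<le> nrm n p + e i" using nrm_proj_le[OF i, of p] by simp
    finally have "(nrm n (q i))\<^sup>2 \<le> (nrm n p + e i)\<^sup>2" by (intro power_mono) auto
    moreover have "0 \<le> (\<sigma> * nrm n p - e i)\<^sup>2 / \<sigma>" using \<sigma> by simp
    then have "2 * nrm n p * e i \<le> \<sigma> * (nrm n p)\<^sup>2 + (e i)\<^sup>2 / \<sigma>"
      using \<sigma> by (simp add: power2_eq_square field_simps)
    moreover have "\<sigma> * (nrm n p)\<^sup>2 \<le> \<sigma> * B\<^sup>2" using \<sigma> pB by (intro mult_left_mono power_mono) auto
    ultimately show ?thesis by (simp add: power2_sum algebra_simps)
  qed
  have lw: "l i * (w i * ((nrm n (q i))\<^sup>2 - (nrm n p)\<^sup>2)) \<ge> - W * (l i * (\<sigma> * B\<^sup>2 + (1 + 1 / \<sigma>) * (e i)\<^sup>2))" if i: "i \<in> I" for i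
  proof -
    let ?x = "(nrm n (q i))\<^sup>2 - (nrm n p)\<^sup>2" and ?y = "\<sigma> * B\<^sup>2 + (1 + 1 / \<sigma>) * (e i)\<^sup>2"
    have "0 \<le> ?y" using \<sigma> by auto
    have "w i * ?y \<le> w i * ?x" using ineq[OF i] w(2)[OF i] by (rule mult_left_mono_neg)
    moreover have "- W * ?y \<le> w i * ?y" using w(1)[OF i] \<open>0 \<le> ?y\<close> by (rule mult_right_mono)
    ultimately have "- W * ?y \<le> w i * ?x" by linarith
    from mult_left_mono[OF this less_imp_le[OF l_pos[OF i]]] show ?thesis by (simp add: mult_ac)
  qed
  \<comment> \<open>Regrouping: \<open>a\<close> meets only the defect \<open>D\<close>, each
    \<open>w i\<close> meets a difference of squared norms, and \<open>m\<close> enters with a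
    favourable sign.\<close>
  have "(\<Sum>i\<in>I. l i * ((w i + a) * (nrm n (q i))\<^sup>2)) - (a + m + (\<Sum>i\<in>I. l i * w i)) * (nrm n p)\<^sup>2
      = a * D + (\<Sum>i\<in>I. l i * (w i * ((nrm n (q i))\<^sup>2 - (nrm n p)\<^sup>2))) - m * (nrm n p)\<^sup>2"
    unfolding D_def by (simp add: algebra_simps sum.distrib sum_subtractf sum_distrib_left sum_distrib_right)
  moreover have "- m * (nrm n p)\<^sup>2 \<ge> 0" using m by (simp add: mult_nonpos_nonneg)
  moreover have "a * D \<ge> - (\<bar>a\<bar> * K * \<sigma>)"
  proof -
    have "\<bar>a * D\<bar> \<le> \<bar>a\<bar> * (K * \<sigma>)"
      unfolding abs_mult using D0 DK \<sigma>2 K0 mult_left_mono[OF \<sigma>2 K0] by (intro mult_left_mono) auto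
    then show ?thesis by (simp add: abs_le_iff mult_ac)
  qed
  moreover have "(\<Sum>i\<in>I. l i * (w i * ((nrm n (q i))\<^sup>2 - (nrm n p)\<^sup>2))) \<ge> - W * (lsum * B\<^sup>2 + 2 * K) * \<sigma>"
  proof -
    have "(\<Sum>i\<in>I. l i * (\<sigma> * B\<^sup>2 + (1 + 1 / \<sigma>) * (e i)\<^sup>2)) = lsum * (\<sigma> * B\<^sup>2) + (1 + 1 / \<sigma>) * D"
      unfolding De lsum_def by (simp add: distrib_left sum.distrib sum_distrib_left sum_distrib_right mult_ac)
    also have "(1 + 1 / \<sigma>) * D \<le> (1 + 1 / \<sigma>) * (K * \<sigma>\<^sup>2)" using DK \<sigma> by (intro mult_left_mono) auto
    also have "(1 + 1 / \<sigma>) * (K * \<sigma>\<^sup>2) = K * \<sigma>\<^sup>2 + K * \<sigma>" using \<sigma> by (simp add: field_simps power2_eq_square)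
    also have "K * \<sigma>\<^sup>2 \<le> K * \<sigma>" by (rule mult_left_mono[OF \<sigma>2 K0])
    finally have le: "(\<Sum>i\<in>I. l i * (\<sigma> * B\<^sup>2 + (1 + 1 / \<sigma>) * (e i)\<^sup>2)) \<le> (lsum * B\<^sup>2 + 2 * K) * \<sigma>"
      by (simp add: algebra_simps)
    have "- W * ((lsum * B\<^sup>2 + 2 * K) * \<sigma>) \<le> - W * (\<Sum>i\<in>I. l i * (\<sigma> * B\<^sup>2 + (1 + 1 / \<sigma>) * (e i)\<^sup>2))"
      using le W by (intro mult_left_mono_neg) auto
    also have "\<dots> \<le> (\<Sum>i\<in>I. l i * (w i * ((nrm n (q i))\<^sup>2 - (nrm n p)\<^sup>2)))"
      unfolding sum_distrib_left by (rule sum_mono) (use lw in \<open>simp add: mult.assoc\<close>)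
    finally show ?thesis by (simp add: mult.assoc)
  qed
  ultimately show ?thesis by (simp add: algebra_simps)
qed

end

text \<open>Mean value theorem within [b - 1, b], where the density is at least its value at M + 1.
  It converts a lowering of the argument into a guaranteed lowering of \<open>Phi\<close>.\<close>

lemma Phi_decrease:
  assumes "0 \<le> x" "x \<le> 1" "\<bar>b\<bar> \<le> M"
  shows "Phi (b - x) \<le> Phi b - std_normal_density (M + 1) * x"
proof (cases "x = 0")
  case False
  then have x: "b - x < b" using assms by simp
  obtain t where t: "b - x < t" "t < b" "Phi b - Phi (b - x) = (b - (b - x)) * std_normal_density t"
    using MVT2[OF x, of Phi std_normal_density] Phi_deriv by blast
  have "std_normal_density (M + 1) \<le> std_normal_density t"
    by (rule phi_lower) (use t assms in linarith)
  then have "x * std_normal_density (M + 1) \<le> x * std_normal_density t" using assms by (intro mult_left_mono) auto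
  then show ?thesis using t(3) by (simp add: mult.commute)
qed simp

context projections begin

text \<open>
  The inequality is applied at the earlier time at the points \<open>y\<^sub>i + \<sigma>\<omega>\<close>, where \<open>y\<close> nearly maximises the left-hand
  side at the later time over the fibre of \<open>z\<close>.  Nothing is required of \<open>K\<close> beyond measurability.
\<close>

lemma one_step:
  assumes L: "0 \<le> L" and W: "0 \<le> W"
  obtains C where "0 \<le> C" and "\<And>\<sigma> v v' K m z y.
     0 < \<sigma> \<Longrightarrow> \<sigma> \<le> 1 \<Longrightarrow> C * \<sigma>^3 \<le> 1 \<Longrightarrow> - 1 \<le> m \<Longrightarrow> m \<le> 0 \<Longrightarrow>
     (\<And>i. i \<in> I \<Longrightarrow> v i \<in> borel_measurable borel) \<Longrightarrow>
     (\<And>i x. i \<in> I \<Longrightarrow> \<bar>v' i x\<bar> \<le> W) \<Longrightarrow> (\<And>i x. i \<in> I \<Longrightarrow> v' i x \<le> a) \<Longrightarrow>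
     (\<And>i x. i \<in> I \<Longrightarrow> \<bar>v i x - v' i x\<bar> \<le> L * \<sigma>\<^sup>2) \<Longrightarrow>
     (\<And>i. i \<in> I \<Longrightarrow> C11 n L (v' i)) \<Longrightarrow>
     (\<And>i x. i \<in> I \<Longrightarrow> v' i (proj i x) = v' i x) \<Longrightarrow>
     (\<And>i x. i \<in> I \<Longrightarrow> (\<integral>\<omega>. Phi (v i (\<lambda>q. x q + \<sigma> * \<omega> q)) \<partial>gauss) = Phi (v' i x)) \<Longrightarrow>
     K \<in> borel_measurable borel \<Longrightarrow> (\<And>x. \<bar>K x\<bar> \<le> 1) \<Longrightarrow>
     (\<And>z y. (\<And>q. q < n \<Longrightarrow> comb y q = z q) \<Longrightarrow> Phi (a + m + (\<Sum>i\<in>I. l i * (v i (y i) - a))) \<le> K z) \<Longrightarrow>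
     (\<And>q. q < n \<Longrightarrow> comb y q = z q) \<Longrightarrow>
     Phi (a + (m - C * \<sigma>^3) + (\<Sum>i\<in>I. l i * (v' i (y i) - a))) \<le> (\<integral>\<omega>. K (\<lambda>q. z q + \<sigma> * \<omega> q) \<partial>gauss)"
proof -
  \<comment> \<open>Sources of the constants: \<open>K1\<close> means of the increments,
    \<open>L'\<close> gradient of the sum, \<open>Wb\<close> argument of \<open>Phi\<close>,
    \<open>K4\<close> mismatch of the gradients, \<open>K3\<close> quadratic form, \<open>K5\<close>
    mean and second moment together, \<open>K6\<close> these with the Taylor remainder. Division by
    the density turns the loss in value into the shift \<open>C\<close> of the argument.\<close>
  define M where "M = expmom n"
  define K1 where "K1 = (27 * L^3 / std_normal_density W + 4 * W * L\<^sup>2) * M"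
  define L' where "L' = lsum * L"
  define Wb where "Wb = \<bar>a\<bar> + 1 + lsum * (W + \<bar>a\<bar>)"
  define K4 where "K4 = 1 + lsum * L * (L + L')\<^sup>2"
  define K3 where "K3 = \<bar>a\<bar> * K4 + (W + \<bar>a\<bar>) * (lsum * L'\<^sup>2 + 2 * K4)"
  define K5 where "K5 = K3 / 2 + lsum * K1 + 4 * Wb * L'\<^sup>2 * M"
  define K6 where "K6 = K5 + 27 * L'^3 * M"
  define C where "C = K6 / std_normal_density (Wb + 1)"
  have M: "1 \<le> M" unfolding M_def by (rule expmom_ge_1)
  have L': "0 \<le> L'" unfolding L'_def using L lsum_nonneg by simp
  have Wb: "0 \<le> Wb" unfolding Wb_def using W lsum_nonneg by (simp add: add_nonneg_nonneg)
  have K1: "0 \<le> K1" unfolding K1_def using L W M phi_pos[of W] by (intro mult_nonneg_nonneg add_nonneg_nonneg divide_nonneg_nonneg) auto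
  have K4: "0 \<le> K4" unfolding K4_def using L lsum_nonneg by (intro add_nonneg_nonneg mult_nonneg_nonneg) auto
  have K3: "0 \<le> K3" unfolding K3_def using K4 W lsum_nonneg by (intro add_nonneg_nonneg mult_nonneg_nonneg) auto
  have K5: "0 \<le> K5" unfolding K5_def using K3 K1 Wb M lsum_nonneg by (intro add_nonneg_nonneg mult_nonneg_nonneg) auto
  have K6: "0 \<le> K6" unfolding K6_def using K5 L' M by (intro add_nonneg_nonneg mult_nonneg_nonneg) auto
  have C0: "0 \<le> C" unfolding C_def using K6 phi_pos[of "Wb + 1"] by (intro divide_nonneg_nonneg) auto
  show thesis
  proof (rule that[OF C0])
    fix \<sigma> m :: real and v v' :: "'i \<Rightarrow> (nat \<Rightarrow> real) \<Rightarrow> real" and K :: "(nat \<Rightarrow> real) \<Rightarrow> real" and z :: "nat \<Rightarrow> real" and y0 :: "'i \<Rightarrow> nat \<Rightarrow> real"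
    assume \<sigma>: "0 < \<sigma>" "\<sigma> \<le> 1" and C1: "C * \<sigma>^3 \<le> 1" and m: "- 1 \<le> m" "m \<le> 0"
      and vm: "\<And>i. i \<in> I \<Longrightarrow> v i \<in> borel_measurable borel"
      and vW: "\<And>i x. i \<in> I \<Longrightarrow> \<bar>v' i x\<bar> \<le> W" and va: "\<And>i x. i \<in> I \<Longrightarrow> v' i x \<le> a"
      and vv: "\<And>i x. i \<in> I \<Longrightarrow> \<bar>v i x - v' i x\<bar> \<le> L * \<sigma>\<^sup>2"
      and vC: "\<And>i. i \<in> I \<Longrightarrow> C11 n L (v' i)"
      and inv: "\<And>i x. i \<in> I \<Longrightarrow> v' i (proj i x) = v' i x"
      and mart: "\<And>i x. i \<in> I \<Longrightarrow> (\<integral>\<omega>. Phi (v i (\<lambda>q. x q + \<sigma> * \<omega> q)) \<partial>gauss) = Phi (v' i x)"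
      and Km: "K \<in> borel_measurable borel" and K1': "\<And>x. \<bar>K x\<bar> \<le> 1"
      and hyp: "\<And>z y. (\<And>q. q < n \<Longrightarrow> comb y q = z q) \<Longrightarrow> Phi (a + m + (\<Sum>i\<in>I. l i * (v i (y i) - a))) \<le> K z"
      and y0: "\<And>q. q < n \<Longrightarrow> comb y0 q = z q"
    define S where "S y = (\<Sum>i\<in>I. l i * (v' i (y i) - a))" for y
    define F where "F = {y. \<forall>q<n. comb y q = z q}"
    have S0: "S y \<le> 0" for y
      unfolding S_def using va by (intro sum_nonpos mult_nonneg_nonpos) (auto intro: less_imp_le[OF l_pos])
    have bdd: "bdd_above (S ` F)" using S0 by (auto intro!: bdd_aboveI[of _ 0])
    have y0F: "y0 \<in> F" using y0 by (simp add: F_def)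
    \<comment> \<open>A maximiser up to \<sigma>^4; \<open>y0\<close> itself is taken if it does
      better, so that the value at \<open>y0\<close> is never lost.\<close>
    obtain y where y: "y \<in> F" "S y0 \<le> S y" "\<And>y'. y' \<in> F \<Longrightarrow> S y' \<le> S y + \<sigma>^4"
    proof -
      have "(SUP y\<in>F. S y) - \<sigma>^4 < (SUP y\<in>F. S y)" using \<sigma> by simp
      then obtain y1 where y1: "y1 \<in> F" "(SUP y\<in>F. S y) - \<sigma>^4 < S y1"
        using less_cSUP_iff[OF _ bdd] y0F by blast
      have up: "S y' \<le> (SUP y\<in>F. S y)" if "y' \<in> F" for y' using that bdd by (rule cSUP_upper)
      show thesis
      proof (cases "S y0 \<le> S y1")
        case True
        then show ?thesis using that[of y1] y1 up by fastforce
      next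
        case False
        then show ?thesis using that[of y0] y0F y1 up by fastforce
      qed
    qed
    have "\<exists>g. nrm n g \<le> L \<and> proj i g = g \<and> (\<forall>x. \<bar>v' i (\<lambda>q. y i q + x q) - v' i (y i) - dot n g x\<bar> \<le> L * (nrm n x)\<^sup>2)" if "i \<in> I" for i
      using C11_invariant_gradient[OF that vC[OF that] inv[OF that], of "y i"] by metis
    then obtain g where g: "\<And>i. i \<in> I \<Longrightarrow> nrm n (g i) \<le> L" "\<And>i. i \<in> I \<Longrightarrow> proj i (g i) = g i"
      "\<And>i x. i \<in> I \<Longrightarrow> \<bar>v' i (\<lambda>q. y i q + x q) - v' i (y i) - dot n (g i) x\<bar> \<le> L * (nrm n x)\<^sup>2"
      by metis
    define p where "p = (\<lambda>r. \<Sum>i\<in>I. l i * g i r)"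
    have dotp: "dot n p x = (\<Sum>i\<in>I. l i * dot n (g i) x)" for x
      unfolding p_def dot_def sum_distrib_left sum_distrib_right by (subst sum.swap) (simp add: mult.assoc)
    have pL: "nrm n p \<le> L'"
    proof -
      have "nrm n p * nrm n p = (\<Sum>i\<in>I. l i * dot n (g i) p)"
        using dotp[of p] nrm_sq[of n p] by (simp add: power2_eq_square)
      also have "\<dots> \<le> (\<Sum>i\<in>I. l i * (L * nrm n p))"
      proof (intro sum_mono mult_left_mono)
        fix i assume i: "i \<in> I"
        show "dot n (g i) p \<le> L * nrm n p"
          using abs_dot_le[of n "g i" p] mult_right_mono[OF g(1)[OF i] nrm_nonneg[of n p]] by linarith
      qed (auto intro: less_imp_le[OF l_pos])
      also have "\<dots> = L' * nrm n p" by (simp add: L'_def lsum_def sum_distrib_left sum_distrib_right mult_ac)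
      finally show ?thesis
        using mult_right_le_imp_le[of "nrm n p" "nrm n p" L'] nrm_nonneg[of n p] L' by linarith
    qed
    define D where "D = (\<Sum>i\<in>I. l i * (nrm n (g i))\<^sup>2) - (nrm n p)\<^sup>2"
    have D: "D \<le> K4 * \<sigma>\<^sup>2"
    proof -
      \<comment> \<open>This displacement stays in the fibre, gains \<sigma>^2 D to first order and
        loses O(\<sigma>^4) to the quadratic error. Near-maximality allows a net gain of at most
        \<sigma>^4, so D = O(\<sigma>^2).\<close>
      define y' where "y' = (\<lambda>i r. y i r + \<sigma>\<^sup>2 * (g i r - p r))"
      have "y' \<in> F"
        unfolding F_def
      proof (intro CollectI allI impI)
        fix q assume q: "q < n"
        have "comb y' q = comb y q + \<sigma>\<^sup>2 * comb (\<lambda>i r. g i r - p r) q"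
          unfolding comb_def y'_def proj_add proj_scale by (simp add: distrib_left sum.distrib sum_distrib_left mult_ac)
        also have "\<dots> = z q" using gradient_defect(3)[OF g(2) p_def q] y(1) q by (simp add: F_def)
        finally show "comb y' q = z q" .
      qed
      then have up: "S y' \<le> S y + \<sigma>^4" by (rule y(3))
      have nd: "nrm n (\<lambda>r. g i r - p r) \<le> L + L'" if i: "i \<in> I" for i
        using nrm_triangle[of n "g i" "\<lambda>r. - p r"] nrm_scale[of n "-1" p] g(1)[OF i] pL by simp
      have "S y' - S y = (\<Sum>i\<in>I. l i * (v' i (y' i) - v' i (y i)))"
        by (simp add: S_def sum_subtractf[symmetric] algebra_simps)
      also have "\<dots> \<ge> (\<Sum>i\<in>I. l i * (\<sigma>\<^sup>2 * dot n (g i) (\<lambda>r. g i r - p r) - L * (\<sigma>^4 * (L + L')\<^sup>2)))"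
      proof (intro sum_mono mult_left_mono)
        fix i assume i: "i \<in> I"
        have n2: "(nrm n (\<lambda>r. \<sigma>\<^sup>2 * (g i r - p r)))\<^sup>2 \<le> \<sigma>^4 * (L + L')\<^sup>2"
          unfolding nrm_scale using nd[OF i] by (auto simp: power_mult_distrib intro!: mult_left_mono power_mono)
        show "\<sigma>\<^sup>2 * dot n (g i) (\<lambda>r. g i r - p r) - L * (\<sigma>^4 * (L + L')\<^sup>2) \<le> v' i (y' i) - v' i (y i)"
          using g(3)[OF i, of "\<lambda>r. \<sigma>\<^sup>2 * (g i r - p r)"] mult_left_mono[OF n2 L]
          unfolding y'_def dot_scale_right by linarith
      qed (auto intro: less_imp_le[OF l_pos])
      also have "(\<Sum>i\<in>I. l i * (\<sigma>\<^sup>2 * dot n (g i) (\<lambda>r. g i r - p r) - L * (\<sigma>^4 * (L + L')\<^sup>2)))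
         = \<sigma>\<^sup>2 * D - lsum * L * (L + L')\<^sup>2 * \<sigma>^4"
      proof -
        have DD: "D = (\<Sum>i\<in>I. l i * dot n (g i) (\<lambda>r. g i r - p r))"
          unfolding D_def by (rule gradient_defect(1)[OF g(2) p_def, symmetric])
        show ?thesis unfolding DD lsum_def
          by (simp add: right_diff_distrib sum_subtractf sum_distrib_left sum_distrib_right mult_ac)
      qed
      finally have "\<sigma>\<^sup>2 * D \<le> \<sigma>^4 + lsum * L * (L + L')\<^sup>2 * \<sigma>^4" using up by linarith
      also have "\<dots> = \<sigma>\<^sup>2 * (K4 * \<sigma>\<^sup>2)" by (simp add: K4_def eval_nat_numeral algebra_simps)
      finally show ?thesis using \<sigma> by (simp add: mult_le_cancel_left_pos)
    qed
    define b where "b = a + m + S y"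
    define bi where "bi i = v' i (y i)" for i
    have bW: "\<bar>b\<bar> \<le> Wb"
    proof -
      have "\<bar>S y\<bar> \<le> (\<Sum>i\<in>I. \<bar>l i * (v' i (y i) - a)\<bar>)" unfolding S_def by (rule sum_abs)
      also have "\<dots> \<le> (\<Sum>i\<in>I. l i * (W + \<bar>a\<bar>))"
      proof (intro sum_mono)
        fix i assume i: "i \<in> I"
        have "\<bar>v' i (y i) - a\<bar> \<le> W + \<bar>a\<bar>" using vW[OF i, of "y i"] by linarith
        then show "\<bar>l i * (v' i (y i) - a)\<bar> \<le> l i * (W + \<bar>a\<bar>)"
          unfolding abs_mult using l_pos[OF i] by (simp add: mult_left_mono)
      qed
      also have "\<dots> = lsum * (W + \<bar>a\<bar>)" by (simp add: lsum_def sum_distrib_right)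
      finally show ?thesis unfolding b_def Wb_def using m by linarith
    qed
    define r where "r i \<omega> = v i (\<lambda>q. y i q + \<sigma> * \<omega> q) - bi i" for i \<omega>
    define R where "R \<omega> = (\<Sum>i\<in>I. l i * r i \<omega>)" for \<omega>
    have sh: "(\<lambda>\<omega> q. x q + \<sigma> * \<omega> q) \<in> measurable borel (borel :: (nat \<Rightarrow> real) measure)" for x
      by (rule measurable_into_fun) simp
    have rm: "r i \<in> borel_measurable borel" if "i \<in> I" for i
      unfolding r_def[abs_def] using measurable_compose[OF sh vm[OF that]] by simp
    have Rm[measurable]: "R \<in> borel_measurable borel"
      unfolding R_def[abs_def] using rm by simp
    have rX: "\<bar>r i \<omega> - \<sigma> * dot n (g i) \<omega>\<bar> \<le> 2 * L * \<sigma>\<^sup>2 * (expabs n \<omega>)\<^sup>2" if i: "i \<in> I" for i \<omega>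
    proof -
      have a1: "\<bar>v i (\<lambda>q. y i q + \<sigma> * \<omega> q) - v' i (\<lambda>q. y i q + \<sigma> * \<omega> q)\<bar> \<le> L * \<sigma>\<^sup>2 * 1" using vv[OF i] by simp
      have a2: "\<bar>v' i (\<lambda>q. y i q + \<sigma> * \<omega> q) - bi i - \<sigma> * dot n (g i) \<omega>\<bar> \<le> L * (\<sigma>\<^sup>2 * (nrm n \<omega>)\<^sup>2)"
        using g(3)[OF i, of "\<lambda>q. \<sigma> * \<omega> q"] \<sigma> by (simp add: dot_scale_right nrm_scale bi_def power_mult_distrib)
      have "nrm n \<omega> \<le> expabs n \<omega>" using nrm_le_sumabs sumabs_le_expabs by (rule order_trans)
      then have n1: "(nrm n \<omega>)\<^sup>2 \<le> (expabs n \<omega>)\<^sup>2" by (intro power_mono) auto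
      have a3: "L * (\<sigma>\<^sup>2 * (nrm n \<omega>)\<^sup>2) \<le> L * \<sigma>\<^sup>2 * (expabs n \<omega>)\<^sup>2"
        unfolding mult.assoc using n1 L by (intro mult_left_mono) auto
      have a4: "L * \<sigma>\<^sup>2 * 1 \<le> L * \<sigma>\<^sup>2 * (expabs n \<omega>)\<^sup>2"
        using L by (intro mult_left_mono one_le_power) auto
      show ?thesis unfolding r_def using a1 a2 a3 a4 by linarith
    qed
    have RX: "\<bar>R \<omega> - \<sigma> * dot n p \<omega>\<bar> \<le> 2 * L' * \<sigma>\<^sup>2 * (expabs n \<omega>)\<^sup>2" for \<omega>
    proof -
      have "R \<omega> - \<sigma> * dot n p \<omega> = (\<Sum>i\<in>I. l i * (r i \<omega> - \<sigma> * dot n (g i) \<omega>))"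
        unfolding R_def dotp by (simp add: right_diff_distrib sum_subtractf sum_distrib_left mult_ac)
      also have "\<bar>\<dots>\<bar> \<le> (\<Sum>i\<in>I. \<bar>l i * (r i \<omega> - \<sigma> * dot n (g i) \<omega>)\<bar>)" by (rule sum_abs)
      also have "\<dots> \<le> (\<Sum>i\<in>I. l i * (2 * L * \<sigma>\<^sup>2 * (expabs n \<omega>)\<^sup>2))"
      proof (intro sum_mono)
        fix i assume i: "i \<in> I"
        show "\<bar>l i * (r i \<omega> - \<sigma> * dot n (g i) \<omega>)\<bar> \<le> l i * (2 * L * \<sigma>\<^sup>2 * (expabs n \<omega>)\<^sup>2)"
          unfolding abs_mult using l_pos[OF i] rX[OF i] by (simp add: mult_left_mono)
      qed
      also have "\<dots> = 2 * L' * \<sigma>\<^sup>2 * (expabs n \<omega>)\<^sup>2"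
        unfolding L'_def lsum_def sum_distrib_right sum_distrib_left by (intro sum.cong refl) simp
      finally show ?thesis .
    qed
    note SP = small_perturbation[OF Rm L' \<sigma> pL RX]
    have ri: "integrable gauss (r i)" if "i \<in> I" for i
      using small_perturbation(1)[OF rm[OF that] L \<sigma> g(1)[OF that] rX[OF that]] .
    \<comment> \<open>The averaging identity between \<open>v\<close> and \<open>v'\<close> forces
      the mean at each index separately.\<close>
    have Er: "\<bar>(\<integral>\<omega>. r i \<omega> \<partial>gauss) - bi i * \<sigma>\<^sup>2 * (nrm n (g i))\<^sup>2 / 2\<bar> \<le> K1 * \<sigma>^3" if i: "i \<in> I" for i
      unfolding K1_def M_def
      by (rule mean_of_increment[OF rm[OF i] L \<sigma> g(1)[OF i] rX[OF i]])
        (use vW[OF i] mart[OF i] in \<open>simp_all add: bi_def r_def\<close>)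
    have ER: "(\<integral>\<omega>. R \<omega> \<partial>gauss) \<ge> (\<Sum>i\<in>I. l i * (bi i * \<sigma>\<^sup>2 * (nrm n (g i))\<^sup>2 / 2)) - lsum * K1 * \<sigma>^3"
    proof -
      have "(\<integral>\<omega>. R \<omega> \<partial>gauss) = (\<Sum>i\<in>I. l i * (\<integral>\<omega>. r i \<omega> \<partial>gauss))"
        unfolding R_def by (subst Bochner_Integration.integral_sum) (use ri in auto)
      also have "\<dots> \<ge> (\<Sum>i\<in>I. l i * (bi i * \<sigma>\<^sup>2 * (nrm n (g i))\<^sup>2 / 2 - K1 * \<sigma>^3))"
      proof (intro sum_mono mult_left_mono)
        fix i assume "i \<in> I"
        then show "bi i * \<sigma>\<^sup>2 * (nrm n (g i))\<^sup>2 / 2 - K1 * \<sigma>^3 \<le> (\<integral>\<omega>. r i \<omega> \<partial>gauss)"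
          using Er[of i] by linarith
      qed (auto intro: less_imp_le[OF l_pos])
      finally show ?thesis by (simp add: right_diff_distrib sum_subtractf lsum_def sum_distrib_left sum_distrib_right mult_ac)
    qed
    have ER2: "b * (\<integral>\<omega>. (R \<omega>)\<^sup>2 \<partial>gauss) / 2 \<le> b * \<sigma>\<^sup>2 * (nrm n p)\<^sup>2 / 2 + 4 * Wb * L'\<^sup>2 * M * \<sigma>^3"
    proof -
      have "\<bar>b * ((\<integral>\<omega>. (R \<omega>)\<^sup>2 \<partial>gauss) - \<sigma>\<^sup>2 * (nrm n p)\<^sup>2)\<bar> \<le> Wb * (8 * L'\<^sup>2 * \<sigma>^3 * M)"
        unfolding abs_mult M_def using bW SP(2) Wb by (intro mult_mono) auto
      then show ?thesis by (simp add: algebra_simps abs_le_iff)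
    qed
    \<comment> \<open>With w_i = v'_i - a, the argument b is a + m + \<Sum> \<lambda>_i w_i; the
      bound v'_i \<le> a supplies the sign.\<close>
    have Q: "(\<Sum>i\<in>I. l i * (bi i * (nrm n (g i))\<^sup>2)) - b * (nrm n p)\<^sup>2 \<ge> - K3 * \<sigma>"
    proof -
      have "(\<Sum>i\<in>I. l i * (((bi i - a) + a) * (nrm n (g i))\<^sup>2)) - (a + m + (\<Sum>i\<in>I. l i * (bi i - a))) * (nrm n p)\<^sup>2
        \<ge> - (\<bar>a\<bar> * K4 + (W + \<bar>a\<bar>) * (lsum * L'\<^sup>2 + 2 * K4)) * \<sigma>"
      proof (rule quadratic_form_bound[OF g(2) p_def \<sigma> _ _ _ _ m(2) pL])
        show "(\<Sum>i\<in>I. l i * (nrm n (g i))\<^sup>2) - (nrm n p)\<^sup>2 \<le> K4 * \<sigma>\<^sup>2" using D by (simp add: D_def)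
        fix i assume i: "i \<in> I"
        show "- (W + \<bar>a\<bar>) \<le> bi i - a" using vW[OF i, of "y i"] unfolding bi_def by linarith
        show "bi i - a \<le> 0" using va[OF i] by (simp add: bi_def)
      qed (use W in auto)
      then show ?thesis by (simp add: b_def S_def bi_def K3_def)
    qed
    \<comment> \<open>Times \<sigma>^2 / 2, the quadratic form is the leading part of the mean minus
      b/2 times the second moment; its error O(\<sigma>) becomes O(\<sigma>^3).\<close>
    have low: "(\<integral>\<omega>. R \<omega> \<partial>gauss) - b * (\<integral>\<omega>. (R \<omega>)\<^sup>2 \<partial>gauss) / 2 \<ge> - K5 * \<sigma>^3"
    proof -
      have "\<sigma>\<^sup>2 / 2 * (- K3 * \<sigma>) \<le> \<sigma>\<^sup>2 / 2 * ((\<Sum>i\<in>I. l i * (bi i * (nrm n (g i))\<^sup>2)) - b * (nrm n p)\<^sup>2)"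
        by (rule mult_left_mono[OF Q]) simp
      also have "\<dots> = (\<Sum>i\<in>I. l i * (bi i * \<sigma>\<^sup>2 * (nrm n (g i))\<^sup>2 / 2)) - b * \<sigma>\<^sup>2 * (nrm n p)\<^sup>2 / 2"
        by (simp add: right_diff_distrib sum_distrib_left mult_ac)
      finally have "- K3 / 2 * \<sigma>^3 \<le> (\<Sum>i\<in>I. l i * (bi i * \<sigma>\<^sup>2 * (nrm n (g i))\<^sup>2 / 2)) - b * \<sigma>\<^sup>2 * (nrm n p)\<^sup>2 / 2"
        by (simp add: eval_nat_numeral mult_ac)
      moreover have "- K5 * \<sigma>^3 = - K3 / 2 * \<sigma>^3 - lsum * K1 * \<sigma>^3 - 4 * Wb * L'\<^sup>2 * M * \<sigma>^3"
        by (simp add: K5_def algebra_simps)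
      ultimately show ?thesis using ER ER2 by linarith
    qed
    have PhiR: "Phi b - K6 * \<sigma>^3 \<le> (\<integral>\<omega>. Phi (b + R \<omega>) \<partial>gauss)"
    proof -
      have "- (K5 * \<sigma>^3) \<le> std_normal_density b * (- (K5 * \<sigma>^3))"
        using mult_right_mono[OF phi_bounds(1)[of b], of "K5 * \<sigma>^3"] K5 \<sigma> by simp
      also have "\<dots> \<le> std_normal_density b * ((\<integral>\<omega>. R \<omega> \<partial>gauss) - b * (\<integral>\<omega>. (R \<omega>)\<^sup>2 \<partial>gauss) / 2)"
        using low by (intro mult_left_mono) (auto intro: less_imp_le)
      finally show ?thesis using SP(3)[of b] unfolding K6_def M_def[symmetric] by (simp add: abs_le_iff algebra_simps)
    qed
    \<comment> \<open>The shift by C \<sigma>^3 lowers \<open>Phi\<close> by at least K6 \<sigma>^3,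
      which is what the averaging can lose; C \<sigma>^3 \<le> 1 keeps the shift within reach of
      \<open>Phi_decrease\<close>.\<close>
    have "Phi (a + (m - C * \<sigma>^3) + S y0) \<le> Phi (b - C * \<sigma>^3)"
      using y(2) by (simp add: b_def)
    also have "\<dots> \<le> Phi b - std_normal_density (Wb + 1) * (C * \<sigma>^3)"
      by (rule Phi_decrease) (use C0 C1 \<sigma> bW in auto)
    also have "std_normal_density (Wb + 1) * (C * \<sigma>^3) = K6 * \<sigma>^3" by (simp add: C_def)
    also have "Phi b - K6 * \<sigma>^3 \<le> (\<integral>\<omega>. Phi (b + R \<omega>) \<partial>gauss)" by (rule PhiR)
    also have "\<dots> \<le> (\<integral>\<omega>. K (\<lambda>q. z q + \<sigma> * \<omega> q) \<partial>gauss)"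
    proof (rule integral_mono)
      show "integrable gauss (\<lambda>\<omega>. Phi (b + R \<omega>))"
        by (intro gauss.integrable_const_bound[where B=1]) (auto simp: abs_of_pos)
      show "integrable gauss (\<lambda>\<omega>. K (\<lambda>q. z q + \<sigma> * \<omega> q))" by (rule integrable_heat[OF Km K1'])
      fix \<omega>
      have "Phi (a + m + (\<Sum>i\<in>I. l i * (v i (\<lambda>q. y i q + \<sigma> * \<omega> q) - a))) \<le> K (\<lambda>q. z q + \<sigma> * \<omega> q)"
      proof (rule hyp)
        fix q assume "q < n"
        then show "comb (\<lambda>i q. y i q + \<sigma> * \<omega> q) q = z q + \<sigma> * \<omega> q"
          using comb_shift[of q y "\<lambda>q. \<sigma> * \<omega> q"] y(1) by (simp add: F_def)
      qed
      moreover have "b + R \<omega> = a + m + (\<Sum>i\<in>I. l i * (v i (\<lambda>q. y i q + \<sigma> * \<omega> q) - a))"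
        by (simp add: b_def S_def R_def r_def bi_def sum.distrib[symmetric] algebra_simps)
      ultimately show "Phi (b + R \<omega>) \<le> K (\<lambda>q. z q + \<sigma> * \<omega> q)" by simp
    qed
    finally show "Phi (a + (m - C * \<sigma>^3) + (\<Sum>i\<in>I. l i * (v' i (y0 i) - a))) \<le> (\<integral>\<omega>. K (\<lambda>q. z q + \<sigma> * \<omega> q) \<partial>gauss)"
      by (simp add: S_def)
  qed
qed

end

section \<open>Regularity of the heat flow in time and under \<open>Phinv\<close>\<close>

lemma Phi_le_limit:
  assumes "0 < e0" "\<And>e. 0 < e \<Longrightarrow> e \<le> e0 \<Longrightarrow> Phi (X - e) \<le> q"
  shows "Phi X \<le> q"
proof (rule ccontr)
  assume "\<not> Phi X \<le> q"
  then have "q < Phi X" by simp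
  moreover have "((\<lambda>e. Phi (X - e)) \<longlongrightarrow> Phi (X - 0)) (at_right 0)"
    by (intro tendsto_compose[OF isCont_Phi[unfolded isCont_def]] tendsto_intros isCont_tendsto_compose[OF isCont_Phi])
  ultimately have "eventually (\<lambda>e. q < Phi (X - e)) (at_right 0)" by (intro order_tendstoD) auto
  then obtain e1 where e1: "0 < e1" "\<And>e. 0 < e \<Longrightarrow> e < e1 \<Longrightarrow> q < Phi (X - e)"
    by (auto simp: eventually_at_right_field)
  define e where "e = min e0 (e1 / 2)"
  have "0 < e" "e \<le> e0" "e < e1" using e1 assms by (auto simp: e_def)
  then show False using e1(2)[of e] assms(2)[of e] by linarith
qed

lemma heat_0[simp]: "heat 0 F x = F x"
  by (simp add: heat_def gauss.prob_space[unfolded space_gauss])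

lemma heat_depends:
  assumes "\<And>x y. (\<And>q. q < n \<Longrightarrow> x q = y q) \<Longrightarrow> F x = F y" "\<And>q. q < n \<Longrightarrow> x q = y q"
  shows "heat t F x = heat t F y"
  unfolding heat_def by (intro Bochner_Integration.integral_cong refl assms(1)) (use assms(2) in auto)

lemma C11_mono: "C11 n L v \<Longrightarrow> L \<le> L' \<Longrightarrow> C11 n L' v"
  unfolding C11_def by (meson mult_right_mono order_trans zero_le_power2)

text \<open>The linear term has Gaussian mean zero, so the change over time s is of order s and not
  of order sqrt s. This matches the tolerance \<open>L * \<sigma>\<^sup>2\<close> of
  \<open>one_step\<close>.\<close>

lemma C11_time_increment:
  assumes v[measurable]: "v \<in> borel_measurable borel" and b: "\<And>x. \<bar>v x\<bar> \<le> 1" and C: "C11 n L v" and L: "0 \<le> L" and s: "0 \<le> s"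
  shows "\<bar>heat s v x - v x\<bar> \<le> L * expmom n * s"
proof -
  obtain g where g: "\<And>y. \<bar>v (\<lambda>q. x q + y q) - v x - dot n g y\<bar> \<le> L * (nrm n y)\<^sup>2"
    using C unfolding C11_def by blast
  have m[measurable]: "(\<lambda>\<omega> q. x q + sqrt s * \<omega> q) \<in> measurable borel (borel :: (nat \<Rightarrow> real) measure)"
    by (rule measurable_into_fun) simp
  have "\<bar>v (\<lambda>q. x q + sqrt s * \<omega> q) - v x - sqrt s * dot n g \<omega>\<bar> \<le> (L * s) * expabs n \<omega> ^ 2" for \<omega>
  proof -
    have "(nrm n (\<lambda>q. sqrt s * \<omega> q))\<^sup>2 = s * (nrm n \<omega>)\<^sup>2"
      unfolding nrm_scale using s by (simp add: power_mult_distrib)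
    moreover have "(nrm n \<omega>)\<^sup>2 \<le> expabs n \<omega> ^ 2"
      by (intro power_mono order_trans[OF nrm_le_sumabs sumabs_le_expabs]) auto
    then have "(L * s) * (nrm n \<omega>)\<^sup>2 \<le> (L * s) * expabs n \<omega> ^ 2" using L s by (intro mult_left_mono) auto
    ultimately show ?thesis using g[of "\<lambda>q. sqrt s * \<omega> q"] by (simp add: dot_scale_right mult_ac)
  qed
  from integrable_expabs_bound(2)[OF _ this] L s
  have "\<bar>\<integral>\<omega>. v (\<lambda>q. x q + sqrt s * \<omega> q) - v x - sqrt s * dot n g \<omega> \<partial>gauss\<bar> \<le> (L * s) * expmom n" by simp
  moreover have "(\<integral>\<omega>. v (\<lambda>q. x q + sqrt s * \<omega> q) - v x - sqrt s * dot n g \<omega> \<partial>gauss) = heat s v x - v x"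
    using integrable_heat[OF v b, of x "sqrt s"] gauss_dot[of n g]
    by (simp add: heat_def gauss.prob_space[unfolded space_gauss])
  ultimately show ?thesis by (simp add: mult_ac)
qed

text \<open>Chain rule: the new gradient is g divided by the density at \<open>Phinv (u x)\<close>.
  The constant collects the second-order error of \<open>Phinv\<close> over the squared increment of
  \<open>u\<close>, and the remainder of \<open>u\<close> itself.\<close>

lemma C11_Phinv:
  assumes \<eta>: "0 < \<eta>" "\<eta> \<le> \<zeta>" "\<zeta> < 1" and L: "0 \<le> L" and K: "1 \<le> K"
    and K1: "\<And>u. \<eta> \<le> u \<Longrightarrow> u \<le> \<zeta> \<Longrightarrow> inverse (std_normal_density (Phinv u)) \<le> K"
    and K2: "\<And>u w. \<eta> \<le> u \<Longrightarrow> u \<le> \<zeta> \<Longrightarrow> \<eta> \<le> w \<Longrightarrow> w \<le> \<zeta> \<Longrightarrow>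
      \<bar>Phinv u - Phinv w - inverse (std_normal_density (Phinv w)) * (u - w)\<bar> \<le> K * (u - w)\<^sup>2"
    and u: "\<And>x. \<eta> \<le> u x" "\<And>x. u x \<le> \<zeta>" and C: "C11 n L u"
  shows "C11 n (K * (2 * L + 1)\<^sup>2 + K * L) (\<lambda>x. Phinv (u x))"
  unfolding C11_def
proof
  fix x
  obtain g where gL: "nrm n g \<le> L" and g: "\<And>y. \<bar>u (\<lambda>q. x q + y q) - u x - dot n g y\<bar> \<le> L * (nrm n y)\<^sup>2"
    using C unfolding C11_def by blast
  define k where "k = inverse (std_normal_density (Phinv (u x)))"
  have k: "0 \<le> k" "k \<le> K" using K1[OF u] phi_pos[of "Phinv (u x)"] by (auto simp: k_def)
  show "\<exists>g. nrm n g \<le> K * (2 * L + 1)\<^sup>2 + K * L \<and>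
     (\<forall>y. \<bar>Phinv (u (\<lambda>q. x q + y q)) - Phinv (u x) - dot n g y\<bar> \<le> (K * (2 * L + 1)\<^sup>2 + K * L) * (nrm n y)\<^sup>2)"
  proof (intro exI[of _ "\<lambda>q. k * g q"] conjI allI)
    have "nrm n (\<lambda>q. k * g q) \<le> K * L" unfolding nrm_scale using k gL L by (intro mult_mono) auto
    moreover have "0 \<le> K * (2 * L + 1)\<^sup>2" using K by (intro mult_nonneg_nonneg) auto
    ultimately show "nrm n (\<lambda>q. k * g q) \<le> K * (2 * L + 1)\<^sup>2 + K * L" by linarith
    fix y :: "nat \<Rightarrow> real"
    define d where "d = u (\<lambda>q. x q + y q) - u x"
    define N where "N = nrm n y"
    have N0: "0 \<le> N" by (simp add: N_def)
    have d: "\<bar>d - dot n g y\<bar> \<le> L * N\<^sup>2" using g[of y] by (simp add: d_def N_def)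
    \<comment> \<open>Linear growth for all \<open>N\<close>: for N \<le> 1 from the expansion, for
      N > 1 because values of \<open>u\<close> differ by at most 1.\<close>
    have dN: "\<bar>d\<bar> \<le> (2 * L + 1) * N"
    proof (cases "N \<le> 1")
      case True
      have "L * N\<^sup>2 \<le> L * N" using True N0 L by (intro mult_left_mono) (auto simp: power2_eq_square mult_left_le)
      moreover have "\<bar>dot n g y\<bar> \<le> L * N"
        using abs_dot_le[of n g y] mult_right_mono[OF gL N0] unfolding N_def by linarith
      moreover have "(2 * L + 1) * N = L * N + L * N + N" by (simp add: algebra_simps)
      ultimately show ?thesis using d N0 by linarith
    next
      case False
      have "\<bar>d\<bar> \<le> 1" using u[of x] u[of "\<lambda>q. x q + y q"] \<eta> unfolding d_def by linarith
      moreover have "1 * 1 \<le> (2 * L + 1) * N" using False L by (intro mult_mono) auto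
      ultimately show ?thesis by linarith
    qed
    then have "\<bar>d\<bar>\<^sup>2 \<le> ((2 * L + 1) * N)\<^sup>2" by (intro power_mono) auto
    then have "K * d\<^sup>2 \<le> K * ((2 * L + 1) * N)\<^sup>2" using K by (intro mult_left_mono) auto
    moreover have "\<bar>Phinv (u (\<lambda>q. x q + y q)) - Phinv (u x) - k * d\<bar> \<le> K * d\<^sup>2"
      unfolding k_def d_def by (rule K2[OF u u])
    moreover have "\<bar>k * d - k * dot n g y\<bar> \<le> K * (L * N\<^sup>2)"
      unfolding right_diff_distrib[symmetric] abs_mult using k d L by (intro mult_mono) auto
    ultimately have "\<bar>Phinv (u (\<lambda>q. x q + y q)) - Phinv (u x) - k * dot n g y\<bar> \<le> K * ((2 * L + 1) * N)\<^sup>2 + K * (L * N\<^sup>2)"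
      by linarith
    also have "\<dots> = (K * (2 * L + 1)\<^sup>2 + K * L) * N\<^sup>2" unfolding power_mult_distrib by (simp add: algebra_simps)
    finally show "\<bar>Phinv (u (\<lambda>q. x q + y q)) - Phinv (u x) - dot n (\<lambda>q. k * g q) y\<bar> \<le> (K * (2 * L + 1)\<^sup>2 + K * L) * (nrm n y)\<^sup>2"
      by (simp add: dot_scale_left N_def)
  qed
qed

context projections begin

lemma invariant_depends:
  assumes "\<And>x. F (proj i x) = F x" "\<And>q. q < n \<Longrightarrow> x q = y q"
  shows "F x = F y"
  using assms(1)[of x] assms(1)[of y] proj_cong[of x y i] assms(2) by simp

lemma heat_invariant:
  assumes i: "i \<in> I" and inv: "\<And>x. F (proj i x) = F x"
  shows "heat t F (proj i x) = heat t F x"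
proof -
  have "F (\<lambda>q. proj i x q + sqrt t * \<omega> q) = F (\<lambda>q. x q + sqrt t * \<omega> q)" for \<omega>
    using inv[of "\<lambda>q. proj i x q + sqrt t * \<omega> q"] inv[of "\<lambda>q. x q + sqrt t * \<omega> q"]
    by (simp add: proj_add proj_proj[OF i])
  then show ?thesis by (simp add: heat_def)
qed

subsection \<open>Lipschitz functions\<close>

text \<open>Iteration of \<open>one_step\<close> over k steps with \<sigma>^2 = 1/k, where k grows
  while \<tau> is fixed. The offset \<open>m0\<close> leaves room for the comparison of the data at
  time 0 with those at time \<tau>.\<close>

lemma ehrhard_regularised:
  assumes \<eta>: "0 < \<eta>" "\<eta> \<le> \<zeta>" "\<zeta> < 1" and \<zeta>a: "\<zeta> \<le> Phi a"
    and Um[measurable]: "\<And>i. i \<in> I \<Longrightarrow> U i \<in> borel_measurable borel"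
    and U: "\<And>i x. i \<in> I \<Longrightarrow> \<eta> \<le> U i x" "\<And>i x. i \<in> I \<Longrightarrow> U i x \<le> \<zeta>"
    and inv: "\<And>i x. i \<in> I \<Longrightarrow> U i (proj i x) = U i x"
    and Hm[measurable]: "H \<in> borel_measurable borel" and H1: "\<And>x. \<bar>H x\<bar> \<le> 1"
    and \<tau>: "0 < \<tau>" and m0: "- 1 / 2 \<le> m0" "m0 \<le> 0"
    and start: "\<And>z y. (\<And>q. q < n \<Longrightarrow> comb y q = z q) \<Longrightarrow>
       Phi (a + m0 + (\<Sum>i\<in>I. l i * (Phinv (heat \<tau> (U i) (y i)) - a))) \<le> H z"
  shows "Phi (a + m0 + (\<Sum>i\<in>I. l i * (Phinv (heat (\<tau> + 1) (U i) (\<lambda>_. 0)) - a))) \<le> (\<integral>\<omega>. H \<omega> \<partial>gauss)"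
proof -
  obtain K where K: "K \<ge> 1" "\<And>u. \<eta> \<le> u \<Longrightarrow> u \<le> \<zeta> \<Longrightarrow> \<bar>Phinv u\<bar> \<le> K"
    "\<And>u. \<eta> \<le> u \<Longrightarrow> u \<le> \<zeta> \<Longrightarrow> inverse (std_normal_density (Phinv u)) \<le> K"
    "\<And>u w. \<eta> \<le> u \<Longrightarrow> u \<le> \<zeta> \<Longrightarrow> \<eta> \<le> w \<Longrightarrow> w \<le> \<zeta> \<Longrightarrow> \<bar>Phinv u - Phinv w\<bar> \<le> K * \<bar>u - w\<bar>"
    "\<And>u w. \<eta> \<le> u \<Longrightarrow> u \<le> \<zeta> \<Longrightarrow> \<eta> \<le> w \<Longrightarrow> w \<le> \<zeta> \<Longrightarrow>
      \<bar>Phinv u - Phinv w - inverse (std_normal_density (Phinv w)) * (u - w)\<bar> \<le> K * (u - w)\<^sup>2"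
    by (rule Phinv_smooth[OF \<eta>]) (rule that, assumption+)
  obtain L0 where L0: "L0 > 0" "\<And>F. F \<in> borel_measurable borel \<Longrightarrow> (\<And>x. 0 \<le> F x) \<Longrightarrow> (\<And>x. F x \<le> 1) \<Longrightarrow>
    (\<And>x y. (\<And>q. q < n \<Longrightarrow> x q = y q) \<Longrightarrow> F x = F y) \<Longrightarrow> C11 n L0 (heat \<tau> F)"
    using heat_C11[OF \<tau>, of n] by blast
  \<comment> \<open>One constant for two purposes: regularity in space, and, by the last summand,
    the change per time step.\<close>
  define L where "L = K * (2 * L0 + 1)\<^sup>2 + K * L0 + K * L0 * expmom n"
  have LL: "0 \<le> L" "K * (2 * L0 + 1)\<^sup>2 + K * L0 \<le> L" "K * L0 * expmom n \<le> L"
    using K(1) L0(1) expmom_ge_1[of n] by (auto simp: L_def intro!: add_nonneg_nonneg mult_nonneg_nonneg)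
  define u where "u t i = heat t (U i)" for t i
  define v where "v t i x = Phinv (u t i x)" for t i x
  have absU: "\<bar>U i x\<bar> \<le> 1" if "i \<in> I" for i x using U[OF that, of x] \<eta> by linarith
  have um[measurable]: "u t i \<in> borel_measurable borel" if "i \<in> I" for t i
    unfolding u_def using Um[OF that] by simp
  have ub: "\<eta> \<le> u t i x" "u t i x \<le> \<zeta>" if "i \<in> I" for t i x
    unfolding u_def using heat_bounds[OF Um[OF that] U(1)[OF that] U(2)[OF that]] by auto
  have u01: "0 \<le> u t i x" "u t i x \<le> 1" "\<bar>u t i x\<bar> \<le> 1" if "i \<in> I" for t i x
    using ub[OF that, where t=t and x=x] \<eta> by linarith+
  have uadd: "heat s (u t i) = u (t + s) i" if "i \<in> I" "0 \<le> t" "0 \<le> s" for t s i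
    unfolding u_def using heat_heat[OF Um[OF that(1)] absU[OF that(1)] that(3,2)] by (auto simp: add.commute)
  \<comment> \<open>From time \<tau> on, \<open>u t i\<close> is the smoothing over time \<tau> of
    an earlier function with values in [0,1], so one constant holds at all later times.\<close>
  have uC: "C11 n L0 (u t i)" if i: "i \<in> I" and t: "\<tau> \<le> t" for t i
  proof -
    have "u t i = heat \<tau> (u (t - \<tau>) i)" using uadd[OF i, of "t - \<tau>" \<tau>] t \<tau> by simp
    moreover have "C11 n L0 (heat \<tau> (u (t - \<tau>) i))"
    proof (rule L0(2)[OF um[OF i] u01(1)[OF i] u01(2)[OF i]])
      fix x y :: "nat \<Rightarrow> real" assume xy: "\<And>q. q < n \<Longrightarrow> x q = y q"
      show "u (t - \<tau>) i x = u (t - \<tau>) i y"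
        unfolding u_def by (rule heat_depends[OF invariant_depends[where F="U i" and i=i] xy]) (use inv[OF i] in auto)
    qed
    ultimately show ?thesis by simp
  qed
  have vC: "C11 n L (v t i)" if "i \<in> I" "\<tau> \<le> t" for t i
    unfolding v_def
    by (rule C11_mono[OF C11_Phinv[OF \<eta> less_imp_le[OF L0(1)] K(1) K(3) K(5) ub[OF that(1)] uC[OF that]] LL(2)])
  obtain C where C: "0 \<le> C" and OS: "\<And>\<sigma> v v' K' m z y.
     0 < \<sigma> \<Longrightarrow> \<sigma> \<le> 1 \<Longrightarrow> C * \<sigma>^3 \<le> 1 \<Longrightarrow> - 1 \<le> m \<Longrightarrow> m \<le> 0 \<Longrightarrow>
     (\<And>i. i \<in> I \<Longrightarrow> v i \<in> borel_measurable borel) \<Longrightarrow>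
     (\<And>i x. i \<in> I \<Longrightarrow> \<bar>v' i x\<bar> \<le> K) \<Longrightarrow> (\<And>i x. i \<in> I \<Longrightarrow> v' i x \<le> a) \<Longrightarrow>
     (\<And>i x. i \<in> I \<Longrightarrow> \<bar>v i x - v' i x\<bar> \<le> L * \<sigma>\<^sup>2) \<Longrightarrow>
     (\<And>i. i \<in> I \<Longrightarrow> C11 n L (v' i)) \<Longrightarrow>
     (\<And>i x. i \<in> I \<Longrightarrow> v' i (proj i x) = v' i x) \<Longrightarrow>
     (\<And>i x. i \<in> I \<Longrightarrow> (\<integral>\<omega>. Phi (v i (\<lambda>q. x q + \<sigma> * \<omega> q)) \<partial>gauss) = Phi (v' i x)) \<Longrightarrow>
     K' \<in> borel_measurable borel \<Longrightarrow> (\<And>x. \<bar>K' x\<bar> \<le> 1) \<Longrightarrow>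
     (\<And>z y. (\<And>q. q < n \<Longrightarrow> comb y q = z q) \<Longrightarrow> Phi (a + m + (\<Sum>i\<in>I. l i * (v i (y i) - a))) \<le> K' z) \<Longrightarrow>
     (\<And>q. q < n \<Longrightarrow> comb y q = z q) \<Longrightarrow>
     Phi (a + (m - C * \<sigma>^3) + (\<Sum>i\<in>I. l i * (v' i (y i) - a))) \<le> (\<integral>\<omega>. K' (\<lambda>q. z q + \<sigma> * \<omega> q) \<partial>gauss)"
    by (rule one_step[OF LL(1), of K a]) (use K(1) in \<open>linarith, blast\<close>)
  have Hb: "- 1 \<le> H x" "H x \<le> 1" for x using H1[of x] by linarith+
  have Hheat: "\<bar>heat t H x\<bar> \<le> 1" for t x using heat_bounds[OF Hm Hb, where t=t and x=x] by linarith
  \<comment> \<open>The bound e \<le> 1/2 together with m0 \<ge> -1/2 keeps the slack above -1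
    during all steps.\<close>
  have step: "Phi (a + m0 - e + (\<Sum>i\<in>I. l i * (v (\<tau> + 1) i (\<lambda>_. 0) - a))) \<le> (\<integral>\<omega>. H \<omega> \<partial>gauss)"
    if e: "0 < e" "e \<le> 1 / 2" for e
  proof -
    \<comment> \<open>The number of steps is so large that the total loss k C \<sigma>^3 = C
      \<sigma> stays below \<open>e\<close>.\<close>
    obtain k0 :: nat where k0: "((C + 1) / e)\<^sup>2 < real k0" using reals_Archimedean2 by blast
    define k where "k = Suc k0"
    define \<sigma> where "\<sigma> = sqrt (1 / real k)"
    have kp: "0 < real k" by (simp add: k_def)
    have \<sigma>: "0 < \<sigma>" "\<sigma> \<le> 1" "\<sigma>\<^sup>2 = 1 / real k" by (auto simp: \<sigma>_def k_def)
    have sq: "sqrt (\<sigma>\<^sup>2) = \<sigma>" using \<sigma>(1) by simp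
    have C\<sigma>: "C * \<sigma> \<le> e"
    proof -
      have "(C + 1) / e \<le> sqrt (real k)"
        by (rule real_le_rsqrt) (use k0 in \<open>simp add: k_def\<close>)
      then have "(C + 1) / sqrt (real k) \<le> e" using e kp by (simp add: field_simps)
      moreover have "C * \<sigma> \<le> (C + 1) / sqrt (real k)" using kp by (simp add: \<sigma>_def real_sqrt_divide divide_right_mono)
      ultimately show ?thesis by linarith
    qed
    have C3: "C * \<sigma>^3 * real k = C * \<sigma>" 
    proof -
      have "C * \<sigma>^3 * real k = C * \<sigma> * (\<sigma>\<^sup>2 * real k)" by (simp add: eval_nat_numeral mult_ac)
      then show ?thesis using \<sigma>(3) kp by simp
    qed
    have C3p: "0 \<le> C * \<sigma>^3" using C \<sigma> by simp
    have iter: "\<forall>z y. (\<forall>q<n. comb y q = z q) \<longrightarrow>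
        Phi (a + (m0 - real j * (C * \<sigma>^3)) + (\<Sum>i\<in>I. l i * (v (\<tau> + real j * \<sigma>\<^sup>2) i (y i) - a))) \<le> heat (real j * \<sigma>\<^sup>2) H z"
      if "j \<le> k" for j
      using that
    proof (induction j)
      case 0
      then show ?case using start by (simp add: v_def u_def)
    next
      case (Suc j)
      define t where "t = \<tau> + real j * \<sigma>\<^sup>2"
      have t: "\<tau> \<le> t" "0 \<le> t" using \<tau> by (auto simp: t_def)
      have t': "\<tau> + real (Suc j) * \<sigma>\<^sup>2 = t + \<sigma>\<^sup>2" by (simp add: t_def algebra_simps)
      have mj: "real j * (C * \<sigma>^3) \<le> 1 / 2" "C * \<sigma>^3 \<le> 1"
      proof -
        have "real j * (C * \<sigma>^3) \<le> real k * (C * \<sigma>^3)" "1 * (C * \<sigma>^3) \<le> real k * (C * \<sigma>^3)"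
          using Suc.prems C3p by (intro mult_right_mono; simp)+
        moreover have "real k * (C * \<sigma>^3) = C * \<sigma>" unfolding C3[symmetric] by (rule mult.commute)
        ultimately show "real j * (C * \<sigma>^3) \<le> 1 / 2" "C * \<sigma>^3 \<le> 1" using C\<sigma> e by linarith+
      qed
      show ?case
      proof (intro allI impI)
        fix z y assume zy: "\<forall>q<n. comb y q = z q"
        have "Phi (a + ((m0 - real j * (C * \<sigma>^3)) - C * \<sigma>^3) + (\<Sum>i\<in>I. l i * (v (t + \<sigma>\<^sup>2) i (y i) - a)))
          \<le> (\<integral>\<omega>. heat (real j * \<sigma>\<^sup>2) H (\<lambda>q. z q + \<sigma> * \<omega> q) \<partial>gauss)"
        proof (rule OS[where v="v t" and v'="v (t + \<sigma>\<^sup>2)", OF \<sigma>(1,2) mj(2)])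
          show "- 1 \<le> m0 - real j * (C * \<sigma>^3)" using m0 mj by linarith
          show "m0 - real j * (C * \<sigma>^3) \<le> 0" using m0 mult_nonneg_nonneg[OF _ C3p, of "real j"] by simp
          fix i assume i: "i \<in> I"
          have "(\<lambda>x. Phinv (u t i x)) \<in> borel_measurable borel"
          proof -
            have "(\<lambda>x. if x \<in> {0<..<1} then Phinv x else 0) \<in> borel_measurable borel"
              by (rule borel_measurable_continuous_on_if)
                (auto intro!: continuous_at_imp_continuous_on isCont_Phinv)
            from measurable_compose[OF um[OF i, of t] this]
            have "(\<lambda>x. if u t i x \<in> {0<..<1} then Phinv (u t i x) else 0) \<in> borel_measurable borel" .
            moreover have "u t i x \<in> {0<..<1}" for x using ub[OF i, of t x] \<eta> by auto
            ultimately show ?thesis by (simp cong: if_cong)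
          qed
          then show "v t i \<in> borel_measurable borel" by (simp add: v_def[abs_def])
          show "C11 n L (v (t + \<sigma>\<^sup>2) i)" by (rule vC[OF i]) (use t in \<open>simp add: add_increasing2\<close>)
          fix x
          show "\<bar>v (t + \<sigma>\<^sup>2) i x\<bar> \<le> K" unfolding v_def by (rule K(2)[OF ub[OF i]])
          show "v (t + \<sigma>\<^sup>2) i x \<le> a"
          proof -
            have "u (t + \<sigma>\<^sup>2) i x \<le> Phi a" using ub(2)[OF i] \<zeta>a by (rule order_trans)
            then have "Phinv (u (t + \<sigma>\<^sup>2) i x) \<le> Phinv (Phi a)"
              using ub(1)[OF i, of "t + \<sigma>\<^sup>2" x] \<eta> by (intro Phinv_mono) auto
            then show ?thesis by (simp add: v_def)
          qed
          have us: "u (t + \<sigma>\<^sup>2) i = heat (\<sigma>\<^sup>2) (u t i)" using uadd[OF i t(2), of "\<sigma>\<^sup>2"] by simp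
          have "\<bar>u t i x - u (t + \<sigma>\<^sup>2) i x\<bar> \<le> L0 * expmom n * \<sigma>\<^sup>2"
            unfolding us
            using C11_time_increment[OF um[OF i] u01(3)[OF i] uC[OF i t(1)] less_imp_le[OF L0(1)], of "\<sigma>\<^sup>2" x]
            by (simp add: abs_minus_commute)
          then have "K * \<bar>u t i x - u (t + \<sigma>\<^sup>2) i x\<bar> \<le> K * (L0 * expmom n * \<sigma>\<^sup>2)"
            using K(1) by (intro mult_left_mono) auto
          moreover have "\<bar>v t i x - v (t + \<sigma>\<^sup>2) i x\<bar> \<le> K * \<bar>u t i x - u (t + \<sigma>\<^sup>2) i x\<bar>"
            unfolding v_def by (rule K(4)[OF ub[OF i] ub[OF i]])
          moreover have "(K * L0 * expmom n) * \<sigma>\<^sup>2 \<le> L * \<sigma>\<^sup>2" using LL(3) by (rule mult_right_mono) simp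
          ultimately show "\<bar>v t i x - v (t + \<sigma>\<^sup>2) i x\<bar> \<le> L * \<sigma>\<^sup>2" by (simp add: mult.assoc)
          show "v (t + \<sigma>\<^sup>2) i (proj i x) = v (t + \<sigma>\<^sup>2) i x"
            unfolding v_def u_def by (simp add: heat_invariant[where F="U i", OF i inv[OF i]])
          have PP: "Phi (v t' i x') = u t' i x'" for t' x'
            unfolding v_def by (rule Phi_Phinv) (use ub[OF i, of t' x'] \<eta> in linarith)+
          show "(\<integral>\<omega>. Phi (v t i (\<lambda>q. x q + \<sigma> * \<omega> q)) \<partial>gauss) = Phi (v (t + \<sigma>\<^sup>2) i x)"
            unfolding PP us heat_def sq ..
        next
          fix z y assume "\<And>q. q < n \<Longrightarrow> comb y q = z q"
          then show "Phi (a + (m0 - real j * (C * \<sigma>^3)) + (\<Sum>i\<in>I. l i * (v t i (y i) - a))) \<le> heat (real j * \<sigma>\<^sup>2) H z"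
            using Suc.IH Suc.prems by (simp add: t_def)
        qed (use zy Hheat in auto)
        also have "(\<integral>\<omega>. heat (real j * \<sigma>\<^sup>2) H (\<lambda>q. z q + \<sigma> * \<omega> q) \<partial>gauss) = heat (\<sigma>\<^sup>2) (heat (real j * \<sigma>\<^sup>2) H) z"
          unfolding heat_def[of "\<sigma>\<^sup>2"] sq ..
        also have "\<dots> = heat (real (Suc j) * \<sigma>\<^sup>2) H z"
          by (subst heat_heat[OF Hm H1]) (auto simp: algebra_simps)
        finally show "Phi (a + (m0 - real (Suc j) * (C * \<sigma>^3)) + (\<Sum>i\<in>I. l i * (v (\<tau> + real (Suc j) * \<sigma>\<^sup>2) i (y i) - a)))
           \<le> heat (real (Suc j) * \<sigma>\<^sup>2) H z"
          unfolding t' by (simp add: algebra_simps)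
      qed
    qed
    have k\<sigma>: "real k * \<sigma>\<^sup>2 = 1" using \<sigma>(3) kp by simp
    \<comment> \<open>Zero vectors combine to the origin, where the heat flow of \<open>H\<close> at
      time 1 is its Gaussian integral.\<close>
    have "comb (\<lambda>_ _. 0) q = 0" for q unfolding comb_def proj_def by (intro sum.neutral) simp
    then have B1: "Phi (a + (m0 - real k * (C * \<sigma>^3)) + (\<Sum>i\<in>I. l i * (v (\<tau> + 1) i (\<lambda>_. 0) - a))) \<le> heat 1 H (\<lambda>_. 0)"
      using iter[of k, THEN spec[of _ "\<lambda>_. 0"], THEN spec[of _ "\<lambda>_ _. 0"]] by (simp add: k\<sigma>)
    have B2: "Phi (a + m0 - e + (\<Sum>i\<in>I. l i * (v (\<tau> + 1) i (\<lambda>_. 0) - a))) \<le> Phi (a + (m0 - real k * (C * \<sigma>^3)) + (\<Sum>i\<in>I. l i * (v (\<tau> + 1) i (\<lambda>_. 0) - a)))"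
    proof -
      have "real k * (C * \<sigma>^3) = C * \<sigma>" unfolding C3[symmetric] by (rule mult.commute)
      then have "real k * (C * \<sigma>^3) \<le> e" using C\<sigma> by linarith
      then show ?thesis by simp
    qed
    show ?thesis using order_trans[OF B2 B1] by (simp add: heat_def)
  qed
  show ?thesis
  proof (rule Phi_le_limit[of "1/2"])
    fix e :: real assume "0 < e" "e \<le> 1 / 2"
    from step[OF this] show "Phi (a + m0 + (\<Sum>i\<in>I. l i * (Phinv (heat (\<tau> + 1) (U i) (\<lambda>_. 0)) - a)) - e) \<le> (\<integral>\<omega>. H \<omega> \<partial>gauss)"
      by (simp add: v_def u_def algebra_simps)
  qed simp
qed

text \<open>
  The functions \<open>U i\<close> are run from time \<open>\<tau>\<close> to \<open>1 + \<tau>\<close>, where they are smooth, while \<open>H\<close> is run from time \<open>0\<close> to \<open>1\<close>.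
\<close>

lemma ehrhard_lipschitz:
  assumes \<eta>: "0 < \<eta>" "\<eta> \<le> \<zeta>" "\<zeta> < 1" and \<zeta>a: "\<zeta> \<le> Phi a"
    and Um[measurable]: "\<And>i. i \<in> I \<Longrightarrow> U i \<in> borel_measurable borel"
    and U: "\<And>i x. i \<in> I \<Longrightarrow> \<eta> \<le> U i x" "\<And>i x. i \<in> I \<Longrightarrow> U i x \<le> \<zeta>"
    and inv: "\<And>i x. i \<in> I \<Longrightarrow> U i (proj i x) = U i x"
    and lip: "\<And>i x y. i \<in> I \<Longrightarrow> \<bar>U i (\<lambda>q. x q + y q) - U i x\<bar> \<le> N * nrm n y" and N: "0 \<le> N"
    and Hm[measurable]: "H \<in> borel_measurable borel" and H1: "\<And>x. \<bar>H x\<bar> \<le> 1"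
    and start: "\<And>z y. (\<And>q. q < n \<Longrightarrow> comb y q = z q) \<Longrightarrow> Phi (a + (\<Sum>i\<in>I. l i * (Phinv (U i (y i)) - a))) \<le> H z"
  shows "Phi (a + (\<Sum>i\<in>I. l i * (Phinv (\<integral>\<omega>. U i \<omega> \<partial>gauss) - a))) \<le> (\<integral>\<omega>. H \<omega> \<partial>gauss)"
proof -
  obtain K where K: "K \<ge> 1" 
    "\<And>u w. \<eta> \<le> u \<Longrightarrow> u \<le> \<zeta> \<Longrightarrow> \<eta> \<le> w \<Longrightarrow> w \<le> \<zeta> \<Longrightarrow> \<bar>Phinv u - Phinv w\<bar> \<le> K * \<bar>u - w\<bar>"
    by (rule Phinv_smooth[OF \<eta>]) (rule that, assumption+)
  define M where "M = expmom n"
  \<comment> \<open>Lipschitz constant, with respect to the square root of time, of the weighted sum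
    of the \<open>Phinv (heat t (U i) x)\<close>.\<close>
  define A where "A = lsum * K * N * M"
  have A0: "0 \<le> A" unfolding A_def M_def using lsum_nonneg K(1) N expmom_ge_1[of n] by (intro mult_nonneg_nonneg) auto
  have absU: "\<bar>U i x\<bar> \<le> 1" if "i \<in> I" for i x using U[OF that, of x] \<eta> by linarith
  have hb: "\<eta> \<le> heat t (U i) x" "heat t (U i) x \<le> \<zeta>" if "i \<in> I" for t i x
    using heat_bounds[OF Um[OF that] U(1)[OF that] U(2)[OF that]] by auto
  have hd: "\<bar>heat t (U i) x - heat s (U i) x\<bar> \<le> N * M * \<bar>sqrt t - sqrt s\<bar>" if i: "i \<in> I" for i t s x
  proof -
    have bd: "\<bar>U i (\<lambda>q. x q + sqrt t * \<omega> q) - U i (\<lambda>q. x q + sqrt s * \<omega> q)\<bar> \<le> (N * \<bar>sqrt t - sqrt s\<bar>) * expabs n \<omega> ^ 1" for \<omega>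
    proof -
      have "\<bar>U i (\<lambda>q. x q + sqrt t * \<omega> q) - U i (\<lambda>q. x q + sqrt s * \<omega> q)\<bar> \<le> N * nrm n (\<lambda>q. (sqrt t - sqrt s) * \<omega> q)"
        using lip[OF i, of "\<lambda>q. x q + sqrt s * \<omega> q" "\<lambda>q. (sqrt t - sqrt s) * \<omega> q"] by (simp add: algebra_simps)
      also have "\<dots> = N * \<bar>sqrt t - sqrt s\<bar> * nrm n \<omega>" by (simp add: nrm_scale)
      also have "\<dots> \<le> N * \<bar>sqrt t - sqrt s\<bar> * expabs n \<omega>"
        using N order_trans[OF nrm_le_sumabs sumabs_le_expabs] by (intro mult_left_mono) auto
      finally show ?thesis by simp
    qed
    have [measurable]: "(\<lambda>\<omega> q. x q + c * \<omega> q) \<in> measurable borel (borel :: (nat \<Rightarrow> real) measure)" for c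
      by (rule measurable_into_fun) simp
    have [measurable]: "U i \<in> borel_measurable borel" by (rule Um[OF i])
    have "\<bar>\<integral>\<omega>. U i (\<lambda>q. x q + sqrt t * \<omega> q) - U i (\<lambda>q. x q + sqrt s * \<omega> q) \<partial>gauss\<bar> \<le> (N * \<bar>sqrt t - sqrt s\<bar>) * expmom n"
      by (rule integrable_expabs_bound(2)[OF _ bd]) (use N in auto)
    moreover have "(\<integral>\<omega>. U i (\<lambda>q. x q + sqrt t * \<omega> q) - U i (\<lambda>q. x q + sqrt s * \<omega> q) \<partial>gauss) = heat t (U i) x - heat s (U i) x"
      unfolding heat_def by (rule Bochner_Integration.integral_diff) (rule integrable_heat[OF Um[OF i] absU[OF i]])+
    ultimately show ?thesis by (simp add: M_def mult_ac)
  qed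
  \<comment> \<open>The delay costs A sqrt \<tau> at the start, where time 0 is replaced by \<tau>,
    but only A \<tau> at the end, since sqrt (1 + \<tau>) - 1 \<le> \<tau>.\<close>
  have main: "Phi (a + (\<Sum>i\<in>I. l i * (Phinv (\<integral>\<omega>. U i \<omega> \<partial>gauss) - a)) - A * (sqrt \<tau> + \<tau>)) \<le> (\<integral>\<omega>. H \<omega> \<partial>gauss)"
    if \<tau>: "0 < \<tau>" "A * sqrt \<tau> \<le> 1 / 2" for \<tau>
  proof -
    have e: "A * r = (\<Sum>i\<in>I. l i * (K * (N * M * r)))" for r
      by (simp add: A_def lsum_def sum_distrib_left sum_distrib_right mult_ac)
    have S1: "Phi (a + (- A * sqrt \<tau>) + (\<Sum>i\<in>I. l i * (Phinv (heat \<tau> (U i) (y i)) - a))) \<le> H z"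
      if "\<And>q. q < n \<Longrightarrow> comb y q = z q" for z y
    proof -
      have "(\<Sum>i\<in>I. l i * (Phinv (heat \<tau> (U i) (y i)) - a)) \<le> (\<Sum>i\<in>I. l i * (Phinv (U i (y i)) - a) + l i * (K * (N * M * sqrt \<tau>)))"
      proof (intro sum_mono)
        fix i assume i: "i \<in> I"
        have "K * \<bar>heat \<tau> (U i) (y i) - U i (y i)\<bar> \<le> K * (N * M * sqrt \<tau>)"
          using hd[OF i, of \<tau> "y i" 0] K(1) \<tau> by (intro mult_left_mono) auto
        then have "Phinv (heat \<tau> (U i) (y i)) - a \<le> (Phinv (U i (y i)) - a) + K * (N * M * sqrt \<tau>)"
          using K(2)[OF hb[OF i, of \<tau> "y i"] U(1)[OF i, of "y i"] U(2)[OF i, of "y i"]] by linarith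
        from mult_left_mono[OF this less_imp_le[OF l_pos[OF i]]]
        show "l i * (Phinv (heat \<tau> (U i) (y i)) - a) \<le> l i * (Phinv (U i (y i)) - a) + l i * (K * (N * M * sqrt \<tau>))"
          by (simp add: distrib_left)
      qed
      then have "a + (- A * sqrt \<tau>) + (\<Sum>i\<in>I. l i * (Phinv (heat \<tau> (U i) (y i)) - a)) \<le> a + (\<Sum>i\<in>I. l i * (Phinv (U i (y i)) - a))"
        using e[of "sqrt \<tau>"] by (simp add: sum.distrib)
      then show ?thesis using start[OF that] by (meson Phi_le_iff order_trans)
    qed
    have R: "Phi (a + (- A * sqrt \<tau>) + (\<Sum>i\<in>I. l i * (Phinv (heat (\<tau> + 1) (U i) (\<lambda>_. 0)) - a))) \<le> (\<integral>\<omega>. H \<omega> \<partial>gauss)"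
      by (rule ehrhard_regularised[OF \<eta> \<zeta>a Um U inv Hm H1 \<tau>(1) _ _ S1]) (use \<tau> A0 in auto)
    have "(\<Sum>i\<in>I. l i * (Phinv (\<integral>\<omega>. U i \<omega> \<partial>gauss) - a)) \<le> (\<Sum>i\<in>I. l i * (Phinv (heat (\<tau> + 1) (U i) (\<lambda>_. 0)) - a) + l i * (K * (N * M * \<tau>)))"
    proof (intro sum_mono)
      fix i assume i: "i \<in> I"
      have h1: "(\<integral>\<omega>. U i \<omega> \<partial>gauss) = heat 1 (U i) (\<lambda>_. 0)" by (simp add: heat_def)
      have "1 \<le> sqrt (\<tau> + 1)" using \<tau> by simp
      moreover have "sqrt (\<tau> + 1) \<le> 1 + \<tau>" using \<tau> by (intro real_le_lsqrt) (auto simp: power2_eq_square algebra_simps)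
      ultimately have "\<bar>sqrt 1 - sqrt (\<tau> + 1)\<bar> \<le> \<tau>" by simp
      then have "N * M * \<bar>sqrt 1 - sqrt (\<tau> + 1)\<bar> \<le> N * M * \<tau>"
        using N expmom_ge_1[of n] unfolding M_def by (intro mult_left_mono) auto
      then have "K * \<bar>heat 1 (U i) (\<lambda>_. 0) - heat (\<tau> + 1) (U i) (\<lambda>_. 0)\<bar> \<le> K * (N * M * \<tau>)"
        using hd[OF i, of 1 "\<lambda>_. 0" "\<tau> + 1"] K(1) by (intro mult_left_mono) auto
      then have "Phinv (heat 1 (U i) (\<lambda>_. 0)) - a \<le> (Phinv (heat (\<tau> + 1) (U i) (\<lambda>_. 0)) - a) + K * (N * M * \<tau>)"
        using K(2)[OF hb[OF i, of 1 "\<lambda>_. 0"] hb[OF i, of "\<tau> + 1" "\<lambda>_. 0"]] by linarith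
      from mult_left_mono[OF this less_imp_le[OF l_pos[OF i]]]
      show "l i * (Phinv (\<integral>\<omega>. U i \<omega> \<partial>gauss) - a) \<le> l i * (Phinv (heat (\<tau> + 1) (U i) (\<lambda>_. 0)) - a) + l i * (K * (N * M * \<tau>))"
        unfolding h1 by (simp add: distrib_left)
    qed
    then have "a + (\<Sum>i\<in>I. l i * (Phinv (\<integral>\<omega>. U i \<omega> \<partial>gauss) - a)) - A * (sqrt \<tau> + \<tau>)
        \<le> a + (- A * sqrt \<tau>) + (\<Sum>i\<in>I. l i * (Phinv (heat (\<tau> + 1) (U i) (\<lambda>_. 0)) - a))"
      using e[of \<tau>] by (simp add: sum.distrib distrib_left)
    then show ?thesis using R by (meson Phi_le_iff order_trans)
  qed
  show ?thesis
  proof (rule Phi_le_limit[of "1/2"])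
    fix e :: real assume e: "0 < e" "e \<le> 1 / 2"
    \<comment> \<open>The delay will be \<tau> = r^2, and r is chosen such that A (r + r^2) \<le>
      e.\<close>
    define r where "r = e / (2 * (A + 1))"
    have r: "0 < r" "r \<le> 1" using e A0 by (auto simp: r_def field_simps)
    have Ar: "A * r \<le> e / 2" using e A0 by (simp add: r_def field_simps)
    have r2: "r\<^sup>2 \<le> r" using r by (simp add: power2_eq_square mult_left_le)
    have s: "sqrt (r\<^sup>2) = r" using r by simp
    have "Phi (a + (\<Sum>i\<in>I. l i * (Phinv (\<integral>\<omega>. U i \<omega> \<partial>gauss) - a)) - A * (r + r\<^sup>2)) \<le> (\<integral>\<omega>. H \<omega> \<partial>gauss)"
      using main[of "r\<^sup>2"] r Ar e unfolding s by simp
    moreover have "A * (r + r\<^sup>2) \<le> e" using mult_left_mono[OF r2 A0] Ar by (simp add: distrib_left)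
    then have "Phi (a + (\<Sum>i\<in>I. l i * (Phinv (\<integral>\<omega>. U i \<omega> \<partial>gauss) - a)) - e) \<le> Phi (a + (\<Sum>i\<in>I. l i * (Phinv (\<integral>\<omega>. U i \<omega> \<partial>gauss) - a)) - A * (r + r\<^sup>2))"
      by simp
    ultimately show "Phi (a + (\<Sum>i\<in>I. l i * (Phinv (\<integral>\<omega>. U i \<omega> \<partial>gauss) - a)) - e) \<le> (\<integral>\<omega>. H \<omega> \<partial>gauss)"
      by (rule order_trans[rotated])
  qed simp
qed

end

lemma isCont_coord: "isCont (\<lambda>y::nat \<Rightarrow> real. y q) x"
proof -
  have "continuous_on UNIV (\<lambda>y::nat \<Rightarrow> real. y q)" by (rule continuous_on_product_coordinates)
  then show ?thesis unfolding continuous_on_eq_continuous_at[OF open_UNIV] by blast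
qed

text \<open>The seminorm involves finitely many coordinates and is continuous in the product
  topology, so a Lipschitz bound for it gives continuity.\<close>

lemma borel_measurable_nrm_lipschitz:
  assumes "\<And>x y. \<bar>F (\<lambda>q. x q + y q) - F x\<bar> \<le> N * nrm n y"
  shows "F \<in> borel_measurable (borel :: (nat \<Rightarrow> real) measure)"
proof (rule borel_measurable_continuous_onI, rule continuous_at_imp_continuous_on, rule ballI)
  fix x :: "nat \<Rightarrow> real"
  have 0: "nrm n (\<lambda>q. 0) = 0" by (simp add: nrm_def L2_set_def)
  have "isCont (\<lambda>y. N * nrm n (\<lambda>q. y q - x q)) x"
    unfolding nrm_def L2_set_def by (intro continuous_intros isCont_coord)
  then have "((\<lambda>y. N * nrm n (\<lambda>q. y q - x q)) \<longlongrightarrow> 0) (at x)"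
    by (simp add: isCont_def 0)
  then have "((\<lambda>y. F y - F x) \<longlongrightarrow> 0) (at x)"
  proof (rule Lim_null_comparison[rotated])
    have "norm (F y - F x) \<le> N * nrm n (\<lambda>q. y q - x q)" for y
      using assms[of x "\<lambda>q. y q - x q"] by simp
    then show "\<forall>\<^sub>F y in at x. norm (F y - F x) \<le> N * nrm n (\<lambda>q. y q - x q)" by simp
  qed
  then show "isCont F x" unfolding isCont_def by (rule Lim_null[THEN iffD2])
qed

subsection \<open>Borel functions\<close>

text \<open>The integral is the mass of the hypograph, a Borel set in a Polish space, and a compact
  subset exhausts it up to \<open>e\<close>. If \<open>G\<close> lies above \<open>C\<close>, its
  hypograph contains \<open>C\<close>, which bounds its integral from below. One compact set thus
  treats all levels at once.\<close>

lemma hypograph_compact: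
  fixes F :: "(nat \<Rightarrow> real) \<Rightarrow> real"
  assumes F[measurable]: "F \<in> borel_measurable borel" and F01: "\<And>x. 0 \<le> F x" "\<And>x. F x \<le> 1" and e: "0 < e"
  obtains C where "compact C" "\<And>y \<theta>. (y, \<theta>) \<in> C \<Longrightarrow> 0 \<le> \<theta> \<and> \<theta> \<le> F y"
    "\<And>G. G \<in> borel_measurable borel \<Longrightarrow> (\<And>x. 0 \<le> G x) \<Longrightarrow> (\<And>x. G x \<le> 1) \<Longrightarrow> (\<And>y \<theta>. (y, \<theta>) \<in> C \<Longrightarrow> \<theta> \<le> G y) \<Longrightarrow>
       (\<integral>\<omega>. F \<omega> \<partial>gauss) - e \<le> (\<integral>\<omega>. G \<omega> \<partial>gauss)"
proof -
  define hyp where "hyp G = {(y, \<theta>). 0 \<le> \<theta> \<and> \<theta> \<le> (G y :: real)}" for G :: "(nat \<Rightarrow> real) \<Rightarrow> real"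
  \<comment> \<open>Restricting the height to [0,1] makes the measure finite, as inner regularity
    requires, and loses nothing for functions with values in [0,1].\<close>
  define \<nu> :: "((nat \<Rightarrow> real) \<times> real) measure" where "\<nu> = density (gauss \<Otimes>\<^sub>M lborel) (\<lambda>z. indicator {0..1::real} (snd z))"
  have sets\<nu>: "sets \<nu> = sets borel"
  proof -
    have "sets \<nu> = sets (borel \<Otimes>\<^sub>M (borel :: real measure))"
      unfolding \<nu>_def sets_density by (intro sets_pair_measure_cong) auto
    then show ?thesis by (simp only: borel_prod)
  qed
  have hs[measurable]: "hyp G \<in> sets borel" if [measurable]: "G \<in> borel_measurable borel" for G
  proof -
    have "{z \<in> space (borel \<Otimes>\<^sub>M borel). 0 \<le> snd z \<and> snd z \<le> G (fst z)} \<in> sets (borel \<Otimes>\<^sub>M (borel :: real measure))"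
      by measurable
    moreover have "{z \<in> space (borel \<Otimes>\<^sub>M borel). 0 \<le> snd z \<and> snd z \<le> G (fst z)} = hyp G"
      by (auto simp: hyp_def space_pair_measure)
    ultimately show ?thesis by (simp only: borel_prod)
  qed
  have hm: "emeasure \<nu> (hyp G) = ennreal (\<integral>\<omega>. G \<omega> \<partial>gauss)"
    if G[measurable]: "G \<in> borel_measurable borel" and G01: "\<And>x. 0 \<le> G x" "\<And>x. G x \<le> 1" for G
  proof -
    have s: "hyp G \<in> sets (gauss \<Otimes>\<^sub>M lborel)"
      using hs[OF G] sets\<nu> by (simp add: \<nu>_def)
    have "emeasure \<nu> (hyp G) = (\<integral>\<^sup>+z. indicator {0..1::real} (snd z) * indicator (hyp G) z \<partial>(gauss \<Otimes>\<^sub>M lborel))"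
      unfolding \<nu>_def by (subst emeasure_density) (use s in auto)
    also have "\<dots> = (\<integral>\<^sup>+x. \<integral>\<^sup>+\<theta>. indicator {0..1::real} \<theta> * indicator (hyp G) (x, \<theta>) \<partial>lborel \<partial>gauss)"
      by (subst lborel.nn_integral_fst[symmetric]) (use s in auto)
    also have "\<dots> = (\<integral>\<^sup>+x. \<integral>\<^sup>+\<theta>. indicator {0..G x} \<theta> \<partial>lborel \<partial>gauss)"
      using G01 by (intro nn_integral_cong) (force simp: hyp_def indicator_def intro: order_trans)
    also have "\<dots> = (\<integral>\<^sup>+x. ennreal (G x) \<partial>gauss)"
      using G01 by simp
    also have "\<dots> = ennreal (\<integral>\<omega>. G \<omega> \<partial>gauss)"
      by (rule nn_integral_eq_integral) (use G01 in \<open>auto intro!: gauss.integrable_const_bound[where B=1]\<close>)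
    finally show ?thesis .
  qed
  have fin: "emeasure \<nu> (space \<nu>) \<noteq> \<infinity>"
  proof -
    have "emeasure \<nu> (space \<nu>) = (\<integral>\<^sup>+z. indicator {0..1::real} (snd z) * indicator (space (gauss \<Otimes>\<^sub>M lborel)) z \<partial>(gauss \<Otimes>\<^sub>M lborel))"
      unfolding \<nu>_def space_density by (rule emeasure_density) (simp, rule sets.top)
    also have "\<dots> = (\<integral>\<^sup>+z. indicator {0..1::real} (snd z) \<partial>(gauss \<Otimes>\<^sub>M lborel))"
      by (rule nn_integral_cong) simp
    also have "\<dots> = (\<integral>\<^sup>+x. \<integral>\<^sup>+\<theta>. indicator {0..1::real} \<theta> \<partial>lborel \<partial>gauss)"
      by (subst lborel.nn_integral_fst[symmetric]) auto
    also have "\<dots> = 1" by (simp add: gauss.emeasure_space_1[unfolded space_gauss])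
    finally show ?thesis by simp
  qed
  have reg: "emeasure \<nu> (hyp F) = (SUP K \<in> {K. K \<subseteq> hyp F \<and> compact K}. emeasure \<nu> K)"
    by (rule inner_regular[OF sets\<nu> fin hs[OF F]])
  have "\<exists>C. C \<subseteq> hyp F \<and> compact C \<and> ennreal ((\<integral>\<omega>. F \<omega> \<partial>gauss) - e) \<le> emeasure \<nu> C"
  proof (cases "(\<integral>\<omega>. F \<omega> \<partial>gauss) - e \<le> 0")
    case True
    then show ?thesis by (intro exI[of _ "{}"]) (simp add: ennreal_neg)
  next
    case False
    then have "ennreal ((\<integral>\<omega>. F \<omega> \<partial>gauss) - e) < emeasure \<nu> (hyp F)"
      using e hm[OF F F01] by (simp add: ennreal_lessI)
    then show ?thesis unfolding reg less_SUP_iff by (auto intro: less_imp_le)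
  qed
  then obtain C where C: "C \<subseteq> hyp F" "compact C" "ennreal ((\<integral>\<omega>. F \<omega> \<partial>gauss) - e) \<le> emeasure \<nu> C" by blast
  show thesis
  proof (rule that[OF C(2)])
    show "0 \<le> \<theta> \<and> \<theta> \<le> F y" if "(y, \<theta>) \<in> C" for y \<theta> using that C(1) by (auto simp: hyp_def)
    fix G assume G: "G \<in> borel_measurable borel" "\<And>x. 0 \<le> G x" "\<And>x. G x \<le> 1" "\<And>y \<theta>. (y, \<theta>) \<in> C \<Longrightarrow> \<theta> \<le> G y"
    have "C \<subseteq> hyp G" using C(1) G(4) by (auto simp: hyp_def)
    then have "emeasure \<nu> C \<le> emeasure \<nu> (hyp G)" by (rule emeasure_mono) (simp add: sets\<nu> hs[OF G(1)])
    then have "ennreal ((\<integral>\<omega>. F \<omega> \<partial>gauss) - e) \<le> ennreal (\<integral>\<omega>. G \<omega> \<partial>gauss)"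
      using C(3) hm[OF G(1-3)] by simp
    moreover have "0 \<le> (\<integral>\<omega>. G \<omega> \<partial>gauss)" using G(2) by (simp add: integral_nonneg_AE)
    ultimately show "(\<integral>\<omega>. F \<omega> \<partial>gauss) - e \<le> (\<integral>\<omega>. G \<omega> \<partial>gauss)" by (simp add: ennreal_le_iff)
  qed
qed

text \<open>For each new index the subsequence found so far is refined once more; the limits
  obtained earlier survive.\<close>

lemma common_subsequence:
  fixes x :: "'i \<Rightarrow> nat \<Rightarrow> 'a::first_countable_topology"
  assumes "finite I" "\<And>i. i \<in> I \<Longrightarrow> compact (S i)" "\<And>i k. i \<in> I \<Longrightarrow> x i k \<in> S i"
  shows "\<exists>r L. strict_mono r \<and> (\<forall>i\<in>I. L i \<in> S i \<and> (\<lambda>k. x i (r k)) \<longlonglongrightarrow> L i)"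
  using assms
proof (induction I rule: finite_induct)
  case empty
  show ?case by (rule exI[of _ id]) (simp add: strict_mono_id)
next
  case (insert j I)
  have "\<exists>r L. strict_mono r \<and> (\<forall>i\<in>I. L i \<in> S i \<and> (\<lambda>k. x i (r k)) \<longlonglongrightarrow> L i)"
    by (rule insert.IH) (use insert.prems in auto)
  then obtain r L where r: "strict_mono r" and L: "\<forall>i\<in>I. L i \<in> S i \<and> (\<lambda>k. x i (r k)) \<longlonglongrightarrow> L i"
    by blast
  have "seq_compact (S j)" using insert.prems(1) by (intro compact_imp_seq_compact) auto
  then obtain M s where M: "M \<in> S j" "strict_mono s" "((\<lambda>k. x j (r k)) \<circ> s) \<longlonglongrightarrow> M"
    by (rule seq_compactE[where f="\<lambda>k. x j (r k)"]) (use insert.prems(2) in auto)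
  have "(\<lambda>k. x i (r (s k))) \<longlonglongrightarrow> L i" if "i \<in> I" for i
    using LIMSEQ_subseq_LIMSEQ[OF _ M(2), of "\<lambda>k. x i (r k)" "L i"] L that by (simp add: o_def)
  then show ?case
    using M L insert.hyps strict_mono_o[OF r M(2)]
    by (intro exI[of _ "r \<circ> s"] exI[of _ "L(j := M)"]) (auto simp: o_def)
qed

context projections begin

text \<open>
  A decreasing sequence of Lipschitz majorants of the function whose hypograph is the compact set \<open>C\<close>, cut off from
  below at \<open>\<eta>\<close>.
\<close>

definition upper_env :: "'i \<Rightarrow> real \<Rightarrow> ((nat \<Rightarrow> real) \<times> real) set \<Rightarrow> nat \<Rightarrow> (nat \<Rightarrow> real) \<Rightarrow> real"
  where "upper_env i \<eta> C k y = max \<eta> (SUP c\<in>C. snd c - real k * nrm n (\<lambda>q. proj i y q - proj i (fst c) q))"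

text \<open>Each point of \<open>C\<close> contributes a k-Lipschitz function of \<open>y\<close>,
  and these properties pass to the supremum. Distances are measured after projection, which gives
  the invariance; the penalty drives nearly optimal points of \<open>C\<close> towards
  \<open>y\<close>, up to projection, as k grows.\<close>

lemma
  assumes i: "i \<in> I" and C: "C \<noteq> {}" "\<And>y \<theta>. (y, \<theta>) \<in> C \<Longrightarrow> \<theta> \<le> \<zeta>" and \<eta>: "\<eta> \<le> \<zeta>"
  shows upper_env_bounds: "\<eta> \<le> upper_env i \<eta> C k y" "upper_env i \<eta> C k y \<le> \<zeta>"
    and upper_env_above: "(y, \<theta>) \<in> C \<Longrightarrow> \<theta> \<le> upper_env i \<eta> C k y"
    and upper_env_invariant: "upper_env i \<eta> C k (proj i y) = upper_env i \<eta> C k y"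
    and upper_env_antimono: "k \<le> k' \<Longrightarrow> upper_env i \<eta> C k' y \<le> upper_env i \<eta> C k y"
    and upper_env_lipschitz: "\<bar>upper_env i \<eta> C k (\<lambda>q. y q + w q) - upper_env i \<eta> C k y\<bar> \<le> real k * nrm n w"
    and upper_env_witness: "\<eta> < upper_env i \<eta> C k y \<Longrightarrow> 0 < e \<Longrightarrow> \<exists>c\<in>C. upper_env i \<eta> C k y - e < snd c - real k * nrm n (\<lambda>q. proj i y q - proj i (fst c) q)"
proof -
  define g where "g k y c = snd c - real k * nrm n (\<lambda>q. proj i y q - proj i (fst c) q)" for k y and c :: "(nat \<Rightarrow> real) \<times> real"
  have upper_env: "upper_env i \<eta> C k y = max \<eta> (SUP c\<in>C. g k y c)" for k y by (simp add: upper_env_def g_def)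
  have gz: "g k y c \<le> \<zeta>" if "c \<in> C" for k y c
  proof -
    have "0 \<le> real k * nrm n (\<lambda>q. proj i y q - proj i (fst c) q)" by simp
    moreover have "snd c \<le> \<zeta>" using C(2)[of "fst c" "snd c"] that by simp
    ultimately show ?thesis unfolding g_def by linarith
  qed
  have bdd: "bdd_above (g k y ` C)" for k y using gz by (auto intro!: bdd_aboveI[of _ \<zeta>])
  show "\<eta> \<le> upper_env i \<eta> C k y" by (simp add: upper_env)
  have "(SUP c\<in>C. g k y c) \<le> \<zeta>" by (rule cSUP_least[OF C(1) gz])
  then show "upper_env i \<eta> C k y \<le> \<zeta>" using \<eta> by (simp add: upper_env)
  show "\<theta> \<le> upper_env i \<eta> C k y" if "(y, \<theta>) \<in> C"
  proof -
    have "g k y (y, \<theta>) \<le> (SUP c\<in>C. g k y c)" by (rule cSUP_upper[OF that bdd])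
    moreover have "g k y (y, \<theta>) = \<theta>" by (simp add: g_def nrm_def L2_set_def)
    ultimately show ?thesis by (simp add: upper_env)
  qed
  show "upper_env i \<eta> C k (proj i y) = upper_env i \<eta> C k y" by (simp add: upper_env_def proj_proj[OF i])
  show "upper_env i \<eta> C k' y \<le> upper_env i \<eta> C k y" if "k \<le> k'"
  proof -
    have "(SUP c\<in>C. g k' y c) \<le> (SUP c\<in>C. g k y c)"
    proof (rule cSUP_least[OF C(1)])
      fix c assume c: "c \<in> C"
      have "g k' y c \<le> g k y c" using that by (simp add: g_def mult_right_mono)
      then show "g k' y c \<le> (SUP c\<in>C. g k y c)" using cSUP_upper[OF c bdd] by (rule order_trans)
    qed
    then show ?thesis by (auto simp: upper_env)
  qed
  have half: "upper_env i \<eta> C k (\<lambda>q. y q + w q) \<le> upper_env i \<eta> C k y + real k * nrm n w" for y w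
  proof -
    have "g k (\<lambda>q. y q + w q) c \<le> (SUP c\<in>C. g k y c) + real k * nrm n w" if c: "c \<in> C" for c
    proof -
      have "nrm n (\<lambda>q. proj i y q - proj i (fst c) q)
        \<le> nrm n (\<lambda>q. proj i (\<lambda>q. y q + w q) q - proj i (fst c) q) + nrm n (proj i (\<lambda>q. - 1 * w q))"
        using nrm_triangle[of n "\<lambda>q. proj i (\<lambda>q. y q + w q) q - proj i (fst c) q" "proj i (\<lambda>q. - 1 * w q)"]
        unfolding proj_add proj_scale by (simp add: algebra_simps)
      also have "nrm n (proj i (\<lambda>q. - 1 * w q)) \<le> nrm n w"
        using nrm_proj_le[OF i, of "\<lambda>q. - 1 * w q"] unfolding nrm_scale by simp
      finally have "real k * nrm n (\<lambda>q. proj i y q - proj i (fst c) q)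
        \<le> real k * (nrm n (\<lambda>q. proj i (\<lambda>q. y q + w q) q - proj i (fst c) q) + nrm n w)"
        by (intro mult_left_mono) auto
      then have "g k (\<lambda>q. y q + w q) c \<le> g k y c + real k * nrm n w" by (simp add: g_def distrib_left)
      then show ?thesis using cSUP_upper[OF c bdd, of k y] by linarith
    qed
    then have "(SUP c\<in>C. g k (\<lambda>q. y q + w q) c) \<le> (SUP c\<in>C. g k y c) + real k * nrm n w"
      by (rule cSUP_least[OF C(1)])
    moreover have "0 \<le> real k * nrm n w" by simp
    ultimately show ?thesis unfolding upper_env by linarith
  qed
  show "\<bar>upper_env i \<eta> C k (\<lambda>q. y q + w q) - upper_env i \<eta> C k y\<bar> \<le> real k * nrm n w"
    using half[of y w] half[of "\<lambda>q. y q + w q" "\<lambda>q. - 1 * w q"] unfolding nrm_scale by (simp add: abs_le_iff)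
  show "\<exists>c\<in>C. upper_env i \<eta> C k y - e < snd c - real k * nrm n (\<lambda>q. proj i y q - proj i (fst c) q)"
    if "\<eta> < upper_env i \<eta> C k y" "0 < e"
  proof -
    have eq: "upper_env i \<eta> C k y = (SUP c\<in>C. g k y c)" using that(1) by (auto simp: upper_env max_def split: if_splits)
    have "upper_env i \<eta> C k y - e < (SUP c\<in>C. g k y c)" using eq that(2) by simp
    then have "\<exists>c\<in>C. upper_env i \<eta> C k y - e < g k y c" using less_cSUP_iff[OF C(1) bdd] by blast
    then show ?thesis by (simp only: g_def)
  qed
qed

lemma Phinv_at_0: "filterlim Phinv at_bot (at_right 0)"
  unfolding filterlim_at_bot
proof
  fix Z
  show "eventually (\<lambda>x. Phinv x \<le> Z) (at_right 0)"
    unfolding eventually_at_right_field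
  proof (intro exI[of _ "Phi Z"] conjI allI impI)
    fix y assume "0 < y" "y < Phi Z"
    then show "Phinv y \<le> Z" using Phinv_mono[of y "Phi Z"] by simp
  qed simp
qed

text \<open>
  By compactness the fibrewise suprema of the Lipschitz majorants decrease to at most \<open>H z\<close>, up to the contribution of
  the cut-off \<open>\<eta>\<close>.
\<close>

lemma upper_env_limit:
  fixes C :: "'i \<Rightarrow> ((nat \<Rightarrow> real) \<times> real) set" and U :: "'i \<Rightarrow> (nat \<Rightarrow> real) \<Rightarrow> real"
  assumes \<eta>: "0 < \<eta>" "\<eta> \<le> Phi a"
    and U1: "\<And>i x. i \<in> I \<Longrightarrow> U i x \<le> Phi a"
    and C: "\<And>i. i \<in> I \<Longrightarrow> compact (C i)" "\<And>i. i \<in> I \<Longrightarrow> C i \<noteq> {}"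
      "\<And>i y \<theta>. i \<in> I \<Longrightarrow> (y, \<theta>) \<in> C i \<Longrightarrow> 0 \<le> \<theta> \<and> \<theta> \<le> U i y"
    and start: "\<And>z y. (\<And>i. i \<in> I \<Longrightarrow> 0 < U i (y i)) \<Longrightarrow> (\<And>q. q < n \<Longrightarrow> comb y q = z q) \<Longrightarrow>
      Phi (a + (\<Sum>i\<in>I. l i * (Phinv (U i (y i)) - a))) \<le> H z"
    and H0: "0 \<le> H z" and e: "0 < e"
    and y: "\<And>k q. q < n \<Longrightarrow> comb (y k) q = z q"
    and big: "\<And>k. H z + (\<Sum>i\<in>I. Phi (a + l i * (Phinv \<eta> - a))) + e < Phi (a + (\<Sum>i\<in>I. l i * (Phinv (upper_env i \<eta> (C i) k (y k i)) - a)))"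
  shows False
proof -
  define t where "t i k = upper_env i \<eta> (C i) k (y k i)" for i k
  have Cz: "\<theta> \<le> Phi a" if "i \<in> I" "(y, \<theta>) \<in> C i" for i y \<theta>
    using C(3)[OF that] U1[OF that(1), of y] by linarith
  note cb = upper_env_bounds[OF _ C(2) Cz \<eta>(2)]
  have tb: "\<eta> \<le> t i k" "t i k \<le> Phi a" if "i \<in> I" for i k
    unfolding t_def using cb[OF that that that] by auto
  have wneg: "Phinv x - a \<le> 0" if "0 < x" "x \<le> Phi a" for x
    using Phinv_mono[of x "Phi a"] that by simp
  \<comment> \<open>If one envelope value sat at the cut-off, then, the other summands being
    nonpositive, the whole value would be at most one term of the cut-off sum, which
    \<open>big\<close> excludes.\<close>
  have tgt: "\<eta> < t i k" if i: "i \<in> I" for i k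
  proof (rule ccontr)
    assume "\<not> \<eta> < t i k"
    then have te: "t i k = \<eta>" using tb[OF i, of k] by linarith
    have "(\<Sum>j\<in>I. l j * (Phinv (t j k) - a)) \<le> (\<Sum>j\<in>{i}. l j * (Phinv (t j k) - a))"
    proof (rule sum_mono2[where f = "\<lambda>j. - (l j * (Phinv (t j k) - a))", simplified sum_negf neg_le_iff_le])
      show "finite I" by (rule finite_I)
      show "{i} \<subseteq> I" using i by simp
      fix j assume "j \<in> I - {i}"
      then show "0 \<le> - (l j * (Phinv (t j k) - a))"
        using tb[of j k] \<eta> l_pos[of j] by (auto intro!: mult_nonneg_nonpos wneg)
    qed
    then have "Phi (a + (\<Sum>j\<in>I. l j * (Phinv (t j k) - a))) \<le> Phi (a + l i * (Phinv \<eta> - a))" by (simp add: te)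
    also have "\<dots> \<le> (\<Sum>i\<in>I. Phi (a + l i * (Phinv \<eta> - a)))"
      by (rule member_le_sum[OF i]) (auto simp: finite_I)
    finally show False using big[of k] H0 e unfolding t_def by linarith
  qed
  have "\<exists>c\<in>C i. t i k - 1 / real (Suc k) < snd c - real k * nrm n (\<lambda>q. proj i (y k i) q - proj i (fst c) q)" if i: "i \<in> I" for i k
    using upper_env_witness[where k=k and y="y k i" and e="1 / real (Suc k)", OF i C(2)[OF i] Cz[OF i] \<eta>(2)] tgt[OF i, of k] by (simp add: t_def)
  then obtain c where c: "\<And>i k. i \<in> I \<Longrightarrow> c i k \<in> C i"
    "\<And>i k. i \<in> I \<Longrightarrow> t i k - 1 / real (Suc k) < snd (c i k) - real k * nrm n (\<lambda>q. proj i (y k i) q - proj i (fst (c i k)) q)"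
    by metis
  have cb1: "0 \<le> snd (c i k)" "snd (c i k) \<le> U i (fst (c i k))" "snd (c i k) \<le> Phi a" if "i \<in> I" for i k
    using C(3)[OF that, of "fst (c i k)" "snd (c i k)"] c(1)[OF that, of k] U1[OF that, of "fst (c i k)"] Phi_bounds(2)[of a] by auto
  \<comment> \<open>The envelope values are included, so that a single subsequence converges for
    points, heights and values.\<close>
  have "\<exists>r M. strict_mono r \<and> (\<forall>i\<in>I. M i \<in> C i \<times> {\<eta>..Phi a} \<and> (\<lambda>k. (c i (r k), t i (r k))) \<longlonglongrightarrow> M i)"
    by (rule common_subsequence[OF finite_I]) (use C(1) c(1) tb in \<open>auto intro!: compact_Times\<close>)
  then obtain r M where r: "strict_mono r" and M: "\<And>i. i \<in> I \<Longrightarrow> M i \<in> C i \<times> {\<eta>..Phi a}"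
    "\<And>i. i \<in> I \<Longrightarrow> (\<lambda>k. (c i (r k), t i (r k))) \<longlonglongrightarrow> M i" by blast
  define ys where "ys i = fst (fst (M i))" for i
  define ths where "ths i = snd (fst (M i))" for i
  define ts where "ts i = snd (M i)" for i
  have lim_y: "(\<lambda>k. fst (c i (r k)) q) \<longlonglongrightarrow> ys i q" if i: "i \<in> I" for i q
  proof -
    have "(\<lambda>k. fst (c i (r k))) \<longlonglongrightarrow> ys i" using tendsto_fst[OF tendsto_fst[OF M(2)[OF i]]] by (simp add: ys_def)
    then show ?thesis by (rule isCont_tendsto_compose[OF isCont_coord])
  qed
  have lim_th: "(\<lambda>k. snd (c i (r k))) \<longlonglongrightarrow> ths i" if i: "i \<in> I" for i
    using tendsto_snd[OF tendsto_fst[OF M(2)[OF i]]] by (simp add: ths_def)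
  have lim_t: "(\<lambda>k. t i (r k)) \<longlonglongrightarrow> ts i" if i: "i \<in> I" for i
    using tendsto_snd[OF M(2)[OF i]] by (simp add: ts_def)
  have tsb: "\<eta> \<le> ts i" "ts i \<le> Phi a" if "i \<in> I" for i using M(1)[OF that] by (auto simp: ts_def)
  have invSuc: "(\<lambda>k. 1 / real (Suc (r k))) \<longlonglongrightarrow> 0"
    using LIMSEQ_subseq_LIMSEQ[OF LIMSEQ_inverse_real_of_nat r] by (simp add: o_def inverse_eq_divide)
  have ts_le: "ts i \<le> ths i" if i: "i \<in> I" for i
  proof (rule LIMSEQ_le)
    show "(\<lambda>k. t i (r k) - 1 / real (Suc (r k))) \<longlonglongrightarrow> ts i" using tendsto_diff[OF lim_t[OF i] invSuc] by simp
    show "(\<lambda>k. snd (c i (r k))) \<longlonglongrightarrow> ths i" by (rule lim_th[OF i])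
    have "t i k - 1 / real (Suc k) \<le> snd (c i k)" for k
      using c(2)[OF i, of k] mult_nonneg_nonneg[OF of_nat_0_le_iff[of k] nrm_nonneg[of n "\<lambda>q. proj i (y k i) q - proj i (fst (c i k)) q"]] by linarith
    then show "\<exists>N. \<forall>k\<ge>N. t i (r k) - 1 / real (Suc (r k)) \<le> snd (c i (r k))" by blast
  qed
  have thsU: "ths i \<le> U i (ys i)" if "i \<in> I" for i
    using C(3)[OF that, of "ys i" "ths i"] M(1)[OF that] by (auto simp: ys_def ths_def)
  \<comment> \<open>The penalty, k times the distance, is less than the height minus
    \<open>t i k\<close> plus 1/(k+1), hence at most 2.\<close>
  have small: "\<bar>proj i (y k i) q - proj i (fst (c i k)) q\<bar> \<le> 2 * (1 / real k)" if i: "i \<in> I" and q: "q < n" and k: "1 \<le> k" for i q k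
  proof -
    have "\<bar>proj i (y k i) q - proj i (fst (c i k)) q\<bar> \<le> nrm n (\<lambda>q. proj i (y k i) q - proj i (fst (c i k)) q)"
    proof -
      have "(\<bar>proj i (y k i) q - proj i (fst (c i k)) q\<bar>)\<^sup>2 \<le> (\<Sum>q<n. (proj i (y k i) q - proj i (fst (c i k)) q)\<^sup>2)"
        unfolding power2_abs by (rule member_le_sum) (use q in auto)
      then show ?thesis unfolding nrm_def L2_set_def by (rule real_le_rsqrt)
    qed
    moreover have "real k * nrm n (\<lambda>q. proj i (y k i) q - proj i (fst (c i k)) q) \<le> 2"
    proof -
      have "1 / real (Suc k) \<le> 1" by simp
      then show ?thesis using c(2)[OF i, of k] cb1(3)[OF i, of k] Phi_bounds(2)[of a] tb(1)[OF i, of k] \<eta>(1) by linarith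
    qed
    then have "nrm n (\<lambda>q. proj i (y k i) q - proj i (fst (c i k)) q) \<le> 2 * (1 / real k)"
      using k by (simp add: field_simps)
    ultimately show ?thesis by linarith
  qed
  \<comment> \<open>The selected points of the \<open>C i\<close> lie in the fibre over
    \<open>z\<close> only asymptotically; by \<open>small\<close> their limit lies in it
    exactly.\<close>
  have comb_ys: "comb ys q = z q" if q: "q < n" for q
  proof -
    have d0: "(\<lambda>k. proj i (y (r k) i) q - proj i (fst (c i (r k))) q) \<longlonglongrightarrow> 0" if i: "i \<in> I" for i
    proof (rule Lim_null_comparison)
      have "k \<le> r k" for k using r by (rule seq_suble)
      then have "\<And>k. 1 \<le> k \<Longrightarrow> norm (proj i (y (r k) i) q - proj i (fst (c i (r k))) q) \<le> 2 * (1 / real (r k))"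
        using small[OF i q] by (metis order_trans real_norm_def)
      then show "\<forall>\<^sub>F k in sequentially. norm (proj i (y (r k) i) q - proj i (fst (c i (r k))) q) \<le> 2 * (1 / real (r k))"
        by (auto simp: eventually_sequentially)
      show "(\<lambda>k. 2 * (1 / real (r k))) \<longlonglongrightarrow> 0"
        using LIMSEQ_subseq_LIMSEQ[OF lim_1_over_n r] by (intro tendsto_mult_right_zero) (simp add: o_def)
    qed
    have p: "(\<lambda>k. proj i (fst (c i (r k))) q) \<longlonglongrightarrow> proj i (ys i) q" if i: "i \<in> I" for i
      unfolding proj_def using q by (auto intro!: tendsto_intros lim_y[OF i])
    have "(\<lambda>k. comb (\<lambda>i. fst (c i (r k))) q) \<longlonglongrightarrow> comb ys q"
      unfolding comb_def by (intro tendsto_intros p)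
    moreover have "(\<lambda>k. (\<Sum>i\<in>I. l i * (proj i (y (r k) i) q - proj i (fst (c i (r k))) q))) \<longlonglongrightarrow> (\<Sum>i\<in>I. l i * 0)"
      by (intro tendsto_intros d0)
    ultimately have "(\<lambda>k. comb (\<lambda>i. fst (c i (r k))) q + (\<Sum>i\<in>I. l i * (proj i (y (r k) i) q - proj i (fst (c i (r k))) q))) \<longlonglongrightarrow> comb ys q + (\<Sum>i\<in>I. l i * 0)"
      by (rule tendsto_add)
    moreover have "comb (\<lambda>i. fst (c i (r k))) q + (\<Sum>i\<in>I. l i * (proj i (y (r k) i) q - proj i (fst (c i (r k))) q)) = z q" for k
      using y[OF q, of "r k"] by (simp add: comb_def sum.distrib[symmetric] algebra_simps)
    ultimately show ?thesis by (simp add: LIMSEQ_const_iff)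
  qed
  have Phi_a: "Phi a < 1" by simp
  have "(\<lambda>k. Phi (a + (\<Sum>i\<in>I. l i * (Phinv (t i (r k)) - a)))) \<longlonglongrightarrow> Phi (a + (\<Sum>i\<in>I. l i * (Phinv (ts i) - a)))"
  proof (rule isCont_tendsto_compose[OF isCont_Phi], intro tendsto_intros)
    fix i assume i: "i \<in> I"
    show "(\<lambda>k. Phinv (t i (r k))) \<longlonglongrightarrow> Phinv (ts i)"
      by (rule isCont_tendsto_compose[OF isCont_Phinv lim_t[OF i]]) (use tsb[OF i] \<eta> Phi_a in linarith)+
  qed
  then have "H z + (\<Sum>i\<in>I. Phi (a + l i * (Phinv \<eta> - a))) + e \<le> Phi (a + (\<Sum>i\<in>I. l i * (Phinv (ts i) - a)))"
    by (rule LIMSEQ_le_const) (use big in \<open>auto simp: t_def intro!: exI[of _ 0] less_imp_le\<close>)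
  also have "\<dots> \<le> Phi (a + (\<Sum>i\<in>I. l i * (Phinv (U i (ys i)) - a)))"
  proof -
    have "(\<Sum>i\<in>I. l i * (Phinv (ts i) - a)) \<le> (\<Sum>i\<in>I. l i * (Phinv (U i (ys i)) - a))"
    proof (intro sum_mono mult_left_mono)
      fix i assume i: "i \<in> I"
      have "Phinv (ts i) \<le> Phinv (U i (ys i))"
        by (rule Phinv_mono) (use tsb[OF i] \<eta> ts_le[OF i] thsU[OF i] U1[OF i, of "ys i"] Phi_a in linarith)+
      then show "Phinv (ts i) - a \<le> Phinv (U i (ys i)) - a" by simp
    qed (auto intro: less_imp_le[OF l_pos])
    then show ?thesis by simp
  qed
  also have "\<dots> \<le> H z"
  proof (rule start[OF _ comb_ys])
    fix i assume "i \<in> I"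
    then show "0 < U i (ys i)" using tsb[of i] \<eta> ts_le[of i] thsU[of i] by linarith
  qed
  finally show False using e sum_nonneg[of I "\<lambda>i. Phi (a + l i * (Phinv \<eta> - a))"] by simp
qed

end

context projections begin

text \<open>The Lipschitz case is applied to the envelopes with the least admissible right-hand
  side, the fibrewise supremum \<open>HN k\<close>. Dominated convergence then brings back
  \<open>H\<close>, up to the cut-off sum, which stems from points where some envelope equals
  \<eta>.\<close>

lemma ehrhard_borel_approx:
  assumes \<eta>: "0 < \<eta>" "\<eta> \<le> Phi a"
    and Um: "\<And>i. i \<in> I \<Longrightarrow> U i \<in> borel_measurable borel"
    and U0: "\<And>i x. i \<in> I \<Longrightarrow> 0 \<le> U i x" and U1: "\<And>i x. i \<in> I \<Longrightarrow> U i x \<le> Phi a"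
    and Hm[measurable]: "H \<in> borel_measurable borel" and H0: "\<And>x. 0 \<le> H x" and H1: "\<And>x. H x \<le> 1"
    and start: "\<And>z y. (\<And>i. i \<in> I \<Longrightarrow> 0 < U i (y i)) \<Longrightarrow> (\<And>q. q < n \<Longrightarrow> comb y q = z q) \<Longrightarrow>
      Phi (a + (\<Sum>i\<in>I. l i * (Phinv (U i (y i)) - a))) \<le> H z"
    and pos: "\<And>i. i \<in> I \<Longrightarrow> \<eta> < (\<integral>\<omega>. U i \<omega> \<partial>gauss)"
  shows "Phi (a + (\<Sum>i\<in>I. l i * (Phinv ((\<integral>\<omega>. U i \<omega> \<partial>gauss) - \<eta>) - a)))
    \<le> (\<integral>\<omega>. H \<omega> \<partial>gauss) + (\<Sum>i\<in>I. Phi (a + l i * (Phinv \<eta> - a)))"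
proof -
  define \<kappa> where "\<kappa> = (\<Sum>i\<in>I. Phi (a + l i * (Phinv \<eta> - a)))"
  have \<kappa>0: "0 \<le> \<kappa>" unfolding \<kappa>_def by (intro sum_nonneg) simp
  have Pa: "Phi a < 1" by simp
  have "\<exists>C. compact C \<and> (\<forall>y \<theta>. (y, \<theta>) \<in> C \<longrightarrow> 0 \<le> \<theta> \<and> \<theta> \<le> U i y) \<and>
      (\<forall>G. G \<in> borel_measurable borel \<longrightarrow> (\<forall>x. 0 \<le> G x) \<longrightarrow> (\<forall>x. G x \<le> 1) \<longrightarrow> (\<forall>y \<theta>. (y, \<theta>) \<in> C \<longrightarrow> \<theta> \<le> G y) \<longrightarrow>
       (\<integral>\<omega>. U i \<omega> \<partial>gauss) - \<eta> \<le> (\<integral>\<omega>. G \<omega> \<partial>gauss))" if i: "i \<in> I" for i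
  proof -
    have "U i x \<le> 1" for x using U1[OF i, of x] Pa by linarith
    from hypograph_compact[OF Um[OF i] U0[OF i] this \<eta>(1)] show ?thesis by metis
  qed
  then obtain C where C: "\<And>i. i \<in> I \<Longrightarrow> compact (C i)"
      "\<And>i y \<theta>. i \<in> I \<Longrightarrow> (y, \<theta>) \<in> C i \<Longrightarrow> 0 \<le> \<theta> \<and> \<theta> \<le> U i y"
      "\<And>i G. i \<in> I \<Longrightarrow> G \<in> borel_measurable borel \<Longrightarrow> (\<And>x. 0 \<le> G x) \<Longrightarrow> (\<And>x. G x \<le> 1) \<Longrightarrow>
        (\<And>y \<theta>. (y, \<theta>) \<in> C i \<Longrightarrow> \<theta> \<le> G y) \<Longrightarrow> (\<integral>\<omega>. U i \<omega> \<partial>gauss) - \<eta> \<le> (\<integral>\<omega>. G \<omega> \<partial>gauss)"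
    by metis
  \<comment> \<open>Otherwise the zero function would qualify as lying above \<open>C i\<close>, and
    its integral would be at least the mean of \<open>U i\<close> minus \<eta>, which is
    positive.\<close>
  have Cne: "C i \<noteq> {}" if i: "i \<in> I" for i
    using C(3)[OF i, of "\<lambda>_. 0"] pos[OF i] by auto
  have Cz: "\<theta> \<le> Phi a" if "i \<in> I" "(y, \<theta>) \<in> C i" for i y \<theta>
    using C(2)[OF that] U1[OF that(1), of y] by linarith
  define V where "V k i = upper_env i \<eta> (C i) k" for k i
  have Vb: "\<eta> \<le> V k i x" "V k i x \<le> Phi a" if i: "i \<in> I" for k i x
    unfolding V_def using upper_env_bounds[OF i Cne[OF i] Cz[OF i] \<eta>(2)] by auto
  have Vinv: "V k i (proj i x) = V k i x" if i: "i \<in> I" for k i x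
    unfolding V_def using upper_env_invariant[OF i Cne[OF i] Cz[OF i] \<eta>(2)] .
  have Vlip: "\<bar>V k i (\<lambda>q. x q + y q) - V k i x\<bar> \<le> real k * nrm n y" if i: "i \<in> I" for k i x y
    unfolding V_def using upper_env_lipschitz[OF i Cne[OF i] Cz[OF i] \<eta>(2)] .
  have Vm: "V k i \<in> borel_measurable borel" if i: "i \<in> I" for k i
    by (rule borel_measurable_nrm_lipschitz[OF Vlip[OF i]])
  have Vanti: "V k' i x \<le> V k i x" if i: "i \<in> I" and k: "k \<le> k'" for k k' i x
    unfolding V_def using upper_env_antimono[OF i Cne[OF i] Cz[OF i] \<eta>(2) k] .
  have Vint: "(\<integral>\<omega>. U i \<omega> \<partial>gauss) - \<eta> \<le> (\<integral>\<omega>. V k i \<omega> \<partial>gauss)" "(\<integral>\<omega>. V k i \<omega> \<partial>gauss) \<le> Phi a" if i: "i \<in> I" for k i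
  proof -
    have v01: "0 \<le> V k i x" "V k i x \<le> 1" for x using Vb[OF i, of k x] \<eta> Pa by linarith+
    show "(\<integral>\<omega>. U i \<omega> \<partial>gauss) - \<eta> \<le> (\<integral>\<omega>. V k i \<omega> \<partial>gauss)"
    proof (rule C(3)[OF i Vm[OF i] v01])
      fix y \<theta> assume y: "(y, \<theta>) \<in> C i"
      show "\<theta> \<le> V k i y" unfolding V_def by (rule upper_env_above[OF i Cne[OF i] Cz[OF i] \<eta>(2) y])
    qed
    have "heat 1 (V k i) (\<lambda>_. 0) \<le> Phi a" by (rule heat_bounds(2)[OF Vm[OF i] Vb[OF i]])
    then show "(\<integral>\<omega>. V k i \<omega> \<partial>gauss) \<le> Phi a" by (simp add: heat_def)
  qed
  define S where "S k y = a + (\<Sum>i\<in>I. l i * (Phinv (V k i (y i)) - a))" for k y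
  define HN where "HN k z = (SUP y\<in>{y. \<forall>q<n. comb y q = z q}. Phi (S k y))" for k z
  have ne: "{y. \<forall>q<n. comb y q = z q} \<noteq> {}" for z
  proof -
    have "comb (\<lambda>_. z) q = z q" if "q < n" for q using sum_proj[OF that] by (simp add: comb_def)
    then show ?thesis by blast
  qed
  have bdd: "bdd_above ((\<lambda>y. Phi (S k y)) ` {y. \<forall>q<n. comb y q = z q})" for k z
    by (auto intro!: bdd_aboveI[of _ 1])
  have HNup: "Phi (S k y) \<le> HN k z" if "\<And>q. q < n \<Longrightarrow> comb y q = z q" for k y z
    unfolding HN_def by (rule cSUP_upper[OF _ bdd]) (use that in simp)
  have HN0: "0 \<le> HN k z" for k z
  proof -
    obtain y where "\<forall>q<n. comb y q = z q" using ne[of z] by blast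
    then have "Phi (S k y) \<le> HN k z" by (intro HNup) auto
    then show ?thesis using Phi_bounds(3)[of "S k y"] by linarith
  qed
  have HN1: "HN k z \<le> 1" for k z unfolding HN_def by (rule cSUP_least[OF ne]) simp
  have HNanti: "HN k' z \<le> HN k z" if "k \<le> k'" for k k' z
    unfolding HN_def[of k']
  proof (rule cSUP_least[OF ne])
    fix y assume y: "y \<in> {y. \<forall>q<n. comb y q = z q}"
    have "S k' y \<le> S k y"
      unfolding S_def
    proof (intro add_left_mono sum_mono mult_left_mono diff_right_mono)
      fix i assume i: "i \<in> I"
      show "Phinv (V k' i (y i)) \<le> Phinv (V k i (y i))"
        by (rule Phinv_mono) (use Vb[OF i, of k' "y i"] Vb[OF i, of k "y i"] Vanti[OF i that, of "y i"] \<eta> Pa in linarith)+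
    qed (auto intro: less_imp_le[OF l_pos])
    then have "Phi (S k' y) \<le> Phi (S k y)" by simp
    also have "\<dots> \<le> HN k z" by (rule HNup) (use y in auto)
    finally show "Phi (S k' y) \<le> HN k z" .
  qed
  obtain K where K: "K \<ge> 1" 
    "\<And>u w. \<eta> \<le> u \<Longrightarrow> u \<le> Phi a \<Longrightarrow> \<eta> \<le> w \<Longrightarrow> w \<le> Phi a \<Longrightarrow> \<bar>Phinv u - Phinv w\<bar> \<le> K * \<bar>u - w\<bar>"
    by (rule Phinv_smooth[OF \<eta> Pa]) (rule that, assumption+)
  have Philip: "Phi u \<le> Phi w + (u - w)" if "w \<le> u" for u w
  proof (cases "u = w")
    case False
    then have "w < u" using that by simp
    then obtain t where "Phi u - Phi w = (u - w) * std_normal_density t"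
      using MVT2[of w u Phi std_normal_density] Phi_deriv by blast
    then show ?thesis using mult_left_mono[OF phi_bounds(1)[of t], of "u - w"] that by simp
  qed simp
  \<comment> \<open>Subtracting \<open>w\<close> from every \<open>y i\<close> maps the fibre over z
    + w to the fibre over z and changes each envelope by at most k |w|. So \<open>HN k\<close> is
    Lipschitz, which also yields its measurability.\<close>
  have HNhalf: "HN k (\<lambda>q. z q + w q) \<le> HN k z + (lsum * K * real k) * nrm n w" for k z w
    unfolding HN_def[of k "\<lambda>q. z q + w q"]
  proof (rule cSUP_least[OF ne])
    fix y assume y: "y \<in> {y. \<forall>q<n. comb y q = z q + w q}"
    define y' where "y' = (\<lambda>i q. y i q + - w q)"
    define d where "d = (lsum * K * real k) * nrm n w"
    have d0: "0 \<le> d" unfolding d_def using lsum_nonneg K(1) by (intro mult_nonneg_nonneg) auto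
    have "S k y \<le> S k y' + d"
    proof -
      have "(\<Sum>i\<in>I. l i * (Phinv (V k i (y i)) - a)) \<le> (\<Sum>i\<in>I. l i * (Phinv (V k i (y' i)) - a) + l i * (K * (real k * nrm n w)))"
      proof (intro sum_mono)
        fix i assume i: "i \<in> I"
        have "V k i (\<lambda>q. y' i q + w q) = V k i (y i)" by (simp add: y'_def)
        then have "K * \<bar>V k i (y i) - V k i (y' i)\<bar> \<le> K * (real k * nrm n w)"
          using Vlip[OF i, of k "y' i" w] K(1) by (intro mult_left_mono) auto
        then have "Phinv (V k i (y i)) - a \<le> Phinv (V k i (y' i)) - a + K * (real k * nrm n w)"
          using K(2)[OF Vb[OF i, of k "y i"] Vb[OF i, of k "y' i"]] by linarith
        from mult_left_mono[OF this less_imp_le[OF l_pos[OF i]]]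
        show "l i * (Phinv (V k i (y i)) - a) \<le> l i * (Phinv (V k i (y' i)) - a) + l i * (K * (real k * nrm n w))"
          by (simp add: distrib_left)
      qed
      also have "\<dots> = (\<Sum>i\<in>I. l i * (Phinv (V k i (y' i)) - a)) + d"
        by (simp add: sum.distrib d_def lsum_def sum_distrib_left sum_distrib_right mult_ac)
      finally show ?thesis by (simp add: S_def)
    qed
    then have "Phi (S k y) \<le> Phi (S k y' + d)" by simp
    also have "\<dots> \<le> Phi (S k y') + d" using Philip[of "S k y'" "S k y' + d"] d0 by simp
    also have "Phi (S k y') \<le> HN k z"
    proof (rule HNup)
      fix q assume "q < n"
      then show "comb y' q = z q" unfolding y'_def using comb_shift[of q y "\<lambda>q. - w q"] y by simp
    qed
    finally show "Phi (S k y) \<le> HN k z + (lsum * K * real k) * nrm n w" by (simp add: d_def)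
  qed
  have HNm[measurable]: "HN k \<in> borel_measurable borel" for k
  proof (rule borel_measurable_nrm_lipschitz)
    fix x y :: "nat \<Rightarrow> real"
    show "\<bar>HN k (\<lambda>q. x q + y q) - HN k x\<bar> \<le> (lsum * K * real k) * nrm n y"
      using HNhalf[of k x y] HNhalf[of k "\<lambda>q. x q + y q" "\<lambda>q. -1 * y q"] unfolding nrm_scale
      by (simp add: abs_le_iff)
  qed
  define Q where "Q = Phi (a + (\<Sum>i\<in>I. l i * (Phinv ((\<integral>\<omega>. U i \<omega> \<partial>gauss) - \<eta>) - a)))"
  have QH: "Q \<le> (\<integral>\<omega>. HN k \<omega> \<partial>gauss)" for k
  proof -
    have "Phi (a + (\<Sum>i\<in>I. l i * (Phinv (\<integral>\<omega>. V k i \<omega> \<partial>gauss) - a))) \<le> (\<integral>\<omega>. HN k \<omega> \<partial>gauss)"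
    proof (rule ehrhard_lipschitz[OF \<eta> Pa order_refl Vm Vb Vinv Vlip _ HNm])
      show "\<bar>HN k x\<bar> \<le> 1" for x using HN0[of k x] HN1[of k x] by simp
      show "Phi (a + (\<Sum>i\<in>I. l i * (Phinv (V k i (y i)) - a))) \<le> HN k z" if "\<And>q. q < n \<Longrightarrow> comb y q = z q" for z y
        using HNup[of y z k] that by (simp add: S_def)
    qed auto
    moreover have "Q \<le> Phi (a + (\<Sum>i\<in>I. l i * (Phinv (\<integral>\<omega>. V k i \<omega> \<partial>gauss) - a)))"
      unfolding Q_def Phi_le_iff
    proof (intro add_left_mono sum_mono mult_left_mono diff_right_mono)
      fix i assume i: "i \<in> I"
      show "Phinv ((\<integral>\<omega>. U i \<omega> \<partial>gauss) - \<eta>) \<le> Phinv (\<integral>\<omega>. V k i \<omega> \<partial>gauss)"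
        by (rule Phinv_mono) (use Vint[OF i, of k] pos[OF i] Pa in linarith)+
    qed (auto intro: less_imp_le[OF l_pos])
    ultimately show ?thesis by linarith
  qed
  \<comment> \<open>Only an upper bound for the limit of \<open>HN k z\<close> is known; the maximum
    with this bound has an actual limit, as dominated convergence demands.\<close>
  have lim: "(\<lambda>k. max (HN k z) (H z + \<kappa>)) \<longlonglongrightarrow> H z + \<kappa>" for z
  proof (rule LIMSEQ_I)
    fix e :: real assume e: "0 < e"
    have "\<exists>k0. HN k0 z \<le> H z + \<kappa> + e / 2"
    proof (rule ccontr)
      assume "\<not> ?thesis"
      then have "\<forall>k. \<exists>y. (\<forall>q<n. comb y q = z q) \<and> H z + \<kappa> + e / 2 < Phi (S k y)"
        unfolding HN_def not_ex not_le using less_cSUP_iff[OF ne bdd] by blast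
      then obtain y where y: "\<And>k q. q < n \<Longrightarrow> comb (y k) q = z q" "\<And>k. H z + \<kappa> + e / 2 < Phi (S k (y k))" by metis
      show False
      proof (rule upper_env_limit[OF \<eta> U1 C(1) Cne C(2) start])
        show "0 \<le> H z" by (rule H0)
        show "0 < e / 2" using e by simp
        show "\<And>k q. q < n \<Longrightarrow> comb (y k) q = z q" by (rule y(1))
        show "\<And>k. H z + (\<Sum>i\<in>I. Phi (a + l i * (Phinv \<eta> - a))) + e / 2 < Phi (a + (\<Sum>i\<in>I. l i * (Phinv (upper_env i \<eta> (C i) k (y k i)) - a)))"
          using y(2) by (simp add: \<kappa>_def S_def V_def)
      qed
    qed
    then obtain k0 where k0: "HN k0 z \<le> H z + \<kappa> + e / 2" by blast
    show "\<exists>k0. \<forall>k\<ge>k0. norm (max (HN k z) (H z + \<kappa>) - (H z + \<kappa>)) < e"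
    proof (intro exI[of _ k0] allI impI)
      fix k assume "k0 \<le> k"
      then have "HN k z \<le> H z + \<kappa> + e / 2" using HNanti[of k0 k z] k0 by linarith
      then show "norm (max (HN k z) (H z + \<kappa>) - (H z + \<kappa>)) < e" using e by (auto simp: max_def)
    qed
  qed
  have Hi: "integrable gauss H" by (intro gauss.integrable_const_bound[where B=1]) (use H0 H1 in auto)
  have "(\<lambda>k. \<integral>z. max (HN k z) (H z + \<kappa>) \<partial>gauss) \<longlonglongrightarrow> (\<integral>z. H z + \<kappa> \<partial>gauss)"
  proof (rule integral_dominated_convergence[where w="\<lambda>_. 1 + \<kappa>"])
    have "norm (max (HN k z) (H z + \<kappa>)) \<le> 1 + \<kappa>" for k z
      using HN0[of k z] HN1[of k z] H0[of z] H1[of z] \<kappa>0 by (auto simp: max_def)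
    then show "AE z in gauss. norm (max (HN k z) (H z + \<kappa>)) \<le> 1 + \<kappa>" for k by simp
    show "AE z in gauss. (\<lambda>k. max (HN k z) (H z + \<kappa>)) \<longlonglongrightarrow> H z + \<kappa>" using lim by simp
  qed auto
  then have "Q \<le> (\<integral>z. H z + \<kappa> \<partial>gauss)"
  proof (rule LIMSEQ_le_const, intro exI allI impI)
    fix k :: nat
    have "(\<integral>\<omega>. HN k \<omega> \<partial>gauss) \<le> (\<integral>z. max (HN k z) (H z + \<kappa>) \<partial>gauss)"
    proof (rule integral_mono)
      show "integrable gauss (HN k)" by (intro gauss.integrable_const_bound[where B=1]) (use HN0 HN1 in auto)
      then show "integrable gauss (\<lambda>z. max (HN k z) (H z + \<kappa>))" using Hi by simp
    qed simp
    then show "Q \<le> (\<integral>z. max (HN k z) (H z + \<kappa>) \<partial>gauss)" using QH[of k] by linarith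
  qed
  also have "(\<integral>z. H z + \<kappa> \<partial>gauss) = (\<integral>\<omega>. H \<omega> \<partial>gauss) + \<kappa>"
    using Hi by (simp add: gauss.prob_space[unfolded space_gauss])
  finally show ?thesis by (simp add: Q_def \<kappa>_def)
qed

text \<open>Limit of \<eta> to 0. The cut-off sum disappears because \<open>Phinv\<close> tends to
  -\<infinity> at 0 and is multiplied by a strictly positive weight.\<close>

lemma ehrhard_borel:
  assumes Um: "\<And>i. i \<in> I \<Longrightarrow> U i \<in> borel_measurable borel"
    and U0: "\<And>i x. i \<in> I \<Longrightarrow> 0 \<le> U i x" and U1: "\<And>i x. i \<in> I \<Longrightarrow> U i x \<le> Phi a"
    and Hm: "H \<in> borel_measurable borel" and H0: "\<And>x. 0 \<le> H x" and H1: "\<And>x. H x \<le> 1"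
    and start: "\<And>z y. (\<And>i. i \<in> I \<Longrightarrow> 0 < U i (y i)) \<Longrightarrow> (\<And>q. q < n \<Longrightarrow> comb y q = z q) \<Longrightarrow>
      Phi (a + (\<Sum>i\<in>I. l i * (Phinv (U i (y i)) - a))) \<le> H z"
    and pos: "\<And>i. i \<in> I \<Longrightarrow> 0 < (\<integral>\<omega>. U i \<omega> \<partial>gauss)"
  shows "Phi (a + (\<Sum>i\<in>I. l i * (Phinv (\<integral>\<omega>. U i \<omega> \<partial>gauss) - a))) \<le> (\<integral>\<omega>. H \<omega> \<partial>gauss)"
proof -
  define m where "m i = (\<integral>\<omega>. U i \<omega> \<partial>gauss)" for i
  have mb: "0 < m i" "m i < 1" if i: "i \<in> I" for i
  proof -
    have "heat 1 (U i) (\<lambda>_. 0) \<le> Phi a" by (rule heat_bounds(2)[OF Um[OF i] U0[OF i] U1[OF i]])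
    then have "m i \<le> Phi a" by (simp add: heat_def m_def)
    then show "m i < 1" using Phi_bounds(2)[of a] by (rule order.strict_trans1)
    show "0 < m i" using pos[OF i] by (simp add: m_def)
  qed
  have "Phi (a + (\<Sum>i\<in>I. l i * (Phinv (m i) - a))) \<le> (\<integral>\<omega>. H \<omega> \<partial>gauss) + (\<Sum>i\<in>I. 0)"
  proof (rule tendsto_le[of "at_right (0::real)"])
    show "((\<lambda>\<eta>. Phi (a + (\<Sum>i\<in>I. l i * (Phinv (m i - \<eta>) - a)))) \<longlongrightarrow> Phi (a + (\<Sum>i\<in>I. l i * (Phinv (m i) - a)))) (at_right 0)"
    proof (rule isCont_tendsto_compose[OF isCont_Phi], intro tendsto_intros)
      fix i assume i: "i \<in> I"
      have "((\<lambda>\<eta>. m i - \<eta>) \<longlongrightarrow> m i - 0) (at_right 0)" by (intro tendsto_intros)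
      then show "((\<lambda>\<eta>. Phinv (m i - \<eta>)) \<longlongrightarrow> Phinv (m i)) (at_right 0)"
        by (intro isCont_tendsto_compose[OF isCont_Phinv[OF mb[OF i]]]) simp
    qed
    show "((\<lambda>\<eta>. (\<integral>\<omega>. H \<omega> \<partial>gauss) + (\<Sum>i\<in>I. Phi (a + l i * (Phinv \<eta> - a)))) \<longlongrightarrow> (\<integral>\<omega>. H \<omega> \<partial>gauss) + (\<Sum>i\<in>I. 0)) (at_right 0)"
    proof (intro tendsto_intros)
      fix i assume i: "i \<in> I"
      have "filterlim (\<lambda>\<eta>. l i * Phinv \<eta>) at_bot (at_right 0)"
        by (rule filterlim_tendsto_pos_mult_at_bot[OF tendsto_const l_pos[OF i] Phinv_at_0])
      then have "filterlim (\<lambda>\<eta>. (a - l i * a) + l i * Phinv \<eta>) at_bot (at_right 0)"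
        by (subst filterlim_tendsto_add_at_bot_iff[OF tendsto_const])
      then have "filterlim (\<lambda>\<eta>. a + l i * (Phinv \<eta> - a)) at_bot (at_right 0)"
        by (simp add: algebra_simps)
      then show "((\<lambda>\<eta>. Phi (a + l i * (Phinv \<eta> - a))) \<longlongrightarrow> 0) (at_right 0)"
        by (rule filterlim_compose[OF Phi_lim(1)])
    qed
    have ev: "\<forall>\<^sub>F \<eta> in at_right 0. \<eta> < b" if "0 < b" for b :: real
      using that by (auto simp: eventually_at_right_field)
    have "\<forall>\<^sub>F \<eta> in at_right 0. \<forall>i\<in>I. \<eta> < m i"
      by (intro eventually_ball_finite finite_I ballI ev) (use mb in auto)
    moreover have "\<forall>\<^sub>F \<eta> in at_right 0. \<eta> < Phi a" by (rule ev) simp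
    moreover have "\<forall>\<^sub>F \<eta> in at_right (0::real). 0 < \<eta>" by (rule eventually_at_right_less)
    ultimately show "\<forall>\<^sub>F \<eta> in at_right 0. Phi (a + (\<Sum>i\<in>I. l i * (Phinv (m i - \<eta>) - a)))
       \<le> (\<integral>\<omega>. H \<omega> \<partial>gauss) + (\<Sum>i\<in>I. Phi (a + l i * (Phinv \<eta> - a)))"
    proof eventually_elim
      case (elim \<eta>)
      show ?case unfolding m_def
        by (rule ehrhard_borel_approx[OF _ _ Um U0 U1 Hm H0 H1 start]) (use elim in \<open>auto simp: m_def\<close>)
    qed
  qed simp
  then show ?thesis by (simp add: m_def)
qed

end

subsection \<open>Vectors and matrices\<close>

lemma measurable_into_borel_vec:
  assumes "\<And>p. p < d \<Longrightarrow> (\<lambda>x. X x p) \<in> borel_measurable M"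
  shows "(\<lambda>x. Matrix.vec d (X x)) \<in> measurable M (borel_vec d)"
proof -
  have "inj_on (Matrix.vec d) (space (\<Pi>\<^sub>M i\<in>{..<d}. (borel :: real measure)))"
    by (simp add: space_PiM inj_on_vec_PiE)
  then have v: "Matrix.vec d \<in> measurable (\<Pi>\<^sub>M i\<in>{..<d}. (borel :: real measure)) (borel_vec d)"
    unfolding borel_vec_def by (rule measurable_embed_measure2')
  have r: "(\<lambda>x. restrict (X x) {..<d}) \<in> measurable M (\<Pi>\<^sub>M i\<in>{..<d}. borel)"
    by (rule measurable_restrict) (use assms in auto)
  have "Matrix.vec d (restrict (X x) {..<d}) = Matrix.vec d (X x)" for x by (intro eq_vecI) auto
  then show ?thesis using measurable_compose[OF r v] by simp
qed

lemma integral_std_gaussian: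
  assumes f: "f \<in> borel_measurable (borel_vec d)"
  shows "(\<integral>v. f v \<partial>std_gaussian d) = (\<integral>\<omega>. (f (Matrix.vec d \<omega>) :: real) \<partial>gauss)"
proof -
  let ?M = "\<Pi>\<^sub>M i\<in>{..<d}. std_normal_distribution"
  have inj: "inj_on (Matrix.vec d) (space ?M)" by (simp add: space_PiM inj_on_vec_PiE)
  have v: "Matrix.vec d \<in> measurable ?M (std_gaussian d)"
    unfolding std_gaussian_def by (rule measurable_embed_measure2'[OF inj])
  have f': "f \<in> borel_measurable (std_gaussian d)"
    using f by (simp add: measurable_cong_sets[OF sets_std_gaussian refl])
  have e: "std_gaussian d = distr ?M (std_gaussian d) (Matrix.vec d)"
    unfolding std_gaussian_def by (rule embed_measure_eq_distr'[OF inj])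
  have r: "(\<lambda>\<omega>. restrict \<omega> {..<d}) \<in> measurable gauss ?M"
    unfolding gauss_def by (rule measurable_restrict_subset) simp
  have w: "Matrix.vec d (restrict \<omega> {..<d}) = Matrix.vec d \<omega>" for \<omega> :: "nat \<Rightarrow> real" by (intro eq_vecI) auto
  have "(\<integral>v. f v \<partial>std_gaussian d) = (\<integral>x. f (Matrix.vec d x) \<partial>?M)"
    by (subst e) (rule integral_distr[OF v f'])
  also have "\<dots> = (\<integral>x. f (Matrix.vec d x) \<partial>distr gauss ?M (\<lambda>\<omega>. restrict \<omega> {..<d}))"
    by (simp only: distr_gauss_restrict[OF finite_lessThan])
  also have "\<dots> = (\<integral>\<omega>. f (Matrix.vec d \<omega>) \<partial>gauss)"
    by (subst integral_distr[OF r measurable_compose[OF v f']]) (simp add: w)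
  finally show ?thesis .
qed

text \<open>To be applied to the rows of B_i: they are orthonormal, so B_i maps the standard
  Gaussian of the large space to that of the small one, and lifting f_i preserves its
  integral.\<close>

lemma integral_std_gaussian_orthonormal:
  assumes f: "f \<in> borel_measurable (borel_vec d)"
    and b: "\<And>p r. p < d \<Longrightarrow> r < d \<Longrightarrow> (\<Sum>q<n. b p q * b r q) = (if p = r then 1 else 0)"
  shows "(\<integral>\<omega>. (f (Matrix.vec d (\<lambda>p. \<Sum>q<n. b p q * \<omega> q)) :: real) \<partial>gauss) = (\<integral>v. f v \<partial>std_gaussian d)"
proof -
  let ?P = "PiM {..<d} (\<lambda>_. borel :: real measure)"
  have m1: "(\<lambda>\<omega>. \<lambda>p\<in>{..<d}. \<Sum>q<n. b p q * \<omega> q) \<in> measurable gauss ?P"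
    by (rule measurable_restrict) simp
  have m2: "(\<lambda>\<omega>. restrict \<omega> {..<d}) \<in> measurable gauss ?P"
    by (rule measurable_restrict) simp
  have "Matrix.vec d \<in> measurable ?P (borel_vec d)"
    by (rule measurable_into_borel_vec) (auto intro!: measurable_component_singleton)
  from measurable_compose[OF this f] have mf: "(\<lambda>x. f (Matrix.vec d x)) \<in> borel_measurable ?P" .
  have w: "Matrix.vec d (restrict x {..<d}) = Matrix.vec d x" for x :: "nat \<Rightarrow> real" by (intro eq_vecI) auto
  have "(\<integral>\<omega>. f (Matrix.vec d (\<lambda>p. \<Sum>q<n. b p q * \<omega> q)) \<partial>gauss) =
    (\<integral>x. f (Matrix.vec d x) \<partial>distr gauss ?P (\<lambda>\<omega>. \<lambda>p\<in>{..<d}. \<Sum>q<n. b p q * \<omega> q))"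
    by (subst integral_distr[OF m1 mf]) (simp only: w)
  also have "\<dots> = (\<integral>\<omega>. f (Matrix.vec d \<omega>) \<partial>gauss)"
    by (subst gauss_orthonormal_image[where b=b, OF b], assumption+, subst integral_distr[OF m2 mf]) (simp only: w)
  finally show ?thesis by (simp only: integral_std_gaussian[OF f])
qed

lemma finsum_module_mat_index:
  fixes M :: "'b \<Rightarrow> 'a::comm_ring_1 mat"
  assumes "finite F" "\<And>i. i \<in> F \<Longrightarrow> M i \<in> carrier_mat nr nc" "q < nr" "r < nc"
  shows "finsum (module_mat TYPE('a) nr nc) M F $$ (q, r) = (\<Sum>i\<in>F. M i $$ (q, r))"
proof -
  interpret abelian_group "module_mat TYPE('a) nr nc" by (rule abelian_group_mat)
  show ?thesis
    using assms(1,2)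
  proof (induction F rule: finite_induct)
    case empty
    then show ?case using assms(3,4) by (simp add: module_mat_simps)
  next
    case (insert i F)
    have M: "M \<in> F \<rightarrow> carrier_mat nr nc" "M i \<in> carrier_mat nr nc" using insert.prems by auto
    then have c: "finsum (module_mat TYPE('a) nr nc) M F \<in> carrier_mat nr nc"
      using finsum_closed[of M F] by (simp add: module_mat_simps)
    have "finsum (module_mat TYPE('a) nr nc) M (insert i F) = M i + finsum (module_mat TYPE('a) nr nc) M F"
      using finsum_insert[OF insert.hyps, of M] M by (simp add: module_mat_simps)
    then show ?case using c insert assms(3,4) by simp
  qed
qed

subsection \<open>The functions \<open>Phi_inv_c\<close> and \<open>scale_ninf\<close>\<close>

lemma Phi_inv_eq: "0 < p \<Longrightarrow> p < 1 \<Longrightarrow> Phi_inv p = ereal (Phinv p)"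
  by (simp add: Phi_inv_def Phinv_def Phi_def)

lemma Phi_inv_c_eq:
  assumes "0 < c" "c < 1" "0 < t" "t \<le> 1"
  shows "Phi_inv_c c t = ereal (Phinv (c * t) - Phinv c)"
proof -
  have "c * t < 1" using assms mult_left_le[of t c] by linarith
  then show ?thesis using assms by (simp add: Phi_inv_c_def Phi_inv_eq)
qed

lemma Phi_inv_c_0: "0 < c \<Longrightarrow> c < 1 \<Longrightarrow> Phi_inv_c c 0 = -\<infinity>"
  by (simp add: Phi_inv_c_def Phi_inv_eq) (simp add: Phi_inv_def)

lemma scale_ninf_ereal[simp]: "scale_ninf u (ereal x) = ereal (u * x)"
  by (simp add: scale_ninf_def)

lemma scale_ninf_Phi_inv_c_nonpos:
  assumes "0 < c" "c < 1" "0 \<le> t" "t \<le> 1" "0 \<le> u"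
  shows "scale_ninf u (Phi_inv_c c t) \<le> 0"
proof (cases "t = 0")
  case True
  then show ?thesis using assms by (simp add: Phi_inv_c_0 scale_ninf_def)
next
  case False
  have "c * t \<le> c" using assms by (simp add: mult_left_le)
  then have "Phinv (c * t) \<le> Phinv c" using assms False by (intro Phinv_mono) auto
  then show ?thesis using assms False by (simp add: Phi_inv_c_eq mult_nonneg_nonpos)
qed

text \<open>All terms are at most 0, so no +\<infinity> can meet the -\<infinity>.\<close>

lemma sum_eq_MInfty:
  fixes g :: "'a \<Rightarrow> ereal"
  assumes "finite F" "i \<in> F" "g i = -\<infinity>" "\<And>j. j \<in> F \<Longrightarrow> g j \<le> 0"
  shows "sum g F = -\<infinity>"
proof -
  have "sum g F = g i + sum g (F - {i})" by (rule sum.remove[OF assms(1,2)])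
  moreover have "sum g (F - {i}) \<le> 0" by (intro sum_nonpos) (use assms in auto)
  ultimately show ?thesis using assms(3) by auto
qed

theorem theorem4p2:
  fixes k n :: nat and d :: "nat \<Rightarrow> nat"
    and l :: "nat \<Rightarrow> real" and B :: "nat \<Rightarrow> real mat"
    and c :: real
    and f :: "nat \<Rightarrow> real Matrix.vec \<Rightarrow> real" and h :: "real Matrix.vec \<Rightarrow> real"
  assumes l_nonneg: "\<And>i. i \<in> {1..k} \<Longrightarrow> 0 \<le> l i"
    and B_carrier: "\<And>i. i \<in> {1..k} \<Longrightarrow> B i \<in> carrier_mat (d i) n"
    and B_sum: "finsum (module_mat TYPE(real) n n)
                  (\<lambda>i. l i \<cdot>\<^sub>m (transpose_mat (B i) * B i)) {1..k} = 1\<^sub>m n"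
    and B_proj: "\<And>i. i \<in> {1..k} \<Longrightarrow> B i * transpose_mat (B i) = 1\<^sub>m (d i)"
    and c: "0 < c" "c < 1"
    and f_meas: "\<And>i. i \<in> {1..k} \<Longrightarrow> f i \<in> borel_measurable (borel_vec (d i))"
    and f_range: "\<And>i v. i \<in> {1..k} \<Longrightarrow> v \<in> carrier_vec (d i) \<Longrightarrow> f i v \<in> {0..1}"
    and h_meas: "h \<in> borel_measurable (borel_vec n)"
    and h_range: "\<And>v. v \<in> carrier_vec n \<Longrightarrow> h v \<in> {0..1}"
    and le: "\<And>x. (\<And>i. i \<in> {1..k} \<Longrightarrow> x i \<in> carrier_vec (d i)) \<Longrightarrow>
        (\<Sum>i\<in>{1..k}. scale_ninf (l i) (Phi_inv_c c (f i (x i))))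
          \<le> Phi_inv_c c (h (finsum_vec TYPE(real) n
               (\<lambda>i. l i \<cdot>\<^sub>v (transpose_mat (B i) *\<^sub>v x i)) {1..k}))"
  shows "(\<Sum>i\<in>{1..k}. scale_ninf (l i) (Phi_inv_c c (\<integral>v. f i v \<partial>std_gaussian (d i))))
          \<le> Phi_inv_c c (\<integral>v. h v \<partial>std_gaussian n)"
proof -
  define a where "a = Phinv c"
  have Pa: "Phi a = c" using c by (simp add: a_def)
  \<comment> \<open>Only positive weights fit the locale; the remaining indices are frozen at the
    points \<open>xs\<close> below.\<close>
  define I where "I = {i \<in> {1..k}. 0 < l i}"
  define P where "P i q r = (\<Sum>p<d i. B i $$ (p, q) * B i $$ (p, r))" for i q r
  define Bv where "Bv i y = Matrix.vec (d i) (\<lambda>p. \<Sum>q<n. B i $$ (p, q) * y q)" for i and y :: "nat \<Rightarrow> real"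
  \<comment> \<open>The factor \<open>c\<close> places all values below \<open>Phi a\<close>, and
    \<open>Phinv (U i y) - a\<close> is \<open>Phi_inv_c c\<close> of the value of
    \<open>f i\<close> wherever that value is positive.\<close>
  define U where "U i y = c * f i (Bv i y)" for i y
  define H where "H z = c * h (Matrix.vec n z)" for z
  have I: "finite I" "I \<subseteq> {1..k}" "\<And>i. i \<in> I \<Longrightarrow> i \<in> {1..k}" by (auto simp: I_def)
  have l0: "l i = 0" if "i \<in> {1..k} - I" for i using that l_nonneg[of i] by (auto simp: I_def)
  have Bcol: "Bv i y \<in> carrier_vec (d i)" for i y by (simp add: Bv_def)
  have ortho: "(\<Sum>q<n. B i $$ (p, q) * B i $$ (r, q)) = (if p = r then 1 else 0)"
    if i: "i \<in> {1..k}" and p: "p < d i" "r < d i" for i p r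
  proof -
    have "(B i * transpose_mat (B i)) $$ (p, r) = (\<Sum>q<n. B i $$ (p, q) * B i $$ (r, q))"
      using B_carrier[OF i] p by (simp add: scalar_prod_def atLeast0LessThan)
    then show ?thesis using B_proj[OF i] p by simp
  qed
  have Psum: "(\<Sum>i\<in>{1..k}. l i * P i q r) = (if q = r then 1 else 0)" if q: "q < n" "r < n" for q r
  proof -
    have "(l i \<cdot>\<^sub>m (transpose_mat (B i) * B i)) $$ (q, r) = l i * P i q r" if i: "i \<in> {1..k}" for i
      using B_carrier[OF i] q by (simp add: scalar_prod_def P_def atLeast0LessThan)
    moreover have "(\<Sum>i\<in>{1..k}. (l i \<cdot>\<^sub>m (transpose_mat (B i) * B i)) $$ (q, r)) = 1\<^sub>m n $$ (q, r)"
      unfolding B_sum[symmetric]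
    proof (rule finsum_module_mat_index[symmetric])
      fix i assume "i \<in> {1..k}"
      from B_carrier[OF this] show "l i \<cdot>\<^sub>m (transpose_mat (B i) * B i) \<in> carrier_mat n n"
        by (intro carrier_matI) auto
    qed (use q in auto)
    ultimately show ?thesis using q by simp
  qed
  have IP: "(\<Sum>i\<in>I. l i * g i) = (\<Sum>i\<in>{1..k}. l i * g i)" for g :: "nat \<Rightarrow> real"
    by (rule sum.mono_neutral_left) (use I l0 in auto)
  interpret projections n I l P
  proof
    show "finite I" by (rule I(1))
    show "0 < l i" if "i \<in> I" for i using that by (simp add: I_def)
    show "P i q r = P i r q" for i q r by (simp add: P_def mult.commute)
    show "(\<Sum>s<n. P i q s * P i s r) = P i q r" if "i \<in> I" for i q r
    proof -
      have "(\<Sum>s<n. P i q s * P i s r) = (\<Sum>s<n. \<Sum>p<d i. \<Sum>p'<d i. B i $$ (p, q) * B i $$ (p', r) * (B i $$ (p, s) * B i $$ (p', s)))"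
        by (simp add: P_def sum_product mult_ac)
      also have "\<dots> = (\<Sum>p<d i. \<Sum>p'<d i. \<Sum>s<n. B i $$ (p, q) * B i $$ (p', r) * (B i $$ (p, s) * B i $$ (p', s)))"
        by (rule trans[OF sum.swap], rule sum.cong[OF refl], rule sum.swap)
      also have "\<dots> = (\<Sum>p<d i. \<Sum>p'<d i. if p = p' then B i $$ (p, q) * B i $$ (p', r) else 0)"
        unfolding sum_distrib_left[symmetric] by (intro sum.cong refl) (use ortho[OF I(3)[OF that]] in auto)
      also have "\<dots> = P i q r" by (simp add: P_def)
      finally show ?thesis .
    qed
    show "(\<Sum>i\<in>I. l i * P i q r) = (if q = r then 1 else 0)" if "q < n" "r < n" for q r
      unfolding IP by (rule Psum[OF that])
  qed
  have projP: "(\<Sum>p<d i. B i $$ (p, q) * (\<Sum>r<n. B i $$ (p, r) * y r)) = proj i y q" if "q < n" for i q y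
  proof -
    have "(\<Sum>p<d i. B i $$ (p, q) * (\<Sum>r<n. B i $$ (p, r) * y r)) = (\<Sum>r<n. P i q r * y r)"
      unfolding P_def sum_distrib_left sum_distrib_right by (subst sum.swap) (simp add: mult.assoc)
    then show ?thesis using that by (simp add: proj_def)
  qed
  \<comment> \<open>B_i times its adjoint is the identity, so B_i absorbs the projection
    P_i.\<close>
  have Bproj: "Bv i (proj i y) = Bv i y" if i: "i \<in> {1..k}" for i y
    unfolding Bv_def
  proof (rule eq_vecI)
    fix p assume "p < dim_vec (Matrix.vec (d i) (\<lambda>p. \<Sum>q<n. B i $$ (p, q) * y q))"
    then have p: "p < d i" by simp
    have "(\<Sum>q<n. B i $$ (p, q) * proj i y q) = (\<Sum>q<n. \<Sum>s<d i. (B i $$ (p, q) * B i $$ (s, q)) * (\<Sum>r<n. B i $$ (s, r) * y r))"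
      by (intro sum.cong refl) (simp add: projP[symmetric] sum_distrib_left mult.assoc)
    also have "\<dots> = (\<Sum>s<d i. (\<Sum>q<n. B i $$ (p, q) * B i $$ (s, q)) * (\<Sum>r<n. B i $$ (s, r) * y r))"
      unfolding sum_distrib_right by (rule sum.swap)
    also have "\<dots> = (\<Sum>s<d i. if p = s then \<Sum>r<n. B i $$ (s, r) * y r else 0)"
      by (intro sum.cong refl) (use ortho[OF i p] in auto)
    also have "\<dots> = (\<Sum>q<n. B i $$ (p, q) * y q)" using p by simp
    finally show "Matrix.vec (d i) (\<lambda>p. \<Sum>q<n. B i $$ (p, q) * proj i y q) $ p = Matrix.vec (d i) (\<lambda>p. \<Sum>q<n. B i $$ (p, q) * y q) $ p"
      using p by simp
  qed simp
  have f01: "0 \<le> f i v" "f i v \<le> 1" if "i \<in> {1..k}" "v \<in> carrier_vec (d i)" for i v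
    using f_range[OF that] by auto
  have h01: "0 \<le> h v" "h v \<le> 1" if "v \<in> carrier_vec n" for v using h_range[OF that] by auto
  have Fm: "(\<lambda>y. f i (Bv i y)) \<in> borel_measurable borel" if i: "i \<in> {1..k}" for i
    unfolding Bv_def by (rule measurable_compose[OF measurable_into_borel_vec f_meas[OF i]]) simp
  have hm: "(\<lambda>z. h (Matrix.vec n z)) \<in> borel_measurable borel"
    by (rule measurable_compose[OF measurable_into_borel_vec h_meas]) simp
  have intU: "(\<integral>\<omega>. U i \<omega> \<partial>gauss) = c * (\<integral>v. f i v \<partial>std_gaussian (d i))" if i: "i \<in> {1..k}" for i
  proof -
    have "(\<integral>\<omega>. f i (Bv i \<omega>) \<partial>gauss) = (\<integral>v. f i v \<partial>std_gaussian (d i))"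
      unfolding Bv_def by (rule integral_std_gaussian_orthonormal[OF f_meas[OF i] ortho[OF i]])
    then show ?thesis by (simp add: U_def)
  qed
  have intH: "(\<integral>\<omega>. H \<omega> \<partial>gauss) = c * (\<integral>v. h v \<partial>std_gaussian n)"
    unfolding H_def integral_std_gaussian[OF h_meas] by simp
  \<comment> \<open>At time 1 and the origin \<open>heat\<close> is the Gaussian integral, so
    \<open>heat_bounds\<close> yields bounds for integrals.\<close>
  have intf: "0 \<le> (\<integral>v. f i v \<partial>std_gaussian (d i))" "(\<integral>v. f i v \<partial>std_gaussian (d i)) \<le> 1" if i: "i \<in> {1..k}" for i
    using heat_bounds[where t=1 and x="\<lambda>_. 0", OF Fm[OF i] f01[OF i Bcol]] intU[OF i] c by (auto simp: heat_def U_def)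
  have inth: "(\<integral>v. h v \<partial>std_gaussian n) \<le> 1"
    using heat_bounds(2)[OF hm, of 0 1 1 "\<lambda>_. 0"] h01[OF vec_carrier] intH c by (auto simp: heat_def H_def)
  show ?thesis
  \<comment> \<open>A vanishing integral makes the left-hand side -\<infinity> whatever its weight,
    by the convention in \<open>scale_ninf\<close>.\<close>
  proof (cases "\<exists>i\<in>{1..k}. (\<integral>v. f i v \<partial>std_gaussian (d i)) = 0")
    case True
    then obtain i where i: "i \<in> {1..k}" "(\<integral>v. f i v \<partial>std_gaussian (d i)) = 0" by blast
    have "(\<Sum>i\<in>{1..k}. scale_ninf (l i) (Phi_inv_c c (\<integral>v. f i v \<partial>std_gaussian (d i)))) = -\<infinity>"
    proof (rule sum_eq_MInfty[OF _ i(1)])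
      show "scale_ninf (l i) (Phi_inv_c c (\<integral>v. f i v \<partial>std_gaussian (d i))) = -\<infinity>"
        using i(2) c by (simp add: Phi_inv_c_0 scale_ninf_def)
      fix j assume "j \<in> {1..k}"
      then show "scale_ninf (l j) (Phi_inv_c c (\<integral>v. f j v \<partial>std_gaussian (d j))) \<le> 0"
        by (intro scale_ninf_Phi_inv_c_nonpos c intf l_nonneg)
    qed simp
    then show ?thesis by simp
  next
    case False
    then have fpos: "0 < (\<integral>v. f i v \<partial>std_gaussian (d i))" if "i \<in> {1..k}" for i
      using intf(1)[OF that] that by force
    \<comment> \<open>A positive integral requires a positive value. At an index of weight zero such
      a point contributes 0 instead of -\<infinity>, so that the hypothesis keeps its
      content.\<close>
    have "\<exists>v\<in>carrier_vec (d i). 0 < f i v" if i: "i \<in> {1..k}" for i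
    proof (rule ccontr)
      assume "\<not> ?thesis"
      then have "f i (Bv i \<omega>) = 0" for \<omega>
        using f01(1)[OF i Bcol[of i \<omega>]] Bcol[of i \<omega>] by (metis order_le_less)
      then show False using intU[OF i] fpos[OF i] c by (simp add: U_def)
    qed
    then obtain xs where xs: "\<And>i. i \<in> {1..k} \<Longrightarrow> xs i \<in> carrier_vec (d i)" "\<And>i. i \<in> {1..k} \<Longrightarrow> 0 < f i (xs i)"
      by metis
    have start: "Phi (a + (\<Sum>i\<in>I. l i * (Phinv (U i (y i)) - a))) \<le> H z"
      if Up: "\<And>i. i \<in> I \<Longrightarrow> 0 < U i (y i)" and z: "\<And>q. q < n \<Longrightarrow> comb y q = z q" for z y
    proof -
      \<comment> \<open>Lifted points at the positive weights, frozen points elsewhere; the latter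
        do not affect the combination.\<close>
      define x where "x i = (if i \<in> I then Bv i (y i) else xs i)" for i
      have xc: "x i \<in> carrier_vec (d i)" if "i \<in> {1..k}" for i using xs(1)[OF that] Bcol by (simp add: x_def)
      have fx: "0 < f i (x i)" "f i (x i) \<le> 1" if "i \<in> {1..k}" for i
        using Up[of i] xs(2)[OF that] f01(2)[OF that xc[OF that]] c by (auto simp: x_def U_def zero_less_mult_iff)
      have arg: "finsum_vec TYPE(real) n (\<lambda>i. l i \<cdot>\<^sub>v (transpose_mat (B i) *\<^sub>v x i)) {1..k} = Matrix.vec n z" (is "?v = _")
      proof (rule eq_vecI)
        have Bx: "(\<lambda>i. l i \<cdot>\<^sub>v (transpose_mat (B i) *\<^sub>v x i)) \<in> {1..k} \<rightarrow> carrier_vec n"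
          using B_carrier by (auto intro!: smult_carrier_vec[THEN iffD2] mult_mat_vec_carrier xc)
        then show "dim_vec ?v = dim_vec (Matrix.vec n z)" using finsum_vec_closed[OF Bx] by auto
        fix q assume "q < dim_vec (Matrix.vec n z)"
        then have q: "q < n" by simp
        have Tx: "(transpose_mat (B i) *\<^sub>v x i) $ q = (\<Sum>p<d i. B i $$ (p, q) * x i $ p)" if i: "i \<in> {1..k}" for i
          using B_carrier[OF i] xc[OF i] q by (simp add: scalar_prod_def atLeast0LessThan)
        have "?v $ q = (\<Sum>i\<in>{1..k}. (l i \<cdot>\<^sub>v (transpose_mat (B i) *\<^sub>v x i)) $ q)"
          by (rule index_finsum_vec[OF _ q Bx]) simp
        also have "\<dots> = (\<Sum>i\<in>{1..k}. l i * (\<Sum>p<d i. B i $$ (p, q) * x i $ p))"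
        proof (rule sum.cong[OF refl])
          fix i assume i: "i \<in> {1..k}"
          have "q < dim_vec (transpose_mat (B i) *\<^sub>v x i)" using B_carrier[OF i] q by simp
          then show "(l i \<cdot>\<^sub>v (transpose_mat (B i) *\<^sub>v x i)) $ q = l i * (\<Sum>p<d i. B i $$ (p, q) * x i $ p)"
            by (simp only: index_smult_vec Tx[OF i])
        qed
        also have "\<dots> = (\<Sum>i\<in>I. l i * (\<Sum>p<d i. B i $$ (p, q) * x i $ p))" by (rule IP[symmetric])
        also have "\<dots> = (\<Sum>i\<in>I. l i * proj i (y i) q)"
          unfolding projP[OF q, symmetric] by (intro sum.cong refl) (simp add: x_def Bv_def)
        also have "\<dots> = z q" using z[OF q] by (simp add: comb_def)
        finally show "?v $ q = Matrix.vec n z $ q" using q by simp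
      qed
      have L: "(\<Sum>i\<in>{1..k}. scale_ninf (l i) (Phi_inv_c c (f i (x i)))) = ereal (\<Sum>i\<in>I. l i * (Phinv (U i (y i)) - a))"
      proof -
        have "(\<Sum>i\<in>{1..k}. scale_ninf (l i) (Phi_inv_c c (f i (x i)))) = (\<Sum>i\<in>{1..k}. ereal (l i * (Phinv (c * f i (x i)) - a)))"
          by (intro sum.cong refl) (simp add: Phi_inv_c_eq[OF c fx] a_def)
        also have "\<dots> = ereal (\<Sum>i\<in>I. l i * (Phinv (c * f i (x i)) - a))" by (simp add: IP)
        also have "(\<Sum>i\<in>I. l i * (Phinv (c * f i (x i)) - a)) = (\<Sum>i\<in>I. l i * (Phinv (U i (y i)) - a))"
          by (intro sum.cong refl) (simp add: x_def U_def)
        finally show ?thesis .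
      qed
      have *: "ereal (\<Sum>i\<in>I. l i * (Phinv (U i (y i)) - a)) \<le> Phi_inv_c c (h (Matrix.vec n z))"
        using le[of x] xc unfolding arg L by blast
      \<comment> \<open>A real lower bound excludes the value -\<infinity> on the right.\<close>
      have hz: "h (Matrix.vec n z) \<noteq> 0"
        using * c by (auto simp: Phi_inv_c_0)
      then have hp: "0 < h (Matrix.vec n z)" "h (Matrix.vec n z) \<le> 1" using h01[OF vec_carrier[of n z]] by auto
      have "a + (\<Sum>i\<in>I. l i * (Phinv (U i (y i)) - a)) \<le> Phinv (H z)"
        using * by (simp add: Phi_inv_c_eq[OF c hp] a_def H_def)
      then have le': "Phi (a + (\<Sum>i\<in>I. l i * (Phinv (U i (y i)) - a))) \<le> Phi (Phinv (H z))" by simp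
      have "H z \<le> c" using c hp by (simp add: H_def mult_left_le)
      moreover have "0 < H z" using c hp by (simp add: H_def)
      ultimately have "Phi (Phinv (H z)) = H z" using c by simp
      then show ?thesis using le' by (simp only:)
    qed
    have main: "Phi (a + (\<Sum>i\<in>I. l i * (Phinv (\<integral>\<omega>. U i \<omega> \<partial>gauss) - a))) \<le> (\<integral>\<omega>. H \<omega> \<partial>gauss)"
    proof (rule ehrhard_borel[OF _ _ _ _ _ _ start])
      show "U i \<in> borel_measurable borel" if "i \<in> I" for i
        unfolding U_def[abs_def] using Fm[OF I(3)[OF that]] by simp
      show "0 \<le> U i x" "U i x \<le> Phi a" if "i \<in> I" for i x
        using f01[OF I(3)[OF that] Bcol] c by (auto simp: U_def Pa mult_left_le)
      show "H \<in> borel_measurable borel" unfolding H_def[abs_def] using hm by simp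
      show "0 \<le> H x" "H x \<le> 1" for x
        using h01[OF vec_carrier[of n x]] c by (auto simp: H_def mult_le_one)
      show "0 < (\<integral>\<omega>. U i \<omega> \<partial>gauss)" if "i \<in> I" for i
        using intU[OF I(3)[OF that]] fpos[OF I(3)[OF that]] c by simp
    qed
    define hh where "hh = (\<integral>v. h v \<partial>std_gaussian n)"
    \<comment> \<open>Values of \<open>Phi\<close> are positive, so the inequality just obtained
      shows that the integral of \<open>h\<close> does not vanish.\<close>
    have "0 < c * hh" using main Phi_bounds(1) unfolding intH hh_def by (rule less_le_trans[rotated])
    then have hh: "0 < hh" "hh \<le> 1" using c inth by (auto simp: zero_less_mult_iff hh_def)
    have hh1: "c * hh < 1" using c hh mult_left_le[of hh c] by linarith
    have "(\<Sum>i\<in>{1..k}. scale_ninf (l i) (Phi_inv_c c (\<integral>v. f i v \<partial>std_gaussian (d i))))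
      = (\<Sum>i\<in>{1..k}. ereal (l i * (Phinv (\<integral>\<omega>. U i \<omega> \<partial>gauss) - a)))"
      by (intro sum.cong refl) (simp add: Phi_inv_c_eq[OF c fpos intf(2)] a_def intU)
    also have "\<dots> = ereal (\<Sum>i\<in>I. l i * (Phinv (\<integral>\<omega>. U i \<omega> \<partial>gauss) - a))" by (simp add: IP)
    also have "\<dots> \<le> ereal (Phinv (c * hh) - a)"
    proof -
      have "Phi (a + (\<Sum>i\<in>I. l i * (Phinv (\<integral>\<omega>. U i \<omega> \<partial>gauss) - a))) \<le> Phi (Phinv (c * hh))"
        using main c hh hh1 by (simp add: intH hh_def del: Phi_le_iff)
      then show ?thesis by simp
    qed
    also have "\<dots> = Phi_inv_c c (\<integral>v. h v \<partial>std_gaussian n)"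
      using Phi_inv_c_eq[OF c hh] by (simp add: a_def hh_def)
    finally show ?thesis .
  qed
qed

end
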